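(* Let $n\ge 3$, $\gamma\in\mathbb{R}$, $\alpha>1$, $s\in\mathbb{R}$, $q\in[1,\infty]$, $r\in(0,\infty]$ and $T>0$. Assume $$\gamma>-\min(2,n),\qquad \alpha\ge \max\Big(1,1+\frac{\gamma}{n}\Big),\qquad \frac{\gamma}{\alpha-1}< s\le n,\qquad \alpha\le q\le\infty,\qquad 0<r\le\infty,\qquad \frac sn+\frac1q>0,$$ and assume moreover the exponent condition: either $\frac sn+\frac1q<1$, or $\frac sn+\frac1q=1$ and $r\le1$. Put $q_c=\frac{n(\alpha-1)}{2+\gamma}$ and $Q_c=\frac{n\alpha}{n+\gamma}$. Suppose that either (i) $\frac sn+\frac1q=\frac1{q_c}<\frac1{Q_c}$, $q<\infty$ and $r=\infty$; or (ii) $\frac sn+\frac1q=\frac1{q_c}=\frac1{Q_c}$ and either ($q<\infty$ and $r\le\alpha-1$) or ($q\le\infty$ and $r\le\min(1,\alpha-1)$). Then for any initial datum $u_0\in\dot{\mathcal K}^s_{q,r}(\mathbb{R}^n)$, solutions of the Hardy–Hénon parabolic equation in $C([0,T];\dot{\mathcal K}^s_{q,r}(\mathbb{R}^n))$ are unique: if $u_1,u_2\in C([0,T];\dot{\mathcal K}^s_{q,r}(\mathbb{R}^n))$ are both solutions with initial datum $u_0$, then $u_1=u_2$ on $[0,T]$.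
   Context: For $j\in\mathbb{Z}$ let $A_j=\{x\in\mathbb{R}^n: 2^{j-1}\le|x|<2^j\}$. For $s\in\mathbb{R}$ and $0<q,r\le\infty$, the homogeneous Herz space $\dot K^s_{q,r}(\mathbb{R}^n)$ is the space of measurable $f$ with finite quasi-norm $\|f\|_{\dot K^s_{q,r}}=\big(\sum_{j\in\mathbb{Z}}[2^{js}\|f\chi_{A_j}\|_{L^q}]^r\big)^{1/r}$ (supremum over $j$ if $r=\infty$). $\dot{\mathcal K}^s_{q,r}(\mathbb{R}^n)$ denotes the closure of $C_c^\infty(\mathbb{R}^n)$ in $\dot K^s_{q,r}(\mathbb{R}^n)$. The heat semigroup is $e^{t\Delta}f(x)=(4\pi t)^{-n/2}\int_{\mathbb{R}^n}e^{-|x-y|^2/(4t)}f(y)\,dy$. The Hardy–Hénon parabolic equation is $\partial_t u-\Delta u=|x|^\gamma|u|^{\alpha-1}u$ on $(0,\infty)\times\mathbb{R}^n$, $u(0)=u_0$; a solution on $[0,T]$ with initial datum $u_0$ means a function $u$ with $u(0)=u_0$ satisfying $u(t)=e^{t\Delta}u_0+\int_0^t e^{(t-\tau)\Delta}\big[|\cdot|^\gamma|u(\tau)|^{\alpha-1}u(\tau)\big]\,d\tau$ for $t\in(0,T]$. *)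

theory Defs
  imports "HOL-Analysis.Analysis" "HOL-Probability.Essential_Supremum"
begin

definition epowr :: "ennreal \<Rightarrow> real \<Rightarrow> ennreal" where
  "epowr x p = (if x = top then top else ennreal (enn2real x powr p))"

definition Lq_norm :: "ereal \<Rightarrow> ('a::euclidean_space \<Rightarrow> real) \<Rightarrow> ennreal" where
  "Lq_norm q f =
     (if q = \<infinity> then e2ennreal (esssup lebesgue (\<lambda>x. ereal \<bar>f x\<bar>))
      else epowr (\<integral>\<^sup>+ x. ennreal (\<bar>f x\<bar> powr real_of_ereal q) \<partial>lebesgue) (1 / real_of_ereal q))"

definition annulus :: "int \<Rightarrow> 'a::euclidean_space set" where
  "annulus j = {x. 2 powr (real_of_int j - 1) \<le> norm x \<and> norm x < 2 powr (real_of_int j)}"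

definition herz_norm :: "real \<Rightarrow> ereal \<Rightarrow> ereal \<Rightarrow> ('a::euclidean_space \<Rightarrow> real) \<Rightarrow> ennreal" where
  "herz_norm s q r f =
     (if r = \<infinity> then
        (SUP j::int. ennreal (2 powr (real_of_int j * s)) * Lq_norm q (\<lambda>x. indicator (annulus j) x * f x))
      else epowr (\<Sum>\<^sub>\<infinity> j::int. epowr (ennreal (2 powr (real_of_int j * s))
                     * Lq_norm q (\<lambda>x. indicator (annulus j) x * f x)) (real_of_ereal r))
                 (1 / real_of_ereal r))"

definition herz_space :: "real \<Rightarrow> ereal \<Rightarrow> ereal \<Rightarrow> ('a::euclidean_space \<Rightarrow> real) set" where
  "herz_space s q r = {f. f \<in> borel_measurable lebesgue \<and> herz_norm s q r f < top}"

fun Ck :: "nat \<Rightarrow> ('a::euclidean_space \<Rightarrow> real) \<Rightarrow> bool" where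
  "Ck 0 f = continuous_on UNIV f"
| "Ck (Suc k) f = (continuous_on UNIV f \<and>
     (\<exists>f'. (\<forall>x. (f has_derivative f' x) (at x)) \<and> (\<forall>v. Ck k (\<lambda>x. f' x v))))"

definition Cc_inf :: "('a::euclidean_space \<Rightarrow> real) \<Rightarrow> bool" where
  "Cc_inf f \<longleftrightarrow> (\<forall>k. Ck k f) \<and> compact (closure {x. f x \<noteq> 0})"

definition herz_closure :: "real \<Rightarrow> ereal \<Rightarrow> ereal \<Rightarrow> ('a::euclidean_space \<Rightarrow> real) set" where
  "herz_closure s q r = {f \<in> herz_space s q r.
      \<forall>\<epsilon>>0. \<exists>\<phi>. Cc_inf \<phi> \<and> herz_norm s q r (\<lambda>x. f x - \<phi> x) < ennreal \<epsilon>}"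

definition herz_continuous :: "real \<Rightarrow> ereal \<Rightarrow> ereal \<Rightarrow> real \<Rightarrow> (real \<Rightarrow> 'a::euclidean_space \<Rightarrow> real) \<Rightarrow> bool" where
  "herz_continuous s q r T u \<longleftrightarrow>
     (\<forall>t\<in>{0..T}. u t \<in> herz_closure s q r) \<and>
     (\<forall>t\<in>{0..T}. ((\<lambda>t'. herz_norm s q r (\<lambda>x. u t' x - u t x)) \<longlongrightarrow> 0) (at t within {0..T}))"

definition heat_kernel :: "real \<Rightarrow> 'a::euclidean_space \<Rightarrow> real" where
  "heat_kernel t z = (4 * pi * t) powr (- real DIM('a) / 2) * exp (- (norm z)\<^sup>2 / (4 * t))"

definition heat_sg :: "real \<Rightarrow> ('a::euclidean_space \<Rightarrow> real) \<Rightarrow> 'a \<Rightarrow> real" where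
  "heat_sg t f x = (\<integral> y. heat_kernel t (x - y) * f y \<partial>lebesgue)"

definition heat_defined :: "real \<Rightarrow> ('a::euclidean_space \<Rightarrow> real) \<Rightarrow> 'a \<Rightarrow> bool" where
  "heat_defined t f x \<longleftrightarrow> integrable lebesgue (\<lambda>y. heat_kernel t (x - y) * f y)"

definition hh_nonlin :: "real \<Rightarrow> real \<Rightarrow> ('a::euclidean_space \<Rightarrow> real) \<Rightarrow> 'a \<Rightarrow> real" where
  "hh_nonlin \<gamma> \<alpha> v y = norm y powr \<gamma> * \<bar>v y\<bar> powr (\<alpha> - 1) * v y"

definition hh_solution :: "real \<Rightarrow> real \<Rightarrow> real \<Rightarrow> ('a::euclidean_space \<Rightarrow> real) \<Rightarrow> (real \<Rightarrow> 'a \<Rightarrow> real) \<Rightarrow> bool" where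
  "hh_solution \<gamma> \<alpha> T u0 u \<longleftrightarrow>
     (AE x in lebesgue. u 0 x = u0 x) \<and>
     (\<forall>t\<in>{0<..T}. AE x in lebesgue.
        heat_defined t u0 x \<and>
        (AE \<tau> in lborel. \<tau> \<in> {0<..<t} \<longrightarrow> heat_defined (t - \<tau>) (hh_nonlin \<gamma> \<alpha> (u \<tau>)) x) \<and>
        set_integrable lborel {0<..<t} (\<lambda>\<tau>. heat_sg (t - \<tau>) (hh_nonlin \<gamma> \<alpha> (u \<tau>)) x) \<and>
        u t x = heat_sg t u0 x + (LINT \<tau>:{0<..<t}|lborel. heat_sg (t - \<tau>) (hh_nonlin \<gamma> \<alpha> (u \<tau>)) x))"

definition crit_qc :: "real \<Rightarrow> real \<Rightarrow> real \<Rightarrow> real" where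
  "crit_qc n \<gamma> \<alpha> = n * (\<alpha> - 1) / (2 + \<gamma>)"

definition crit_Qc :: "real \<Rightarrow> real \<Rightarrow> real \<Rightarrow> real" where
  "crit_Qc n \<gamma> \<alpha> = n * \<alpha> / (n + \<gamma>)"

end

theory Submission
  imports Defs
begin

text \<open>
  Write \<open>\<sigma> = s + n/q = (2+\<gamma>)/(\<alpha>-1)\<close>; the two cases are \<open>\<sigma> < n - 2\<close> and \<open>\<sigma> = n - 2\<close>.
  The difference \<open>w\<close> of two solutions satisfies
  \<open>|w(t)| \<le> C \<integral> e\<^bsup>(t-\<tau>)\<Delta>\<^esup> V |w| d\<tau>\<close> with
  \<open>V = |x|\<^bsup>\<gamma>\<^esup> (|u\<^sub>1|\<^bsup>\<alpha>-1\<^esup> + |u\<^sub>2|\<^bsup>\<alpha>-1\<^esup>)\<close>. Near a time \<open>t\<^sub>0\<close> up to which the solutions agree,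
  approximating \<open>u(t\<^sub>0)\<close> by a test function \<open>\<phi>\<close> splits \<open>V\<close> into a small element of a critical Herz space
  (scale index 2) and the subcritical potential \<open>|x|\<^bsup>\<gamma>\<^esup> |\<phi>|\<^bsup>\<alpha>-1\<^esup>\<close>.

  The norm of \<open>w\<close> is taken in \<open>L\<^sup>p\<close> on annuli, where \<open>p\<close> is the exponent conjugate to \<open>q/(\<alpha>-1)\<close>
  (a large finite exponent replaces \<open>q = \<infinity>\<close>). Then
  \<open>V w\<close> is locally \<open>L\<^sup>1\<close>, and the hypothesis \<open>s > \<gamma>/(\<alpha>-1)\<close> says exactly that \<open>p < n/(n-2)\<close>, i.e. that
  the Newtonian kernel is locally in \<open>L\<^sup>p\<close>. Minkowski's inequality reduces everything to the \<open>L\<^sup>p\<close> norm of the heat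
  kernel over \<open>|x| < R\<close>, which is dominated by a product of an integrable function of time and the spatial weight
  \<open>max R |y|\<^bsup>-(n-2-2\<delta>)\<^esup>\<close>; summing over annuli is a geometric series when \<open>\<sigma> < n - 2\<close>, and uses
  \<open>r \<le> \<alpha> - 1\<close> when \<open>\<sigma> = n - 2\<close>. The resulting bound halves the norm of \<open>w\<close> on a short time interval.
\<close>

section \<open>Annuli and heat kernel bounds\<close>

text \<open>At the critical scaling a short time interval gains nothing: the bound for the critical
  part of V is scale invariant, and only its size \<eta> makes it small. The bounded potential V of
  the test function gains R^(2 \<delta>) over the critical one, and this is paid for by (t -
  t0)^\<delta> R^(-2 \<delta>). The one factor min 1 ((t - t0)^\<delta> R^(-2 \<delta>)) in
  \<open>Duhamel_estimate\<close> serves both parts, so a supremum in time is the only time norm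
  that occurs.

  Three more points shape the proof. Tonelli's theorem asks for joint measurability in time and
  space, while the hypotheses give a Lebesgue function at each time; Borel versions are therefore
  built from continuity in time. Halving proves something only from a finite start; the L^p bound on
  w comes from \<alpha> \<le> q, which for finite q amounts to p \<le> q. Finally, the length of the
  time step depends on the test function and hence on t0, so local uniqueness is extended through
  the supremum of the times of agreement, where the Duhamel formula itself yields agreement.\<close>

lemma powr_mult_exp_minus_bounded:
  fixes b :: real
  assumes "b \<ge> 0"
  shows "\<exists>C>0. \<forall>u>0. u powr b * exp (- u) \<le> C"
proof (cases "b = 0")
  case True
  then show ?thesis by (intro exI[of _ 1]) auto
next
  case False
  with assms have b: "b > 0" by simp
  have "u powr b * exp (- u) \<le> exp (b * ln b - b)" if u: "u > 0" for u
  proof -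
    have "ln (u / b) \<le> u / b - 1"
      using u b by (intro ln_le_minus_one) auto
    then have "b * ln (u / b) \<le> b * (u / b - 1)"
      using b by (intro mult_left_mono) auto
    then have "b * ln u - u \<le> b * ln b - b"
      using u b by (simp add: ln_div algebra_simps)
    moreover have "u powr b * exp (- u) = exp (b * ln u - u)"
      using u by (simp add: powr_def exp_diff exp_minus field_simps)
    ultimately show ?thesis by simp
  qed
  then show ?thesis by (intro exI[of _ "exp (b * ln b - b)"]) auto
qed

text \<open>With u = |z|^2 / (4 t), the Gaussian is bounded by exp (-u) \<le> C u^(-b). The free
  parameter b trades the singularity in time against the one in space; it is used twice, with values
  on either side of (n - 2) / 2.\<close>

lemma heat_kernel_le_powr:
  assumes "b \<ge> 0"
  shows "\<exists>C>0. \<forall>t>0. \<forall>z::'a::euclidean_space. z \<noteq> 0 \<longrightarrow>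
    heat_kernel t z \<le> C * t powr (b - real DIM('a) / 2) * norm z powr (- 2 * b)"
proof -
  obtain C where C: "C > 0" "\<And>u. u > 0 \<Longrightarrow> u powr b * exp (- u) \<le> C"
    using powr_mult_exp_minus_bounded[OF assms] by blast
  let ?n = "real DIM('a)"
  have "heat_kernel t z \<le> ((4*pi) powr (-?n/2) * C * 4 powr b) * t powr (b - ?n / 2) * norm z powr (- 2 * b)"
    if t: "t > 0" and z: "z \<noteq> 0" for t and z :: 'a
  proof -
    define u where "u = (norm z)\<^sup>2 / (4 * t)"
    have u: "u > 0" using t z by (simp add: u_def)
    have upb: "u powr b = norm z powr (2*b) * 4 powr (-b) * t powr (-b)"
    proof -
      have "u powr b = ((norm z)\<^sup>2) powr b / (4*t) powr b"
        unfolding u_def using t by (simp add: powr_divide)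
      also have "((norm z)\<^sup>2) powr b = norm z powr (2*b)"
        using z by (simp add: powr_powr flip: powr_numeral)
      also have "(4*t) powr b = 4 powr b * t powr b"
        using t by (simp add: powr_mult)
      finally show ?thesis by (simp add: powr_minus field_simps)
    qed
    have "exp (-u) \<le> C * u powr (-b)"
      using C(2)[OF u] u by (simp add: powr_minus field_simps)
    also have "u powr (-b) = norm z powr (-2*b) * 4 powr b * t powr b"
      by (simp add: powr_minus upb field_simps)
    finally have e: "exp (-u) \<le> C * (norm z powr (-2*b) * 4 powr b * t powr b)" .
    have "heat_kernel t z = (4*pi) powr (-?n/2) * t powr (-?n/2) * exp (-u)"
      using t by (simp add: heat_kernel_def u_def powr_mult)
    also have "\<dots> \<le> (4*pi) powr (-?n/2) * t powr (-?n/2) * (C * (norm z powr (-2*b) * 4 powr b * t powr b))"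
      using e by (intro mult_left_mono) auto
    also have "\<dots> = ((4*pi) powr (-?n/2) * C * 4 powr b) * (t powr b * t powr (-?n/2)) * norm z powr (- 2 * b)"
      by simp
    also have "t powr b * t powr (-?n/2) = t powr (b - ?n/2)"
      by (simp flip: powr_add)
    finally show ?thesis .
  qed
  moreover have "(4*pi) powr (-?n/2) * C * 4 powr b > 0" using C by simp
  ultimately show ?thesis by blast
qed

section \<open>Dyadic annuli and sums over them\<close>

lemma annulus_borel [measurable]: "annulus k \<in> sets borel"
  unfolding annulus_def by measurable

lemma annulus_lebesgue [measurable]: "annulus k \<in> sets lebesgue"
  by (simp add: annulus_borel)

lemma ball_borel [measurable]: "ball (c::'a::euclidean_space) R \<in> sets borel"
  by simp

lemma dyadic_floor:
  assumes "R > (0::real)"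
  shows "2 powr real_of_int \<lfloor>log 2 R\<rfloor> \<le> R" "R < 2 powr real_of_int (\<lfloor>log 2 R\<rfloor> + 1)"
proof -
  have "2 powr real_of_int \<lfloor>log 2 R\<rfloor> \<le> 2 powr log 2 R"
    by (intro powr_mono) auto
  then show "2 powr real_of_int \<lfloor>log 2 R\<rfloor> \<le> R" using assms by simp
  have "2 powr log 2 R < 2 powr real_of_int (\<lfloor>log 2 R\<rfloor> + 1)"
    by (intro powr_less_mono) linarith+
  then show "R < 2 powr real_of_int (\<lfloor>log 2 R\<rfloor> + 1)" using assms by simp
qed

lemma in_annulus_ex: "x \<noteq> 0 \<Longrightarrow> x \<in> annulus (\<lfloor>log 2 (norm x)\<rfloor> + 1)"
  using dyadic_floor[of "norm x"] by (simp add: annulus_def)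

lemma annulus_unique:
  assumes "x \<in> annulus i" "x \<in> annulus j"
  shows "i = j"
proof -
  have "(2::real) powr (real_of_int i - 1) < 2 powr (real_of_int j)" "(2::real) powr (real_of_int j - 1) < 2 powr (real_of_int i)"
    using assms unfolding annulus_def mem_Collect_eq by (blast intro: le_less_trans)+
  then show ?thesis by simp
qed

lemma annulus_nonzero: "x \<in> annulus k \<Longrightarrow> x \<noteq> 0"
  by (auto simp: annulus_def)

lemma emeasure_ball_le_powr:
  "\<exists>C>0. \<forall>R>0. \<forall>c::'a::euclidean_space. emeasure lborel (ball c R) \<le> ennreal (C * R powr real DIM('a))"
proof (intro exI conjI allI impI)
  show "unit_ball_vol (real DIM('a)) > 0" by simp
next
  fix R :: real and c :: 'a assume "R > 0"
  then show "emeasure lborel (ball c R) \<le> ennreal (unit_ball_vol (real DIM('a)) * R powr real DIM('a))"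
    by (simp add: emeasure_ball powr_realpow)
qed

lemma emeasure_annulus_le:
  "\<exists>C>0. \<forall>k. emeasure lborel (annulus k :: 'a::euclidean_space set) \<le> ennreal (C * 2 powr (real DIM('a) * real_of_int k))"
proof -
  obtain C where C: "C > 0" "\<And>R c. R > 0 \<Longrightarrow> emeasure lborel (ball (c::'a) R) \<le> ennreal (C * R powr real DIM('a))"
    using emeasure_ball_le_powr by blast
  have "emeasure lborel (annulus k :: 'a set) \<le> ennreal (C * 2 powr (real DIM('a) * real_of_int k))" for k
  proof -
    have "emeasure lborel (annulus k :: 'a set) \<le> emeasure lborel (ball (0::'a) (2 powr real_of_int k))"
      by (intro emeasure_mono) (auto simp: annulus_def)
    also have "\<dots> \<le> ennreal (C * (2 powr real_of_int k) powr real DIM('a))"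
      by (intro C) auto
    finally show ?thesis by (simp add: powr_powr mult.commute)
  qed
  with C(1) show ?thesis by blast
qed

text \<open>The annuli are disjoint and miss only the origin, a null set. The hypothesis speaks of
  finite partial sums in the reals, so that every application reduces to a geometric or a weighted
  sum with no series over the integers.\<close>

lemma nn_integral_annuli_le:
  fixes f :: "'a::euclidean_space \<Rightarrow> ennreal"
  assumes [measurable]: "f \<in> borel_measurable lebesgue"
    and le: "\<And>k. (\<integral>\<^sup>+x. f x * indicator (annulus k) x \<partial>lebesgue) \<le> ennreal (a k)"
    and a: "\<And>k. a k \<ge> 0" "\<And>F. finite F \<Longrightarrow> (\<Sum>k\<in>F. a k) \<le> C"
  shows "(\<integral>\<^sup>+x. f x \<partial>lebesgue) \<le> ennreal C"
proof -
  \<comment> \<open>Symmetric intervals turn the unordered sum over the integers into a monotone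
    sequence.\<close>
  define S where "S m = {- int m..int m}" for m
  have ae: "AE x in lebesgue. x \<noteq> (0::'a)"
    by (intro AE_completion AE_lborel_singleton)
  have eq: "(\<Sum>k\<in>S m. f x * indicator (annulus k) x) = (if x \<noteq> 0 \<and> \<lfloor>log 2 (norm x)\<rfloor> + 1 \<in> S m then f x else 0)" for x m
  proof (cases "x = 0")
    case True
    then show ?thesis using annulus_nonzero[of x] by (auto simp: indicator_def intro!: sum.neutral)
  next
    case False
    have "(\<Sum>k\<in>S m. f x * indicator (annulus k) x) = (\<Sum>k\<in>S m. if k = \<lfloor>log 2 (norm x)\<rfloor> + 1 then f x else 0)"
      using in_annulus_ex[OF False] annulus_unique[of x] by (intro sum.cong) (auto simp: indicator_def)
    then show ?thesis using False by (simp add: S_def)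
  qed
  have "(\<integral>\<^sup>+x. f x \<partial>lebesgue) = (\<integral>\<^sup>+x. (SUP m. \<Sum>k\<in>S m. f x * indicator (annulus k) x) \<partial>lebesgue)"
    using ae
  proof (intro nn_integral_cong_AE, eventually_elim)
    case (elim x)
    let ?k = "\<lfloor>log 2 (norm x)\<rfloor> + 1"
    have "?k \<in> S (nat \<bar>?k\<bar>)" by (auto simp: S_def)
    then have "f x = (\<Sum>k\<in>S (nat \<bar>?k\<bar>). f x * indicator (annulus k) x)"
      unfolding eq using elim by simp
    then have "f x \<le> (SUP m. \<Sum>k\<in>S m. f x * indicator (annulus k) x)"
      by (metis SUP_upper UNIV_I)
    moreover have "(SUP m. \<Sum>k\<in>S m. f x * indicator (annulus k) x) \<le> f x"
      unfolding eq by (intro SUP_least) auto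
    ultimately show ?case by (rule antisym)
  qed
  also have "\<dots> = (SUP m. \<integral>\<^sup>+x. (\<Sum>k\<in>S m. f x * indicator (annulus k) x) \<partial>lebesgue)"
  proof (intro nn_integral_monotone_convergence_SUP)
    show "incseq (\<lambda>m x. \<Sum>k\<in>S m. f x * indicator (annulus k) x)"
      unfolding incseq_def le_fun_def S_def by (intro allI impI sum_mono2) auto
  qed measurable
  also have "\<dots> \<le> ennreal C"
  proof (intro SUP_least)
    fix m
    have "(\<integral>\<^sup>+x. (\<Sum>k\<in>S m. f x * indicator (annulus k) x) \<partial>lebesgue) = (\<Sum>k\<in>S m. \<integral>\<^sup>+x. f x * indicator (annulus k) x \<partial>lebesgue)"
      by (intro nn_integral_sum) measurable
    also have "\<dots> \<le> (\<Sum>k\<in>S m. ennreal (a k))" by (intro sum_mono le)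
    also have "\<dots> = ennreal (\<Sum>k\<in>S m. a k)" using a by (intro sum_ennreal)
    also have "\<dots> \<le> ennreal C" using a(2)[of "S m"] by (intro ennreal_leI) (simp add: S_def)
    finally show "(\<integral>\<^sup>+x. (\<Sum>k\<in>S m. f x * indicator (annulus k) x) \<partial>lebesgue) \<le> ennreal C" .
  qed
  finally show ?thesis .
qed

text \<open>Two geometric series, one on each side of j, where k \<mapsto> |k - j| is injective. The
  point is that C does not depend on j.\<close>

lemma sum_powr_abs_le:
  assumes c: "c > (0::real)"
  shows "\<exists>C>0. \<forall>(F::int set) j. finite F \<longrightarrow> (\<Sum>k\<in>F. 2 powr (- c * \<bar>real_of_int k - real_of_int j\<bar>)) \<le> C"
proof -
  define x :: real where "x = 2 powr (-c)"
  have x: "0 < x" "x < 1" using c powr_less_mono[of "-c" 0 2] by (auto simp: x_def)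
  have summ: "summable (\<lambda>i. x ^ i)" using x by (intro summable_geometric) auto
  define S where "S = (\<Sum>i. x ^ i)"
  have fin: "(\<Sum>i\<in>I. x ^ i) \<le> S" if "finite I" for I
    unfolding S_def using x that by (intro sum_le_suminf summ) auto
  have xp: "2 powr (- c * \<bar>real_of_int k - real_of_int j\<bar>) = x ^ nat \<bar>k - j\<bar>" for k j
  proof -
    have "x ^ nat \<bar>k - j\<bar> = x powr real (nat \<bar>k - j\<bar>)" by (rule powr_realpow[OF x(1), symmetric])
    also have "\<dots> = 2 powr (- c * \<bar>real_of_int k - real_of_int j\<bar>)" unfolding x_def
      by (simp add: powr_powr)
    finally show ?thesis ..
  qed
  have "(\<Sum>k\<in>F. 2 powr (- c * \<bar>real_of_int k - real_of_int j\<bar>)) \<le> 2 * S" if F: "finite F" for F j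
  proof -
    have "(\<Sum>k\<in>F. 2 powr (- c * \<bar>real_of_int k - real_of_int j\<bar>)) = (\<Sum>k\<in>F. x ^ nat \<bar>k - j\<bar>)"
      by (simp only: xp)
    also have "\<dots> = (\<Sum>k\<in>F \<inter> {j..}. x ^ nat \<bar>k - j\<bar>) + (\<Sum>k\<in>F - {j..}. x ^ nat \<bar>k - j\<bar>)"
      using F by (rule sum.Int_Diff)
    also have "(\<Sum>k\<in>F \<inter> {j..}. x ^ nat \<bar>k - j\<bar>) = (\<Sum>i\<in>(\<lambda>k. nat \<bar>k - j\<bar>) ` (F \<inter> {j..}). x ^ i)"
      by (subst sum.reindex) (auto simp: inj_on_def)
    also have "\<dots> \<le> S" using F by (intro fin) auto
    also have "(\<Sum>k\<in>F - {j..}. x ^ nat \<bar>k - j\<bar>) = (\<Sum>i\<in>(\<lambda>k. nat \<bar>k - j\<bar>) ` (F - {j..}). x ^ i)"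
      by (subst sum.reindex) (auto simp: inj_on_def)
    also have "\<dots> \<le> S" using F by (intro fin) auto
    finally show ?thesis by simp
  qed
  moreover have "S > 0" unfolding S_def using x by (intro suminf_pos summ) auto
  ultimately show ?thesis by (intro exI[of _ "2 * S"]) auto
qed

text \<open>Annulus k contributes about 2^(k (n - c)), and n - c > 0 makes the sum geometric,
  dominated by the outermost annulus.\<close>

lemma nn_integral_centred_ball_powr_le:
  fixes c :: real
  assumes c: "0 \<le> c" "c < real DIM('a::euclidean_space)"
  shows "\<exists>C>0. \<forall>R>0. (\<integral>\<^sup>+(x::'a). ennreal (norm x powr (-c)) * indicator (ball 0 R) x \<partial>lborel)
    \<le> ennreal (C * R powr (real DIM('a) - c))"
proof -
  let ?n = "real DIM('a)"
  obtain C1 where C1: "C1 > 0" "\<And>k. emeasure lborel (annulus k :: 'a set) \<le> ennreal (C1 * 2 powr (?n * real_of_int k))"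
    using emeasure_annulus_le by blast
  obtain C2 where C2: "C2 > 0" "\<And>F j. finite F \<Longrightarrow> (\<Sum>k\<in>F. 2 powr (- (?n - c) * \<bar>real_of_int k - real_of_int j\<bar>)) \<le> C2"
    using sum_powr_abs_le[of "?n - c"] c by auto
  have "(\<integral>\<^sup>+(x::'a). ennreal (norm x powr (-c)) * indicator (ball 0 R) x \<partial>lborel)
      \<le> ennreal ((C1 * 2 powr c * C2 * 2 powr (?n - c)) * R powr (?n - c))" if R: "R > 0" for R :: real
  proof -
    define K where "K = \<lfloor>log 2 R\<rfloor> + 1"
    let ?D = "C1 * 2 powr c * (2 powr real_of_int K) powr (?n - c)"
    have K: "2 powr (real_of_int K - 1) \<le> R" "R < 2 powr (real_of_int K)"
      using dyadic_floor[OF R] by (simp_all add: K_def)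
    \<comment> \<open>For k \<le> K this is the contribution of annulus k, with 2^(K (n - c))
      factored out; the factor 2^c comes from the inner radius 2^(k - 1). Annuli with k > K miss the
      ball, so any nonnegative bound serves there.\<close>
    define a where "a k = ?D * 2 powr (- (?n - c) * \<bar>real_of_int k - real_of_int K\<bar>)" for k
    have "(\<integral>\<^sup>+(x::'a). ennreal (norm x powr (-c)) * indicator (ball 0 R) x \<partial>lebesgue)
      \<le> ennreal (?D * C2)"
    proof (rule nn_integral_annuli_le[where a = a])
      show "(\<lambda>x::'a. ennreal (norm x powr (-c)) * indicator (ball 0 R) x) \<in> borel_measurable lebesgue"
        by (intro measurable_completion) measurable
    next
      fix k :: int
      have "(\<integral>\<^sup>+(x::'a). ennreal (norm x powr (-c)) * indicator (ball 0 R) x * indicator (annulus k) x \<partial>lebesgue)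
        \<le> (\<integral>\<^sup>+(x::'a). (if k \<le> K then ennreal ((2 powr (real_of_int k - 1)) powr (-c)) else 0) * indicator (annulus k) x \<partial>lborel)"
        unfolding nn_integral_completion
      proof (intro nn_integral_mono)
        fix x :: 'a
        show "ennreal (norm x powr (-c)) * indicator (ball 0 R) x * indicator (annulus k) x
          \<le> (if k \<le> K then ennreal ((2 powr (real_of_int k - 1)) powr (-c)) else 0) * indicator (annulus k) x"
        proof (cases "x \<in> annulus k \<and> x \<in> ball 0 R")
          case True
          then have x: "2 powr (real_of_int k - 1) \<le> norm x" "norm x < R"
            by (auto simp: annulus_def)
          then have "(2::real) powr (real_of_int k - 1) < 2 powr (real_of_int K)" using K by linarith
          then have "k \<le> K" by simp
          moreover have "norm x powr (-c) \<le> (2 powr (real_of_int k - 1)) powr (-c)"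
            using x c by (intro powr_mono2') auto
          ultimately show ?thesis using True by (auto intro: ennreal_leI)
        qed (auto simp: indicator_def)
      qed
      also have "\<dots> = (if k \<le> K then ennreal ((2 powr (real_of_int k - 1)) powr (-c)) else 0) * emeasure lborel (annulus k :: 'a set)"
        by (subst nn_integral_cmult_indicator) auto
      also have "\<dots> \<le> ennreal (a k)"
      proof (cases "k \<le> K")
        case True
        have "ennreal ((2 powr (real_of_int k - 1)) powr (-c)) * emeasure lborel (annulus k :: 'a set)
          \<le> ennreal ((2 powr (real_of_int k - 1)) powr (-c)) * ennreal (C1 * 2 powr (?n * real_of_int k))"
          by (intro mult_left_mono C1) auto
        also have "\<dots> = ennreal ((2 powr (real_of_int k - 1)) powr (-c) * (C1 * 2 powr (?n * real_of_int k)))"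
          using C1 by (simp add: ennreal_mult)
        also have "(2 powr (real_of_int k - 1)) powr (-c) * (C1 * 2 powr (?n * real_of_int k)) = a k"
          using True unfolding a_def powr_powr
          by (simp add: powr_def exp_add[symmetric] algebra_simps)
        finally show ?thesis using True by simp
      qed auto
      finally show "(\<integral>\<^sup>+(x::'a). ennreal (norm x powr (-c)) * indicator (ball 0 R) x * indicator (annulus k) x \<partial>lebesgue) \<le> ennreal (a k)" .
    next
      fix F :: "int set" assume F: "finite F"
      have "(\<Sum>k\<in>F. a k) = ?D * (\<Sum>k\<in>F. 2 powr (- (?n - c) * \<bar>real_of_int k - real_of_int K\<bar>))"
        unfolding a_def by (simp add: sum_distrib_left)
      also have "\<dots> \<le> ?D * C2"
        using C1 F by (intro mult_left_mono C2) auto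
      finally show "(\<Sum>k\<in>F. a k) \<le> ?D * C2" .
    next
      show "a k \<ge> 0" for k using C1 by (auto simp: a_def)
    qed
    also have "\<dots> \<le> ennreal ((C1 * 2 powr c * C2 * 2 powr (?n - c)) * R powr (?n - c))"
    proof (rule ennreal_leI)
      have "2 powr real_of_int K \<le> 2 * R" using K by (simp add: powr_diff)
      then have "(2 powr real_of_int K) powr (?n - c) \<le> (2 * R) powr (?n - c)"
        using c by (intro powr_mono2) auto
      also have "\<dots> = 2 powr (?n - c) * R powr (?n - c)" using R by (simp add: powr_mult)
      finally have "C1 * 2 powr c * C2 * (2 powr real_of_int K) powr (?n - c) \<le> C1 * 2 powr c * C2 * (2 powr (?n - c) * R powr (?n - c))"
        using C1 C2 by (intro mult_left_mono) auto
      then show "?D * C2 \<le> (C1 * 2 powr c * C2 * 2 powr (?n - c)) * R powr (?n - c)"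
        by (simp add: mult_ac)
    qed
    finally show ?thesis by (simp add: nn_integral_completion)
  qed
  moreover have "C1 * 2 powr c * C2 * 2 powr (?n - c) > 0" using C1 C2 by simp
  ultimately show ?thesis by blast
qed

section \<open>Off-centre singularities and the heat kernel over a ball\<close>

lemma nn_integral_lborel_minus:
  fixes f :: "'a::euclidean_space \<Rightarrow> ennreal"
  assumes [measurable]: "f \<in> borel_measurable borel"
  shows "(\<integral>\<^sup>+x. f (x - y) \<partial>lborel) = (\<integral>\<^sup>+x. f x \<partial>lborel)"
proof -
  have "(\<integral>\<^sup>+x. f x \<partial>lborel) = (\<integral>\<^sup>+x. f x \<partial>distr lborel borel ((+) (-y)))"
    by (simp only: lborel_distr_plus)
  also have "\<dots> = (\<integral>\<^sup>+x. f (-y + x) \<partial>lborel)"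
    by (intro nn_integral_distr) auto
  finally show ?thesis by (simp add: algebra_simps)
qed

text \<open>If |y| < 2 R, the ball lies inside the ball of radius 3 R about y, where the centred
  estimate applies; otherwise |x - y| \<ge> |y| / 2 throughout the ball. The maximum of R and |y|
  expresses both cases in one formula.\<close>

lemma nn_integral_ball_powr_le:
  fixes c :: real
  assumes c: "0 \<le> c" "c < real DIM('a::euclidean_space)"
  shows "\<exists>C>0. \<forall>R>0. \<forall>y::'a. (\<integral>\<^sup>+x. ennreal (norm (x - y) powr (-c)) * indicator (ball 0 R) x \<partial>lborel)
    \<le> ennreal (C * R powr real DIM('a) * max R (norm y) powr (-c))"
proof -
  let ?n = "real DIM('a)"
  obtain C1 where C1: "C1 > 0" "\<And>R. R > 0 \<Longrightarrow> (\<integral>\<^sup>+(x::'a). ennreal (norm x powr (-c)) * indicator (ball 0 R) x \<partial>lborel)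
    \<le> ennreal (C1 * R powr (?n - c))"
    using nn_integral_centred_ball_powr_le[where 'a='a, OF c] by blast
  obtain C2 where C2: "C2 > 0" "\<And>R c. R > 0 \<Longrightarrow> emeasure lborel (ball (c::'a) R) \<le> ennreal (C2 * R powr ?n)"
    using emeasure_ball_le_powr by blast
  let ?E = "C1 * 3 powr (?n - c) * 2 powr c + C2 * 2 powr c"
  have "(\<integral>\<^sup>+x. ennreal (norm (x - y) powr (-c)) * indicator (ball 0 R) x \<partial>lborel)
    \<le> ennreal (?E * R powr ?n * max R (norm y) powr (-c))"
    if R: "R > 0" for R and y :: 'a
  proof (cases "norm y < 2 * R")
    case True
    have "(\<integral>\<^sup>+x. ennreal (norm (x - y) powr (-c)) * indicator (ball 0 R) x \<partial>lborel)
      \<le> (\<integral>\<^sup>+x. ennreal (norm (x - y) powr (-c)) * indicator (ball 0 (3*R)) (x - y) \<partial>lborel)"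
    proof (intro nn_integral_mono mult_left_mono)
      fix x
      have "norm (x - y) < 3 * R" if "norm x < R"
        using that True norm_triangle_ineq4[of x y] by linarith
      then show "(indicator (ball 0 R) x :: ennreal) \<le> indicator (ball 0 (3*R)) (x - y)"
        by (auto simp: indicator_def)
    qed auto
    also have "\<dots> = (\<integral>\<^sup>+(x::'a). ennreal (norm x powr (-c)) * indicator (ball 0 (3*R)) x \<partial>lborel)"
      by (rule nn_integral_lborel_minus) measurable
    also have "\<dots> \<le> ennreal (C1 * (3*R) powr (?n - c))"
      using R by (intro C1) auto
    also have "\<dots> \<le> ennreal (?E * R powr ?n * max R (norm y) powr (-c))"
    proof (rule ennreal_leI)
      have "(2 * R) powr (-c) \<le> max R (norm y) powr (-c)"
        using True R c by (intro powr_mono2') auto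
      moreover have "R powr (-c) = 2 powr c * (2 * R) powr (-c)"
        using R by (simp add: powr_mult powr_minus)
      ultimately have "R powr (-c) \<le> 2 powr c * max R (norm y) powr (-c)" by simp
      then have "C1 * 3 powr (?n - c) * R powr ?n * R powr (-c) \<le> C1 * 3 powr (?n - c) * R powr ?n * (2 powr c * max R (norm y) powr (-c))"
        using C1 by (intro mult_left_mono) auto
      also have "\<dots> \<le> ?E * R powr ?n * max R (norm y) powr (-c)"
        using C2 by (simp add: algebra_simps)
      finally show "C1 * (3*R) powr (?n - c) \<le> ?E * R powr ?n * max R (norm y) powr (-c)"
        using R by (simp add: powr_mult powr_diff powr_minus field_simps)
    qed
    finally show ?thesis .
  next
    case False
    then have y: "norm y > 0" and m: "max R (norm y) = norm y" using R by auto
    have "(\<integral>\<^sup>+x. ennreal (norm (x - y) powr (-c)) * indicator (ball 0 R) x \<partial>lborel)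
      \<le> (\<integral>\<^sup>+x. ennreal ((norm y / 2) powr (-c)) * indicator (ball (0::'a) R) x \<partial>lborel)"
    proof (intro nn_integral_mono)
      fix x
      have "norm y / 2 \<le> norm (x - y)" if "norm x < R"
        using that False norm_triangle_ineq2[of y x] by (simp add: norm_minus_commute)
      then have "norm (x - y) powr (-c) \<le> (norm y / 2) powr (-c)" if "norm x < R"
        using that c y by (intro powr_mono2') auto
      then show "ennreal (norm (x - y) powr (-c)) * indicator (ball 0 R) x \<le> ennreal ((norm y / 2) powr (-c)) * indicator (ball 0 R) x"
        by (auto simp: indicator_def intro: ennreal_leI)
    qed
    also have "\<dots> = ennreal ((norm y / 2) powr (-c)) * emeasure lborel (ball (0::'a) R)"
      by (subst nn_integral_cmult_indicator) auto
    also have "\<dots> \<le> ennreal ((norm y / 2) powr (-c)) * ennreal (C2 * R powr ?n)"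
      using R by (intro mult_left_mono C2) auto
    also have "\<dots> = ennreal ((norm y / 2) powr (-c) * (C2 * R powr ?n))"
      using C2 by (simp add: ennreal_mult)
    also have "\<dots> \<le> ennreal (?E * R powr ?n * max R (norm y) powr (-c))"
    proof (rule ennreal_leI)
      have "(norm y / 2) powr (-c) = 2 powr c * norm y powr (-c)"
        using y by (simp add: powr_divide powr_minus field_simps)
      then show "(norm y / 2) powr (-c) * (C2 * R powr ?n) \<le> ?E * R powr ?n * max R (norm y) powr (-c)"
        unfolding m using C1 by (simp add: algebra_simps)
    qed
    finally show ?thesis .
  qed
  moreover have "?E > 0" using C1 C2 by (intro add_pos_pos) auto
  ultimately show ?thesis by blast
qed

lemma heat_kernel_nonneg: "t > 0 \<Longrightarrow> heat_kernel t z \<ge> 0"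
  by (simp add: heat_kernel_def)

lemma heat_kernel_borel [measurable]:
  assumes [measurable]: "f \<in> borel_measurable M" "g \<in> borel_measurable M"
  shows "(\<lambda>x. heat_kernel (f x) (g x :: 'a::euclidean_space)) \<in> borel_measurable M"
  unfolding heat_kernel_def by measurable

text \<open>The condition c p < n is local integrability of |x|^(-c p). The right-hand side is kept
  as a p-th power, so its base can be read as a bound for the L^p norm of the kernel over the
  ball.\<close>

lemma nn_integral_ball_heat_kernel_le:
  fixes c p :: real
  assumes c: "0 \<le> c" and p: "0 < p" "c * p < real DIM('a::euclidean_space)"
  shows "\<exists>C>0. \<forall>t>0. \<forall>R>0. \<forall>y::'a.
    (\<integral>\<^sup>+x. ennreal (heat_kernel t (x - y) powr p) * indicator (ball 0 R) x \<partial>lborel)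
    \<le> ennreal ((C * t powr ((c - real DIM('a)) / 2) * R powr (real DIM('a) / p) * max R (norm y) powr (-c)) powr p)"
proof -
  let ?n = "real DIM('a)"
  obtain C1 where C1: "C1 > 0" "\<And>t z. t > 0 \<Longrightarrow> z \<noteq> (0::'a) \<Longrightarrow>
    heat_kernel t z \<le> C1 * t powr (c/2 - ?n / 2) * norm z powr (- 2 * (c/2))"
    using heat_kernel_le_powr[of "c/2", where 'a='a] c by auto
  have cp: "0 \<le> c * p" using c p by simp
  obtain C2 where C2: "C2 > 0" "\<And>R y. R > 0 \<Longrightarrow> (\<integral>\<^sup>+(x::'a). ennreal (norm (x - y) powr (-(c*p))) * indicator (ball 0 R) x \<partial>lborel)
    \<le> ennreal (C2 * R powr ?n * max R (norm y) powr (-(c*p)))"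
    using nn_integral_ball_powr_le[where 'a='a, OF cp p(2)] by blast
  have "(\<integral>\<^sup>+x. ennreal (heat_kernel t (x - y) powr p) * indicator (ball 0 R) x \<partial>lborel)
    \<le> ennreal (((C1 * C2 powr (1/p)) * t powr ((c - ?n) / 2) * R powr (?n / p) * max R (norm y) powr (-c)) powr p)"
    if t: "t > 0" and R: "R > 0" for t R and y :: 'a
  proof -
    define D where "D = (C1 * t powr ((c - ?n) / 2)) powr p"
    have D: "D \<ge> 0" by (simp add: D_def)
    have "(\<integral>\<^sup>+x. ennreal (heat_kernel t (x - y) powr p) * indicator (ball 0 R) x \<partial>lborel)
      \<le> (\<integral>\<^sup>+x. ennreal D * (ennreal (norm (x - y) powr (-(c*p))) * indicator (ball 0 R) x) \<partial>lborel)"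
    proof (intro nn_integral_mono_AE)
      have "AE x in lborel. x \<noteq> y" by (rule AE_lborel_singleton)
      then show "AE x in lborel. ennreal (heat_kernel t (x - y) powr p) * indicator (ball 0 R) x
        \<le> ennreal D * (ennreal (norm (x - y) powr (-(c*p))) * indicator (ball 0 R) x)"
      proof eventually_elim
        case (elim x)
        have "heat_kernel t (x - y) \<le> C1 * t powr ((c - ?n) / 2) * norm (x - y) powr (-c)"
          using C1(2)[OF t, of "x - y"] elim by (simp add: diff_divide_distrib)
        then have "heat_kernel t (x - y) powr p \<le> (C1 * t powr ((c - ?n) / 2) * norm (x - y) powr (-c)) powr p"
          using p t by (intro powr_mono2 heat_kernel_nonneg) auto
        also have "\<dots> = D * norm (x - y) powr (-(c*p))"
          using C1 elim by (simp add: D_def powr_mult powr_powr)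
        finally show ?case using D
          by (auto simp: indicator_def simp flip: ennreal_mult intro: ennreal_leI)
      qed
    qed
    also have "\<dots> = ennreal D * (\<integral>\<^sup>+x. ennreal (norm (x - y) powr (-(c*p))) * indicator (ball 0 R) x \<partial>lborel)"
      by (intro nn_integral_cmult) measurable
    also have "\<dots> \<le> ennreal D * ennreal (C2 * R powr ?n * max R (norm y) powr (-(c*p)))"
      using R by (intro mult_left_mono C2) auto
    also have "\<dots> = ennreal (D * (C2 * R powr ?n * max R (norm y) powr (-(c*p))))"
      using D C2 by (simp add: ennreal_mult)
    also have "D * (C2 * R powr ?n * max R (norm y) powr (-(c*p)))
      = ((C1 * C2 powr (1/p)) * t powr ((c - ?n) / 2) * R powr (?n / p) * max R (norm y) powr (-c)) powr p"
      using C1 C2 p R unfolding D_def by (simp add: powr_mult powr_powr)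
    finally show ?thesis .
  qed
  moreover have "C1 * C2 powr (1/p) > 0" using C1 C2 by simp
  ultimately show ?thesis by blast
qed

text \<open>
  The minimum of the bounds \<open>t\<^bsup>(c-n)/2\<^esup> |z|\<^bsup>-c\<^esup>\<close> on the heat kernel for \<open>c = n - 2 \<plusminus> 2\<delta>\<close>,
  after the common spatial factor has been split off.
\<close>

definition heat_weight :: "real \<Rightarrow> real \<Rightarrow> real \<Rightarrow> real" where
  "heat_weight \<delta> R \<tau> = min (\<tau> powr (\<delta> - 1) * R powr (- 2 * \<delta>)) (\<tau> powr (- 1 - \<delta>) * R powr (2 * \<delta>))"

lemma heat_weight_nonneg: "heat_weight \<delta> R \<tau> \<ge> 0"
  by (simp add: heat_weight_def)

lemma heat_weight_pos: "R > 0 \<Longrightarrow> \<tau> > 0 \<Longrightarrow> heat_weight \<delta> R \<tau> > 0"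
  by (simp add: heat_weight_def)

lemma heat_weight_borel [measurable]:
  assumes [measurable]: "f \<in> borel_measurable M"
  shows "(\<lambda>x. heat_weight \<delta> R (f x)) \<in> borel_measurable M"
  unfolding heat_weight_def by measurable

text \<open>The two branches of the minimum cross at \<tau> = R^2. The first is integrable at 0, the
  second at infinity, and each part of the full integral is at most 1 / \<delta>, independently of
  R. For small h the first branch alone gives the power of h.\<close>

lemma nn_integral_heat_weight_le:
  assumes \<delta>: "\<delta> > 0"
  shows "\<exists>C>0. \<forall>h>0. \<forall>R>0. (\<integral>\<^sup>+\<tau>. ennreal (heat_weight \<delta> R \<tau>) * indicator {0<..<h} \<tau> \<partial>lborel)
    \<le> ennreal (C * min 1 (h powr \<delta> * R powr (- 2 * \<delta>)))"
proof -
  let ?I = "\<lambda>R h. \<integral>\<^sup>+\<tau>. ennreal (heat_weight \<delta> R \<tau>) * indicator {0<..<h} \<tau> \<partial>lborel"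
  have small: "(\<integral>\<^sup>+\<tau>. ennreal (heat_weight \<delta> R \<tau>) * indicator {0..h} \<tau> \<partial>lborel) \<le> ennreal (h powr \<delta> / \<delta> * R powr (- 2 * \<delta>))"
    if R: "R > 0" and h: "h > 0" for R h
  proof -
    have "((\<lambda>x. x powr (\<delta> - 1)) has_integral (h powr \<delta> / \<delta>)) {0..h}"
      using has_integral_powr_from_0[of "\<delta> - 1" h] \<delta> h by simp
    then have "((\<lambda>x. x powr (\<delta> - 1) * R powr (- 2 * \<delta>)) has_integral (h powr \<delta> / \<delta> * R powr (- 2 * \<delta>))) {0..h}"
      by (rule has_integral_mult_left)
    then have "(\<integral>\<^sup>+\<tau>. ennreal (\<tau> powr (\<delta> - 1) * R powr (- 2 * \<delta>)) * indicator {0..h} \<tau> \<partial>lborel) = ennreal (h powr \<delta> / \<delta> * R powr (- 2 * \<delta>))"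
      by (intro nn_integral_has_integral_lebesgue') auto
    moreover have "(\<integral>\<^sup>+\<tau>. ennreal (heat_weight \<delta> R \<tau>) * indicator {0..h} \<tau> \<partial>lborel) \<le> (\<integral>\<^sup>+\<tau>. ennreal (\<tau> powr (\<delta> - 1) * R powr (- 2 * \<delta>)) * indicator {0..h} \<tau> \<partial>lborel)"
      by (intro nn_integral_mono mult_right_mono ennreal_leI) (auto simp: heat_weight_def)
    ultimately show ?thesis by simp
  qed
  have large: "(\<integral>\<^sup>+\<tau>. ennreal (heat_weight \<delta> R \<tau>) * indicator {R\<^sup>2..} \<tau> \<partial>lborel) \<le> ennreal (1 / \<delta>)"
    if R: "R > 0" for R
  proof -
    have "((\<lambda>x. x powr (- 1 - \<delta>)) has_integral ((R\<^sup>2) powr (-\<delta>) / \<delta>)) {R\<^sup>2..}"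
      using has_integral_powr_to_inf[of "-1-\<delta>" "R\<^sup>2"] \<delta> R by simp
    then have "((\<lambda>x. x powr (- 1 - \<delta>) * R powr (2 * \<delta>)) has_integral ((R\<^sup>2) powr (-\<delta>) / \<delta> * R powr (2 * \<delta>))) {R\<^sup>2..}"
      by (rule has_integral_mult_left)
    also have "(R\<^sup>2) powr (-\<delta>) / \<delta> * R powr (2 * \<delta>) = 1 / \<delta>"
    proof -
      have "(R\<^sup>2) powr (-\<delta>) = R powr (-(2*\<delta>))" using R by (simp add: powr_powr flip: powr_numeral)
      then show ?thesis using R by (simp add: powr_minus)
    qed
    finally have "(\<integral>\<^sup>+\<tau>. ennreal (\<tau> powr (- 1 - \<delta>) * R powr (2 * \<delta>)) * indicator {R\<^sup>2..} \<tau> \<partial>lborel) = ennreal (1 / \<delta>)"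
      by (intro nn_integral_has_integral_lebesgue') auto
    moreover have "(\<integral>\<^sup>+\<tau>. ennreal (heat_weight \<delta> R \<tau>) * indicator {R\<^sup>2..} \<tau> \<partial>lborel) \<le> (\<integral>\<^sup>+\<tau>. ennreal (\<tau> powr (- 1 - \<delta>) * R powr (2 * \<delta>)) * indicator {R\<^sup>2..} \<tau> \<partial>lborel)"
      by (intro nn_integral_mono mult_right_mono ennreal_leI) (auto simp: heat_weight_def)
    ultimately show ?thesis by simp
  qed
  have "(?I R h)
    \<le> ennreal (2 / \<delta> * min 1 (h powr \<delta> * R powr (- 2 * \<delta>)))" if R: "R > 0" and h: "h > 0" for R h
  proof -
    have "(?I R h)
      \<le> (\<integral>\<^sup>+\<tau>. ennreal (heat_weight \<delta> R \<tau>) * indicator {0..h} \<tau> \<partial>lborel)"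
      by (intro nn_integral_mono mult_left_mono) (auto simp: indicator_def)
    also have "\<dots> \<le> ennreal (h powr \<delta> / \<delta> * R powr (- 2 * \<delta>))" by (rule small[OF R h])
    also have "\<dots> \<le> ennreal (2 / \<delta> * (h powr \<delta> * R powr (- 2 * \<delta>)))"
      using \<delta> by (intro ennreal_leI) (simp add: field_simps)
    finally have 1: "(?I R h) \<le> ennreal (2 / \<delta> * (h powr \<delta> * R powr (- 2 * \<delta>)))" .
    have "(?I R h)
      \<le> (\<integral>\<^sup>+\<tau>. ennreal (heat_weight \<delta> R \<tau>) * indicator {0..R\<^sup>2} \<tau> + ennreal (heat_weight \<delta> R \<tau>) * indicator {R\<^sup>2..} \<tau> \<partial>lborel)"
      by (intro nn_integral_mono) (auto simp: indicator_def)
    also have "\<dots> = (\<integral>\<^sup>+\<tau>. ennreal (heat_weight \<delta> R \<tau>) * indicator {0..R\<^sup>2} \<tau> \<partial>lborel) + (\<integral>\<^sup>+\<tau>. ennreal (heat_weight \<delta> R \<tau>) * indicator {R\<^sup>2..} \<tau> \<partial>lborel)"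
      by (intro nn_integral_add) measurable
    also have "\<dots> \<le> ennreal ((R\<^sup>2) powr \<delta> / \<delta> * R powr (- 2 * \<delta>)) + ennreal (1 / \<delta>)"
      using R by (intro add_mono small large) auto
    also have "(R\<^sup>2) powr \<delta> / \<delta> * R powr (- 2 * \<delta>) = 1 / \<delta>"
    proof -
      have "(R\<^sup>2) powr \<delta> = R powr (2*\<delta>)" using R by (simp add: powr_powr flip: powr_numeral)
      then show ?thesis using R by (simp add: powr_minus)
    qed
    also have "ennreal (1 / \<delta>) + ennreal (1 / \<delta>) = ennreal (2 / \<delta> * 1)"
      using \<delta> by (simp flip: ennreal_plus)
    finally have 2: "(?I R h) \<le> ennreal (2 / \<delta> * 1)" .
    show ?thesis using 1 2 by (auto simp: min_def)
  qed
  moreover have "2 / \<delta> > 0" using \<delta> by simp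
  ultimately show ?thesis by blast
qed

section \<open>The Duhamel integral\<close>

text \<open>An average, with weight f of mass at most I, of functions with L^p norm at most 1 has
  L^p norm at most I; the factor 2 is the price of the elementary argument. The kernel is normalised
  to norm 1 and its size is moved into f, so only the integral of f has to be estimated
  later.\<close>

lemma Minkowski_type_inequality:
  fixes k :: "'x \<Rightarrow> 'z \<Rightarrow> real" and f :: "'z \<Rightarrow> ennreal" and W :: "'x \<Rightarrow> real"
  assumes M: "sigma_finite_measure M" and N: "sigma_finite_measure N"
    and k [measurable]: "case_prod k \<in> borel_measurable (M \<Otimes>\<^sub>M N)"
    and f [measurable]: "f \<in> borel_measurable N"
    and k0: "\<And>x z. k x z \<ge> 0" and W0: "\<And>x. W x \<ge> 0"
    and p: "p \<ge> 1" and I: "I > 0" "(\<integral>\<^sup>+z. f z \<partial>N) \<le> ennreal I"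
    and k1: "\<And>z. z \<in> space N \<Longrightarrow> (\<integral>\<^sup>+x. ennreal (k x z powr p) \<partial>M) \<le> 1"
    and W: "AE x in M. ennreal (W x) \<le> (\<integral>\<^sup>+z. ennreal (k x z) * f z \<partial>N)"
  shows "(\<integral>\<^sup>+x. ennreal (W x powr p) \<partial>M) \<le> ennreal ((2 * I) powr p)"
proof -
  interpret M: sigma_finite_measure M by fact
  interpret N: sigma_finite_measure N by fact
  interpret pair_sigma_finite M N ..
  define J where "J x = (\<integral>\<^sup>+z. ennreal (k x z powr p) * f z \<partial>N)" for x
  have [measurable]: "J \<in> borel_measurable M" unfolding J_def by measurable
  have IJ: "(\<integral>\<^sup>+x. J x \<partial>M) \<le> ennreal I"
  proof -
    have "(\<integral>\<^sup>+x. J x \<partial>M) = (\<integral>\<^sup>+z. (\<integral>\<^sup>+x. ennreal (k x z powr p) * f z \<partial>M) \<partial>N)"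
      unfolding J_def by (rule Fubini'[symmetric]) measurable
    also have "\<dots> \<le> (\<integral>\<^sup>+z. f z \<partial>N)"
    proof (intro nn_integral_mono)
      fix z assume z: "z \<in> space N"
      have [measurable]: "(\<lambda>x. k x z) \<in> borel_measurable M"
        using measurable_Pair1[OF k z] by simp
      have "(\<integral>\<^sup>+x. ennreal (k x z powr p) * f z \<partial>M) = (\<integral>\<^sup>+x. ennreal (k x z powr p) \<partial>M) * f z"
        by (intro nn_integral_multc) measurable
      also have "\<dots> \<le> 1 * f z" using k1[OF z] by (intro mult_right_mono) auto
      finally show "(\<integral>\<^sup>+x. ennreal (k x z powr p) * f z \<partial>M) \<le> f z" by simp
    qed
    finally show ?thesis using I by simp
  qed
  have key: "ennreal (W x powr p) \<le> ennreal (2 powr p * I powr (p - 1)) * J x"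
    if x: "x \<in> space M" and Wx: "ennreal (W x) \<le> (\<integral>\<^sup>+z. ennreal (k x z) * f z \<partial>N)" for x
  proof (cases "J x")
    case top
    then show ?thesis using I by (simp add: ennreal_mult_top)
  next
    case (real j)
    have [measurable]: "(\<lambda>z. k x z) \<in> borel_measurable N"
      using measurable_Pair2[OF k x] by simp
    \<comment> \<open>\<open>k \<le> l + l powr (1 - p) * k powr p\<close>, optimised in \<open>l\<close>, replaces Jensen's inequality.\<close>
    have le: "W x \<le> l * I + l powr (1 - p) * j" if l: "l > 0" for l
    proof -
      have kl: "k x z \<le> l + l powr (1 - p) * k x z powr p" for z
      proof (cases "k x z \<le> l")
        case True
        have "0 \<le> l powr (1 - p) * k x z powr p" by simp
        with True show ?thesis by linarith
      next
        case False
        then have kz: "k x z > 0" using l by linarith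
        have "k x z = k x z powr (1 - p) * k x z powr p" using kz by (simp flip: powr_add)
        also have "\<dots> \<le> l powr (1 - p) * k x z powr p"
          using False l p by (intro mult_right_mono powr_mono2') auto
        finally show ?thesis using l by linarith
      qed
      have "ennreal (W x) \<le> (\<integral>\<^sup>+z. ennreal (k x z) * f z \<partial>N)" by fact
      also have "\<dots> \<le> (\<integral>\<^sup>+z. ennreal l * f z + ennreal (l powr (1 - p)) * (ennreal (k x z powr p) * f z) \<partial>N)"
      proof (intro nn_integral_mono)
        fix z
        have "ennreal (k x z) * f z \<le> ennreal (l + l powr (1 - p) * k x z powr p) * f z"
          by (intro mult_right_mono ennreal_leI kl) auto
        also have "\<dots> = ennreal l * f z + ennreal (l powr (1 - p)) * (ennreal (k x z powr p) * f z)"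
          using l by (simp add: ennreal_mult distrib_right mult.assoc)
        finally show "ennreal (k x z) * f z \<le> ennreal l * f z + ennreal (l powr (1 - p)) * (ennreal (k x z powr p) * f z)" .
      qed
      also have "\<dots> = ennreal l * (\<integral>\<^sup>+z. f z \<partial>N) + ennreal (l powr (1 - p)) * J x"
        unfolding J_def by (subst nn_integral_add) (auto simp: nn_integral_cmult)
      also have "\<dots> \<le> ennreal l * ennreal I + ennreal (l powr (1 - p)) * J x"
        using I by (intro add_mono mult_left_mono) auto
      also have "\<dots> = ennreal (l * I + l powr (1 - p) * j)"
        using real l I by (simp add: ennreal_mult ennreal_plus)
      finally show ?thesis
        using l I real by (subst (asm) ennreal_le_iff) (auto intro!: add_nonneg_nonneg)
    qed
    show ?thesis
    proof (cases "j = 0")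
      case True
      have "W x = 0"
      proof (rule ccontr)
        assume "W x \<noteq> 0"
        then have "W x > 0" using W0[of x] by simp
        \<comment> \<open>With j = 0 the inequality reads W x \<le> l I, and this choice of l turns
          it into W x \<le> W x / 2.\<close>
        then show False using le[of "W x / (2 * I)"] True I by simp
      qed
      then show ?thesis by simp
    next
      case False
      then have j: "j > 0" using real by simp
      \<comment> \<open>This l makes the two terms l I and l^(1 - p) j equal.\<close>
      define l where "l = (j / I) powr (1 / p)"
      have l: "l > 0" using j I by (simp add: l_def)
      have lp: "l powr p = j / I" using j I p by (simp add: l_def powr_powr)
      have "l powr (1 - p) * j = l * (I / j) * j"
        using l lp by (simp add: powr_diff)
      then have "W x \<le> 2 * l * I" using le[OF l] j by (simp add: mult_ac)
      then have "W x powr p \<le> (2 * l * I) powr p" using p W0[of x] by (intro powr_mono2) auto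
      also have "\<dots> = 2 powr p * I powr p * (j / I)"
        using l I by (simp add: powr_mult lp)
      also have "\<dots> = 2 powr p * I powr (p - 1) * j"
        using I by (simp add: powr_diff)
      finally show ?thesis using real
        by (simp flip: ennreal_mult add: ennreal_leI)
    qed
  qed
  have "(\<integral>\<^sup>+x. ennreal (W x powr p) \<partial>M) \<le> (\<integral>\<^sup>+x. ennreal (2 powr p * I powr (p - 1)) * J x \<partial>M)"
    using W AE_space by (intro nn_integral_mono_AE, eventually_elim) (rule key)
  also have "\<dots> = ennreal (2 powr p * I powr (p - 1)) * (\<integral>\<^sup>+x. J x \<partial>M)"
    by (rule nn_integral_cmult) measurable
  also have "\<dots> \<le> ennreal (2 powr p * I powr (p - 1)) * ennreal I"
    using IJ by (intro mult_left_mono) auto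
  also have "\<dots> = ennreal ((2 * I) powr p)"
    using I by (simp add: powr_mult powr_diff flip: ennreal_mult)
  finally show ?thesis .
qed

lemma Hoelder_type_inequality:
  fixes f g :: "'x \<Rightarrow> real"
  assumes [measurable]: "f \<in> borel_measurable M" "g \<in> borel_measurable M"
    and f0: "\<And>x. f x \<ge> 0" and g0: "\<And>x. g x \<ge> 0" and a: "a \<ge> 0" and b: "b \<ge> 0"
    and m: "m > 0" and p: "p > 0" and mp: "1 / m + 1 / p = 1"
    and fa: "(\<integral>\<^sup>+x. ennreal (f x powr m) \<partial>M) \<le> ennreal (a powr m)"
    and gb: "(\<integral>\<^sup>+x. ennreal (g x powr p) \<partial>M) \<le> ennreal (b powr p)"
  shows "(\<integral>\<^sup>+x. ennreal (f x * g x) \<partial>M) \<le> ennreal (2 * a * b)"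
proof -
  \<comment> \<open>Both u^m and v^p are at most their sum, and the exponents 1/m and 1/p add up to
    1. This crude form of Young's inequality costs the factor 2 in the conclusion.\<close>
  have Young: "u * v \<le> u powr m + v powr p" if "u \<ge> 0" "v \<ge> 0" for u v
  proof -
    have "u * v = (u powr m) powr (1/m) * (v powr p) powr (1/p)"
      using that m p by (simp add: powr_powr)
    also have "\<dots> \<le> (u powr m + v powr p) powr (1/m) * (u powr m + v powr p) powr (1/p)"
      using m p by (intro mult_mono powr_mono2) auto
    also have "\<dots> = u powr m + v powr p"
      using mp by (simp flip: powr_add)
    finally show ?thesis .
  qed
  show ?thesis
  \<comment> \<open>The general argument applies Young's inequality to f / a and g / b, so vanishing
    bounds are treated apart.\<close>
  proof (cases "a = 0 \<or> b = 0")
    case True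
    then have "(\<integral>\<^sup>+x. ennreal (f x powr m) \<partial>M) = 0 \<or> (\<integral>\<^sup>+x. ennreal (g x powr p) \<partial>M) = 0"
      using fa gb by auto
    then have "(AE x in M. ennreal (f x powr m) = 0) \<or> (AE x in M. ennreal (g x powr p) = 0)"
      by (simp add: nn_integral_0_iff_AE)
    then have "AE x in M. ennreal (f x * g x) = 0"
      by (auto elim!: eventually_mono simp: ennreal_eq_0_iff)
    then have "(\<integral>\<^sup>+x. ennreal (f x * g x) \<partial>M) = 0" by (subst nn_integral_0_iff_AE) auto
    then show ?thesis by simp
  next
    case False
    then have 3: "a > 0" "b > 0" using a b by auto
    have "(\<integral>\<^sup>+x. ennreal (f x * g x) \<partial>M)
      \<le> (\<integral>\<^sup>+x. ennreal (a * b / a powr m) * ennreal (f x powr m) + ennreal (a * b / b powr p) * ennreal (g x powr p) \<partial>M)"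
    proof (intro nn_integral_mono)
      fix x
      have "f x * g x = a * b * ((f x / a) * (g x / b))" using 3 by simp
      also have "\<dots> \<le> a * b * ((f x / a) powr m + (g x / b) powr p)"
        using 3 f0 g0 by (intro mult_left_mono Young) auto
      also have "\<dots> = a * b / a powr m * f x powr m + a * b / b powr p * g x powr p"
        using 3 f0 g0 by (simp add: powr_divide algebra_simps)
      finally show "ennreal (f x * g x) \<le> ennreal (a * b / a powr m) * ennreal (f x powr m) + ennreal (a * b / b powr p) * ennreal (g x powr p)"
        using 3 by (simp flip: ennreal_mult ennreal_plus add: ennreal_leI)
    qed
    also have "\<dots> = ennreal (a * b / a powr m) * (\<integral>\<^sup>+x. ennreal (f x powr m) \<partial>M) + ennreal (a * b / b powr p) * (\<integral>\<^sup>+x. ennreal (g x powr p) \<partial>M)"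
      by (subst nn_integral_add) (auto simp: nn_integral_cmult)
    also have "\<dots> \<le> ennreal (a * b / a powr m) * ennreal (a powr m) + ennreal (a * b / b powr p) * ennreal (b powr p)"
      by (intro add_mono mult_left_mono fa gb) auto
    also have "\<dots> = ennreal (2 * a * b)"
      using 3 by (simp flip: ennreal_mult ennreal_plus)
    finally show ?thesis .
  qed
qed

text \<open>Minkowski's inequality in the pair (\<tau>, y), with the heat kernel divided by a bound
  for its L^p norm over |x| < R. That bound is a product of \<open>heat_weight\<close> in time and a
  power of max R |y| in space. Hence a bound, uniform in time, on the weighted L^1 norm of G
  suffices, and integrating the time weight produces the minimum. C is chosen before t0, t, R, B, G
  and W.\<close>

lemma Duhamel_estimate:
  fixes \<delta> p :: real
  defines "n \<equiv> real DIM('a::euclidean_space)"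
  assumes \<delta>: "\<delta> > 0" "2 * \<delta> \<le> n - 2" and p: "p \<ge> 1" "(n - 2 + 2 * \<delta>) * p < n"
  shows "\<exists>C>0. \<forall>t0 t R B. \<forall>(G :: real \<Rightarrow> 'a \<Rightarrow> ennreal) (W :: 'a \<Rightarrow> real).
    t0 < t \<longrightarrow> R > 0 \<longrightarrow> B > 0 \<longrightarrow> (\<forall>x. W x \<ge> 0) \<longrightarrow> case_prod G \<in> borel_measurable borel \<longrightarrow>
    (\<forall>\<tau>. t0 < \<tau> \<and> \<tau> < t \<longrightarrow> (\<integral>\<^sup>+y. ennreal (max R (norm y) powr (- (n - 2 - 2 * \<delta>))) * G \<tau> y \<partial>lborel) \<le> ennreal B) \<longrightarrow>
    (AE x in lborel. ennreal (W x) \<le> (\<integral>\<^sup>+\<tau>. indicator {t0<..<t} \<tau> * (\<integral>\<^sup>+y. ennreal (heat_kernel (t - \<tau>) (x - y)) * G \<tau> y \<partial>lborel) \<partial>lborel)) \<longrightarrow>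
    (\<integral>\<^sup>+x. ennreal (W x powr p) * indicator (ball 0 R) x \<partial>lborel)
      \<le> ennreal ((C * R powr (n / p - 2 * \<delta>) * min 1 ((t - t0) powr \<delta> * R powr (- 2 * \<delta>)) * B) powr p)"
proof -
  let ?K = "\<lambda>t R y. \<integral>\<^sup>+x. ennreal (heat_kernel t (x - y :: 'a) powr p) * indicator (ball 0 R) x \<partial>lborel"
  let ?b = "n - 2 - 2 * \<delta>"
  obtain C1 where C1: "C1 > 0" and K1: "\<And>t R y. t > 0 \<Longrightarrow> R > 0 \<Longrightarrow>
      (?K t R y)
    \<le> ennreal ((C1 * t powr ((n - 2 + 2 * \<delta> - n) / 2) * R powr (n / p) * max R (norm y) powr (-(n - 2 + 2 * \<delta>))) powr p)"
    using nn_integral_ball_heat_kernel_le[where 'a='a, of "n - 2 + 2 * \<delta>" p] \<delta> p unfolding n_def by auto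
  have "?b * p \<le> (n - 2 + 2 * \<delta>) * p" using \<delta> p by (intro mult_right_mono) auto
  then have bp: "?b * p < n" using p by linarith
  obtain C2 where C2: "C2 > 0" and K2: "\<And>t R y. t > 0 \<Longrightarrow> R > 0 \<Longrightarrow>
      (?K t R y)
    \<le> ennreal ((C2 * t powr ((?b - n) / 2) * R powr (n / p) * max R (norm y) powr (-?b)) powr p)"
    using nn_integral_ball_heat_kernel_le[where 'a='a, of ?b p] \<delta> p bp unfolding n_def by auto
  define C where "C = max C1 C2"
  have C: "C > 0" using C1 by (simp add: C_def)
  \<comment> \<open>The bounds with c = n - 2 + 2 \<delta> and c = n - 2 - 2 \<delta> are brought to
    the same spatial factor; what remains of them are the two branches of
    \<open>heat_weight\<close>.\<close>
  have K: "(?K t R y)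
    \<le> ennreal ((C * heat_weight \<delta> R t * R powr (n / p - 2 * \<delta>) * max R (norm y) powr (-?b)) powr p)"
    if t: "t > 0" and R: "R > 0" for t R y
  proof -
    define X where "X = R powr (n / p - 2 * \<delta>) * max R (norm y) powr (-?b)"
    have X: "X \<ge> 0" by (simp add: X_def)
    have "C1 * t powr ((n - 2 + 2 * \<delta> - n) / 2) * R powr (n / p) * max R (norm y) powr (-(n - 2 + 2 * \<delta>))
      = C1 * t powr (\<delta> - 1) * R powr (n / p) * (max R (norm y) powr (- ?b) * max R (norm y) powr (- 4 * \<delta>))"
    proof -
      have "(n - 2 + 2 * \<delta> - n) / 2 = \<delta> - 1" by (simp add: field_simps)
      moreover have "max R (norm y) powr (-(n - 2 + 2 * \<delta>)) = max R (norm y) powr (- ?b) * max R (norm y) powr (- 4 * \<delta>)"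
        by (simp flip: powr_add)
      ultimately show ?thesis by (simp only:)
    qed
    \<comment> \<open>The surplus decay max R |y|^(-4 \<delta>) of the first bound is given up for
      R^(-4 \<delta>), because the second bound does not have it.\<close>
    also have "\<dots> \<le> C1 * t powr (\<delta> - 1) * R powr (n / p) * (max R (norm y) powr (- ?b) * R powr (- 4 * \<delta>))"
      using C1 R \<delta> by (intro mult_left_mono powr_mono2') auto
    also have "\<dots> = C1 * X * (t powr (\<delta> - 1) * R powr (- 2 * \<delta>))"
      using R t unfolding X_def by (simp add: powr_def algebra_simps flip: exp_add)
    also have "\<dots> \<le> C * X * (t powr (\<delta> - 1) * R powr (- 2 * \<delta>))"
      using X by (intro mult_right_mono) (auto simp: C_def)
    finally have "ennreal ((C1 * t powr ((n - 2 + 2 * \<delta> - n) / 2) * R powr (n / p) * max R (norm y) powr (-(n - 2 + 2 * \<delta>))) powr p)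
      \<le> ennreal ((C * X * (t powr (\<delta> - 1) * R powr (- 2 * \<delta>))) powr p)"
      using C1 p by (intro ennreal_leI powr_mono2) auto
    with K1[OF t R, of y] have B1: "(?K t R y)
      \<le> ennreal ((C * X * (t powr (\<delta> - 1) * R powr (- 2 * \<delta>))) powr p)" by (rule order_trans)
    have "(?b - n) / 2 = - 1 - \<delta>" by (simp add: field_simps)
    then have "C2 * t powr ((?b - n) / 2) * R powr (n / p) * max R (norm y) powr (-?b)
      = C2 * t powr (- 1 - \<delta>) * R powr (n / p) * max R (norm y) powr (-?b)" by (simp only:)
    also have "\<dots> = C2 * X * (t powr (- 1 - \<delta>) * R powr (2 * \<delta>))"
    proof -
      have e: "R powr (n / p) = R powr (n / p - 2 * \<delta>) * R powr (2 * \<delta>)"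
        by (simp flip: powr_add)
      show ?thesis unfolding X_def e by (simp only: mult_ac)
    qed
    also have "\<dots> \<le> C * X * (t powr (- 1 - \<delta>) * R powr (2 * \<delta>))"
      using X by (intro mult_right_mono) (auto simp: C_def)
    finally have "ennreal ((C2 * t powr ((?b - n) / 2) * R powr (n / p) * max R (norm y) powr (-?b)) powr p)
      \<le> ennreal ((C * X * (t powr (- 1 - \<delta>) * R powr (2 * \<delta>))) powr p)"
      using C2 p by (intro ennreal_leI powr_mono2) auto
    with K2[OF t R, of y] have B2: "(?K t R y)
      \<le> ennreal ((C * X * (t powr (- 1 - \<delta>) * R powr (2 * \<delta>))) powr p)" by (rule order_trans)
    have "(?K t R y)
      \<le> ennreal ((C * X * heat_weight \<delta> R t) powr p)"
      using B1 B2 by (auto simp: heat_weight_def min_def)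
    also have "C * X * heat_weight \<delta> R t = C * heat_weight \<delta> R t * R powr (n / p - 2 * \<delta>) * max R (norm y) powr (-?b)"
      by (simp add: X_def mult_ac)
    finally show ?thesis .
  qed
  obtain C3 where C3: "C3 > 0" "\<And>h R. h > 0 \<Longrightarrow> R > 0 \<Longrightarrow> (\<integral>\<^sup>+\<tau>. ennreal (heat_weight \<delta> R \<tau>) * indicator {0<..<h} \<tau> \<partial>lborel)
    \<le> ennreal (C3 * min 1 (h powr \<delta> * R powr (- 2 * \<delta>)))"
    using nn_integral_heat_weight_le[OF \<delta>(1)] by blast
  have main: "(\<integral>\<^sup>+x. ennreal (W x powr p) * indicator (ball 0 R) x \<partial>lborel)
      \<le> ennreal (((2 * C * C3) * R powr (n / p - 2 * \<delta>) * min 1 ((t - t0) powr \<delta> * R powr (- 2 * \<delta>)) * B) powr p)"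
    if t: "t0 < t" and R: "R > 0" and B: "B > 0" and W0: "\<forall>x. W x \<ge> 0"
      and [measurable]: "case_prod G \<in> borel_measurable borel"
      and GB: "\<forall>\<tau>. t0 < \<tau> \<and> \<tau> < t \<longrightarrow> (\<integral>\<^sup>+y. ennreal (max R (norm y) powr (- ?b)) * G \<tau> y \<partial>lborel) \<le> ennreal B"
      and W: "AE x in lborel. ennreal (W x) \<le> (\<integral>\<^sup>+\<tau>. indicator {t0<..<t} \<tau> * (\<integral>\<^sup>+y. ennreal (heat_kernel (t - \<tau>) (x - y)) * G \<tau> y \<partial>lborel) \<partial>lborel)"
    for t0 t R B and G :: "real \<Rightarrow> 'a \<Rightarrow> ennreal" and W :: "'a \<Rightarrow> real"
  proof -
    have [measurable]: "case_prod G \<in> borel_measurable (borel \<Otimes>\<^sub>M borel)"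
      using that(5) by (simp add: borel_prod)
    define \<kappa> where "\<kappa> \<tau> y = C * heat_weight \<delta> R (t - \<tau>) * R powr (n / p - 2 * \<delta>) * max R (norm (y::'a)) powr (-?b)" for \<tau> y
    have [measurable]: "(\<lambda>x. \<kappa> (f x) (g x)) \<in> borel_measurable M"
      if [measurable]: "f \<in> borel_measurable M" "g \<in> borel_measurable M" for f g and M :: "('a \<times> real \<times> 'a) measure"
      unfolding \<kappa>_def by measurable
    have [measurable]: "(\<lambda>x. \<kappa> (f x) (g x)) \<in> borel_measurable M"
      if [measurable]: "f \<in> borel_measurable M" "g \<in> borel_measurable M" for f g and M :: "(real \<times> 'a) measure"
      unfolding \<kappa>_def by measurable
    have \<kappa>0: "\<kappa> \<tau> y > 0" if "\<tau> < t" for \<tau> y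
      unfolding \<kappa>_def using that C R by (auto simp: heat_weight_pos)
    let ?E = "ennreal (C * R powr (n / p - 2 * \<delta>) * B)"
    \<comment> \<open>The normalised kernel, with \<open>\<kappa>\<close> moved into
      \<open>f\<close> below. The cut-off in time keeps the division inside the range where
      \<open>\<kappa>\<close> is positive.\<close>
    define k where "k x z = (if t0 < fst z \<and> fst z < t \<and> x \<in> ball 0 R then heat_kernel (t - fst z) (x - snd z) / \<kappa> (fst z) (snd z) else 0)" for x :: 'a and z :: "real \<times> 'a"
    define f where "f z = (if t0 < fst z \<and> fst z < t then ennreal (\<kappa> (fst z) (snd z)) * G (fst z) (snd z) else 0)" for z :: "real \<times> 'a"
    define I where "I = C * R powr (n / p - 2 * \<delta>) * B * (C3 * min 1 ((t - t0) powr \<delta> * R powr (- 2 * \<delta>)))"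
    have Ipos: "I > 0" using C R B C3 t by (auto simp: I_def)
    have [measurable]: "f \<in> borel_measurable (lborel \<Otimes>\<^sub>M lborel)"
      unfolding f_def by measurable
    have fI: "(\<integral>\<^sup>+z. f z \<partial>(lborel \<Otimes>\<^sub>M lborel)) \<le> ennreal I"
    proof -
      have "(\<integral>\<^sup>+z. f z \<partial>(lborel \<Otimes>\<^sub>M lborel)) = (\<integral>\<^sup>+\<tau>. (\<integral>\<^sup>+y. f (\<tau>, y) \<partial>lborel) \<partial>lborel)"
        by (rule lborel.nn_integral_fst[symmetric]) measurable
      also have "\<dots> \<le> (\<integral>\<^sup>+\<tau>. ?E * (ennreal (heat_weight \<delta> R (t - \<tau>)) * indicator {0<..<t-t0} (t - \<tau>)) \<partial>lborel)"
      proof (intro nn_integral_mono)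
        fix \<tau> :: real
        show "(\<integral>\<^sup>+y. f (\<tau>, y) \<partial>lborel) \<le> ?E * (ennreal (heat_weight \<delta> R (t - \<tau>)) * indicator {0<..<t-t0} (t - \<tau>))"
        proof (cases "t0 < \<tau> \<and> \<tau> < t")
          case True
          let ?c = "C * heat_weight \<delta> R (t - \<tau>) * R powr (n / p - 2 * \<delta>)"
          have c: "?c \<ge> 0" using C by (simp add: heat_weight_nonneg)
          have "(\<integral>\<^sup>+y. f (\<tau>, y) \<partial>lborel) = (\<integral>\<^sup>+y. ennreal ?c * (ennreal (max R (norm y) powr (-?b)) * G \<tau> y) \<partial>lborel)"
          proof (intro nn_integral_cong)
            fix y
            have "ennreal (\<kappa> \<tau> y) = ennreal ?c * ennreal (max R (norm y) powr (-?b))"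
              unfolding \<kappa>_def using c by (intro ennreal_mult) auto
            then show "f (\<tau>, y) = ennreal ?c * (ennreal (max R (norm y) powr (-?b)) * G \<tau> y)"
              using True by (simp only: f_def fst_conv snd_conv simp_thms if_True mult.assoc)
          qed
          also have "\<dots> = ennreal ?c * (\<integral>\<^sup>+y. ennreal (max R (norm y) powr (-?b)) * G \<tau> y \<partial>lborel)"
            by (rule nn_integral_cmult) measurable
          also have "\<dots> \<le> ennreal ?c * ennreal B" using GB True by (intro mult_left_mono) auto
          also have "\<dots> = ?E * ennreal (heat_weight \<delta> R (t - \<tau>))"
            using c C B by (subst (1 2) ennreal_mult[symmetric]) (auto simp: heat_weight_nonneg mult_ac)
          finally show ?thesis using True by simp
        qed (auto simp: f_def)
      qed
      also have "\<dots> = ?E * (\<integral>\<^sup>+\<tau>. ennreal (heat_weight \<delta> R (t - \<tau>)) * indicator {0<..<t-t0} (t - \<tau>) \<partial>lborel)"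
        by (rule nn_integral_cmult) measurable
      also have "(\<integral>\<^sup>+\<tau>. ennreal (heat_weight \<delta> R (t - \<tau>)) * indicator {0<..<t-t0} (t - \<tau>) \<partial>lborel)
        = (\<integral>\<^sup>+\<tau>. ennreal (heat_weight \<delta> R \<tau>) * indicator {0<..<t-t0} \<tau> \<partial>lborel)"
        by (subst nn_integral_real_affine[of "\<lambda>\<tau>. ennreal (heat_weight \<delta> R \<tau>) * indicator {0<..<t-t0} \<tau>" "-1" t]) auto
      also have "?E * \<dots> \<le> ?E * ennreal (C3 * min 1 ((t - t0) powr \<delta> * R powr (- 2 * \<delta>)))"
        using t R by (intro mult_left_mono C3) auto
      also have "\<dots> = ennreal I"
        using C C3 B unfolding I_def by (simp flip: ennreal_mult)
      finally show ?thesis .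
    qed
    have "(\<integral>\<^sup>+x. ennreal ((W x * indicator (ball 0 R) x) powr p) \<partial>lborel) \<le> ennreal ((2 * I) powr p)"
    proof (rule Minkowski_type_inequality[where N = "lborel \<Otimes>\<^sub>M lborel" and k = k and f = f])
      show "sigma_finite_measure (lborel :: 'a measure)" ..
      show "sigma_finite_measure ((lborel :: real measure) \<Otimes>\<^sub>M (lborel :: 'a measure))"
        by (intro sigma_finite_pair_measure) unfold_locales
      show "case_prod k \<in> borel_measurable (lborel \<Otimes>\<^sub>M (lborel \<Otimes>\<^sub>M lborel))"
        unfolding k_def by measurable
      show "f \<in> borel_measurable (lborel \<Otimes>\<^sub>M lborel)" by measurable
      show "k x z \<ge> 0" for x z
        unfolding k_def using \<kappa>0[of "fst z" "snd z"] by (auto intro!: divide_nonneg_pos heat_kernel_nonneg)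
      show "W x * indicator (ball 0 R) x \<ge> 0" for x using W0 by simp
      show "p \<ge> 1" "I > 0" by fact+
      show "(\<integral>\<^sup>+z. f z \<partial>(lborel \<Otimes>\<^sub>M lborel)) \<le> ennreal I" by fact
      show "(\<integral>\<^sup>+x. ennreal (k x z powr p) \<partial>lborel) \<le> 1" for z
      proof (cases "t0 < fst z \<and> fst z < t")
        case True
        obtain \<tau> y where z: "z = (\<tau>, y)" by (cases z)
        have \<tau>: "t0 < \<tau>" "\<tau> < t" using True z by auto
        have "(\<integral>\<^sup>+x. ennreal (k x z powr p) \<partial>lborel) = (\<integral>\<^sup>+x. ennreal (1 / \<kappa> \<tau> y powr p) * (ennreal (heat_kernel (t - \<tau>) (x - y) powr p) * indicator (ball 0 R) x) \<partial>lborel)"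
          using \<tau> \<kappa>0[OF \<tau>(2), of y] p
          by (intro nn_integral_cong) (auto simp: k_def z powr_divide heat_kernel_nonneg indicator_def simp flip: ennreal_mult)
        also have "\<dots> = ennreal (1 / \<kappa> \<tau> y powr p) * (\<integral>\<^sup>+x. ennreal (heat_kernel (t - \<tau>) (x - y) powr p) * indicator (ball 0 R) x \<partial>lborel)"
          by (rule nn_integral_cmult) measurable
        also have "\<dots> \<le> ennreal (1 / \<kappa> \<tau> y powr p) * ennreal (\<kappa> \<tau> y powr p)"
          unfolding \<kappa>_def using \<tau> R by (intro mult_left_mono K) auto
        also have "\<dots> = 1" using \<kappa>0[OF \<tau>(2), of y] by (simp flip: ennreal_mult)
        finally show ?thesis .
      qed (auto simp: k_def)
      show "AE x in lborel. ennreal (W x * indicator (ball 0 R) x) \<le> (\<integral>\<^sup>+z. ennreal (k x z) * f z \<partial>(lborel \<Otimes>\<^sub>M lborel))"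
        using W
      proof eventually_elim
        case (elim x)
        show ?case
        proof (cases "x \<in> ball 0 R")
          case True
          have [measurable]: "k x \<in> borel_measurable (lborel \<Otimes>\<^sub>M lborel)"
            unfolding k_def by measurable
          have "(\<integral>\<^sup>+\<tau>. indicator {t0<..<t} \<tau> * (\<integral>\<^sup>+y. ennreal (heat_kernel (t - \<tau>) (x - y)) * G \<tau> y \<partial>lborel) \<partial>lborel)
            = (\<integral>\<^sup>+\<tau>. (\<integral>\<^sup>+y. ennreal (k x (\<tau>, y)) * f (\<tau>, y) \<partial>lborel) \<partial>lborel)"
          proof (intro nn_integral_cong)
            fix \<tau> :: real
            show "indicator {t0<..<t} \<tau> * (\<integral>\<^sup>+y. ennreal (heat_kernel (t - \<tau>) (x - y)) * G \<tau> y \<partial>lborel)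
              = (\<integral>\<^sup>+y. ennreal (k x (\<tau>, y)) * f (\<tau>, y) \<partial>lborel)"
            proof (cases "t0 < \<tau> \<and> \<tau> < t")
              case T: True
              have "ennreal (heat_kernel (t - \<tau>) (x - y)) * G \<tau> y = ennreal (k x (\<tau>, y)) * f (\<tau>, y)" for y
              proof -
                have "ennreal (heat_kernel (t - \<tau>) (x - y) / \<kappa> \<tau> y) * ennreal (\<kappa> \<tau> y) = ennreal (heat_kernel (t - \<tau>) (x - y))"
                  using T \<kappa>0[of \<tau> y] heat_kernel_nonneg[of "t - \<tau>" "x - y"] by (subst ennreal_mult[symmetric]) auto
                then show ?thesis using T True by (simp add: k_def f_def mult.assoc[symmetric])
              qed
              then show ?thesis using T by simp
            qed (auto simp: k_def)
          qed
          also have "\<dots> = (\<integral>\<^sup>+z. ennreal (k x z) * f z \<partial>(lborel \<Otimes>\<^sub>M lborel))"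
            by (rule lborel.nn_integral_fst) measurable
          finally show ?thesis using elim True by simp
        qed auto
      qed
    qed
    also have "(\<integral>\<^sup>+x. ennreal ((W x * indicator (ball 0 R) x) powr p) \<partial>lborel) = (\<integral>\<^sup>+x. ennreal (W x powr p) * indicator (ball 0 R) x \<partial>lborel)"
      using p by (intro nn_integral_cong) (auto simp: indicator_def)
    also have "2 * I = (2 * C * C3) * R powr (n / p - 2 * \<delta>) * min 1 ((t - t0) powr \<delta> * R powr (- 2 * \<delta>)) * B"
      by (simp add: I_def mult_ac)
    finally show ?thesis .
  qed
  have "2 * C * C3 > 0" using C C3 by simp
  then show ?thesis by (intro exI[of _ "2 * C * C3"] conjI allI impI) (assumption | (rule main; assumption))+
qed

section \<open>Herz-type bounds on annuli\<close>

text \<open>For N \<ge> 0 and p > 0 this says that the Herz norm with integrability p, third index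
  \<infinity> and smoothness \<sigma> - n / p is at most N. The parameter \<sigma> is the scaling
  index, which stays the same when p changes. Integrals of p-th powers replace norms in order to
  avoid roots of extended reals.\<close>

definition annular_bound :: "real \<Rightarrow> real \<Rightarrow> real \<Rightarrow> ('a::euclidean_space \<Rightarrow> real) \<Rightarrow> bool" where
  "annular_bound p \<sigma> N w \<longleftrightarrow> w \<in> borel_measurable lebesgue \<and>
     (\<forall>k. (\<integral>\<^sup>+x. ennreal (\<bar>w x\<bar> powr p) * indicator (annulus k) x \<partial>lebesgue)
        \<le> ennreal ((N * 2 powr (- real_of_int k * (\<sigma> - real DIM('a) / p))) powr p))"

text \<open>
  Smallness of \<open>v\<close> in the Herz space, in a form covering both cases: for \<open>c > 0\<close> the sum is controlled by the
  supremum of the \<open>\<nu> k\<close> alone, for \<open>c = 0\<close> the \<open>\<nu> k powr \<beta>\<close> have to be summable.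
\<close>

definition annular_control :: "real \<Rightarrow> real \<Rightarrow> real \<Rightarrow> real \<Rightarrow> real \<Rightarrow> ('a::euclidean_space \<Rightarrow> real) \<Rightarrow> bool" where
  "annular_control c \<beta> Q \<sigma> \<eta> v \<longleftrightarrow> v \<in> borel_measurable lebesgue \<and>
     (\<exists>\<nu>. (\<forall>k. 0 \<le> \<nu> k \<and> (\<integral>\<^sup>+x. ennreal (\<bar>v x\<bar> powr Q) * indicator (annulus k) x \<partial>lebesgue)
            \<le> ennreal ((\<nu> k * 2 powr (- real_of_int k * (\<sigma> - real DIM('a) / Q))) powr Q)) \<and>
        (\<forall>j F. finite F \<longrightarrow> (\<Sum>k\<in>F. 2 powr (- c * \<bar>real_of_int k - real_of_int j\<bar>) * \<nu> k powr \<beta>) \<le> \<eta>))"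

section \<open>Weighted L^1 bounds for potential times w\<close>

lemma norm_powr_annulus_le:
  assumes "x \<in> annulus k"
  shows "norm x powr e \<le> 2 powr \<bar>e\<bar> * 2 powr (real_of_int k * e)"
proof (cases "e \<ge> 0")
  case True
  have "norm x powr e \<le> (2 powr real_of_int k) powr e"
    using assms True by (intro powr_mono2) (auto simp: annulus_def)
  also have "\<dots> = 1 * 2 powr (real_of_int k * e)" by (simp add: powr_powr)
  also have "\<dots> \<le> 2 powr \<bar>e\<bar> * 2 powr (real_of_int k * e)"
    by (intro mult_right_mono ge_one_powr_ge_zero) auto
  finally show ?thesis .
next
  case False
  have "norm x powr e \<le> (2 powr (real_of_int k - 1)) powr e"
    using assms False by (intro powr_mono2') (auto simp: annulus_def)
  also have "\<dots> = 2 powr \<bar>e\<bar> * 2 powr (real_of_int k * e)"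
    using False by (simp add: powr_powr left_diff_distrib flip: powr_add)
  finally show ?thesis .
qed

text \<open>Hoelder with exponents Q / \<beta> and p. The powers of 2^k collect to \<gamma> -
  \<sigma> \<beta> + n - \<sigma>, since n \<beta> / Q + n / p = n, and the critical relation
  \<sigma> \<beta> = 2 + \<gamma> turns this into n - 2 - \<sigma>.\<close>

lemma nn_integral_annulus_weighted:
  fixes v w :: "'a::euclidean_space \<Rightarrow> real"
  defines "n \<equiv> real DIM('a)"
  assumes v [measurable]: "v \<in> borel_measurable lebesgue" and w [measurable]: "w \<in> borel_measurable lebesgue"
    and \<beta>: "\<beta> > 0" and Q: "Q > 0" and p: "p > 0" and Qp: "\<beta> / Q + 1 / p = 1"
    and \<sigma>: "\<sigma> * \<beta> = 2 + \<gamma>" and \<nu>: "\<nu> \<ge> 0" and N: "N \<ge> 0"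
    and vQ: "(\<integral>\<^sup>+x. ennreal (\<bar>v x\<bar> powr Q) * indicator (annulus k) x \<partial>lebesgue)
      \<le> ennreal ((\<nu> * 2 powr (- real_of_int k * (\<sigma> - n / Q))) powr Q)"
    and wp: "(\<integral>\<^sup>+x. ennreal (\<bar>w x\<bar> powr p) * indicator (annulus k) x \<partial>lebesgue)
      \<le> ennreal ((N * 2 powr (- real_of_int k * (\<sigma> - n / p))) powr p)"
  shows "(\<integral>\<^sup>+x. ennreal (norm x powr \<gamma> * \<bar>v x\<bar> powr \<beta> * \<bar>w x\<bar>) * indicator (annulus k) x \<partial>lebesgue)
    \<le> ennreal (2 * 2 powr \<bar>\<gamma>\<bar> * \<nu> powr \<beta> * N * 2 powr (real_of_int k * (n - 2 - \<sigma>)))"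
proof -
  let ?k = "real_of_int k"
  let ?i = "\<lambda>x::'a. indicator (annulus k) x :: real"
  define a where "a = (\<nu> * 2 powr (- ?k * (\<sigma> - n / Q))) powr \<beta>"
  define b where "b = N * 2 powr (- ?k * (\<sigma> - n / p))"
  define D where "D = 2 powr \<bar>\<gamma>\<bar> * 2 powr (?k * \<gamma>)"
  have D0: "D \<ge> 0" by (simp add: D_def)
  have Hoelder: "(\<integral>\<^sup>+x. ennreal ((\<bar>v x\<bar> powr \<beta> * ?i x) * (\<bar>w x\<bar> * ?i x)) \<partial>lebesgue) \<le> ennreal (2 * a * b)"
  proof (rule Hoelder_type_inequality[where m = "Q / \<beta>" and p = p])
    have "(\<integral>\<^sup>+x. ennreal ((\<bar>v x\<bar> powr \<beta> * ?i x) powr (Q / \<beta>)) \<partial>lebesgue)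
      = (\<integral>\<^sup>+x. ennreal (\<bar>v x\<bar> powr Q) * indicator (annulus k) x \<partial>lebesgue)"
      using \<beta> by (intro nn_integral_cong) (auto simp: indicator_def powr_powr)
    also note vQ
    also have "(\<nu> * 2 powr (- ?k * (\<sigma> - n / Q))) powr Q = a powr (Q / \<beta>)"
      using \<beta> by (simp add: a_def powr_powr)
    finally show "(\<integral>\<^sup>+x. ennreal ((\<bar>v x\<bar> powr \<beta> * ?i x) powr (Q / \<beta>)) \<partial>lebesgue) \<le> ennreal (a powr (Q / \<beta>))" .
    have "(\<integral>\<^sup>+x. ennreal ((\<bar>w x\<bar> * ?i x) powr p) \<partial>lebesgue)
      = (\<integral>\<^sup>+x. ennreal (\<bar>w x\<bar> powr p) * indicator (annulus k) x \<partial>lebesgue)"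
      using p by (intro nn_integral_cong) (auto simp: indicator_def)
    also note wp
    finally show "(\<integral>\<^sup>+x. ennreal ((\<bar>w x\<bar> * ?i x) powr p) \<partial>lebesgue) \<le> ennreal (b powr p)"
      by (simp add: b_def)
  qed (use \<beta> Q p Qp N in \<open>auto simp: a_def b_def\<close>)
  have "(\<integral>\<^sup>+x. ennreal (norm x powr \<gamma> * \<bar>v x\<bar> powr \<beta> * \<bar>w x\<bar>) * indicator (annulus k) x \<partial>lebesgue)
    \<le> (\<integral>\<^sup>+x. ennreal D * ennreal ((\<bar>v x\<bar> powr \<beta> * ?i x) * (\<bar>w x\<bar> * ?i x)) \<partial>lebesgue)"
  proof (intro nn_integral_mono)
    fix x :: 'a
    show "ennreal (norm x powr \<gamma> * \<bar>v x\<bar> powr \<beta> * \<bar>w x\<bar>) * indicator (annulus k) x \<le> ennreal D * ennreal ((\<bar>v x\<bar> powr \<beta> * ?i x) * (\<bar>w x\<bar> * ?i x))"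
    proof (cases "x \<in> annulus k")
      case True
      have "norm x powr \<gamma> * (\<bar>v x\<bar> powr \<beta> * \<bar>w x\<bar>) \<le> D * (\<bar>v x\<bar> powr \<beta> * \<bar>w x\<bar>)"
        unfolding D_def using True by (intro mult_right_mono norm_powr_annulus_le) auto
      then show ?thesis using True D0 by (simp add: mult.assoc ennreal_leI ennreal_mult[symmetric])
    qed auto
  qed
  also have "\<dots> = ennreal D * (\<integral>\<^sup>+x. ennreal ((\<bar>v x\<bar> powr \<beta> * ?i x) * (\<bar>w x\<bar> * ?i x)) \<partial>lebesgue)"
    by (rule nn_integral_cmult) measurable
  also have "\<dots> \<le> ennreal D * ennreal (2 * a * b)"
    using Hoelder by (intro mult_left_mono) auto
  also have "\<dots> = ennreal (D * (2 * a * b))"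
    by (intro ennreal_mult[symmetric]) (auto simp: D_def a_def b_def N)
  also have "D * (2 * a * b) = 2 * 2 powr \<bar>\<gamma>\<bar> * \<nu> powr \<beta> * N * (2 powr (?k * \<gamma>) * 2 powr (- ?k * (\<sigma> - n / Q) * \<beta>) * 2 powr (- ?k * (\<sigma> - n / p)))"
    unfolding D_def a_def b_def using \<nu> by (simp add: powr_mult powr_powr)
  also have "2 powr (?k * \<gamma>) * 2 powr (- ?k * (\<sigma> - n / Q) * \<beta>) * 2 powr (- ?k * (\<sigma> - n / p))
    = 2 powr (?k * \<gamma> + - ?k * (\<sigma> - n / Q) * \<beta> + - ?k * (\<sigma> - n / p))"
    by (simp only: powr_add)
  also have "?k * \<gamma> + - ?k * (\<sigma> - n / Q) * \<beta> + - ?k * (\<sigma> - n / p) = ?k * (\<gamma> - \<sigma> * \<beta> + n * (\<beta> / Q + 1 / p) - \<sigma>)"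
    by (simp add: algebra_simps)
  also have "\<gamma> - \<sigma> * \<beta> + n * (\<beta> / Q + 1 / p) - \<sigma> = n - 2 - \<sigma>"
    unfolding \<sigma> Qp by simp
  finally show ?thesis .
qed

text \<open>Here 2^(k d) is the growth of the mass on annulus k. For k \<le> j the weight is at most
  2^(-j b), so the product decays at rate d towards the origin; for k > j the weight behaves like
  2^(-k b) and the product decays at rate b - d outwards. The rate c is one that both sides
  reach.\<close>

lemma max_powr_shell_le:
  fixes j k :: int and b d c R :: real
  assumes d: "0 \<le> d" "d \<le> b" and c: "0 \<le> c" "c \<le> d" "c \<le> b - d" and x: "x \<in> annulus k"
  shows "max (2 powr real_of_int j) (norm x) powr (- b) * 2 powr (real_of_int k * d)
    \<le> 2 powr b * 2 powr (real_of_int j * (d - b)) * 2 powr (- c * \<bar>real_of_int k - real_of_int j\<bar>)"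
proof (cases "k \<le> j")
  case True
  have "max (2 powr real_of_int j) (norm x) powr (- b) \<le> (2 powr real_of_int j) powr (- b)"
    using d by (intro powr_mono2') auto
  then have "max (2 powr real_of_int j) (norm x) powr (- b) * 2 powr (real_of_int k * d) \<le> (2 powr real_of_int j) powr (- b) * 2 powr (real_of_int k * d)"
    by (intro mult_right_mono) auto
  also have "\<dots> = 2 powr (real_of_int j * (d - b) - d * (real_of_int j - real_of_int k))"
    by (simp add: powr_powr algebra_simps flip: powr_add)
  also have "\<dots> \<le> 2 powr (b + real_of_int j * (d - b) + - c * \<bar>real_of_int k - real_of_int j\<bar>)"
  proof (intro powr_mono)
    have "c * (real_of_int j - real_of_int k) \<le> d * (real_of_int j - real_of_int k)"
      using c True by (intro mult_right_mono) auto
    then show "real_of_int j * (d - b) - d * (real_of_int j - real_of_int k) \<le> b + real_of_int j * (d - b) + - c * \<bar>real_of_int k - real_of_int j\<bar>"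
      using True d by (simp add: abs_if)
  qed auto
  finally show ?thesis by (simp only: powr_add)
next
  case False
  have "2 powr (real_of_int k - 1) \<le> max (2 powr real_of_int j) (norm x)"
    using x by (intro max.coboundedI2) (simp add: annulus_def)
  then have "max (2 powr real_of_int j) (norm x) powr (- b) \<le> (2 powr (real_of_int k - 1)) powr (- b)"
    using d by (intro powr_mono2') auto
  then have "max (2 powr real_of_int j) (norm x) powr (- b) * 2 powr (real_of_int k * d) \<le> (2 powr (real_of_int k - 1)) powr (- b) * 2 powr (real_of_int k * d)"
    by (intro mult_right_mono) auto
  also have "\<dots> = 2 powr (b + real_of_int j * (d - b) - (b - d) * (real_of_int k - real_of_int j))"
    by (simp add: powr_powr algebra_simps flip: powr_add)
  also have "\<dots> \<le> 2 powr (b + real_of_int j * (d - b) + - c * \<bar>real_of_int k - real_of_int j\<bar>)"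
  proof (intro powr_mono)
    have "c * (real_of_int k - real_of_int j) \<le> (b - d) * (real_of_int k - real_of_int j)"
      using c False by (intro mult_right_mono) auto
    then show "b + real_of_int j * (d - b) - (b - d) * (real_of_int k - real_of_int j) \<le> b + real_of_int j * (d - b) + - c * \<bar>real_of_int k - real_of_int j\<bar>"
      using False by (simp add: abs_if)
  qed auto
  finally show ?thesis by (simp only: powr_add)
qed

text \<open>The critical part of the potential. If \<sigma> = n - 2 then c = 0 is forced: annuli
  inside |y| < 2^j contribute without decay, and convergence rests on the summability of
  \<open>\<nu> k powr \<beta>\<close> contained in \<open>annular_control\<close>.\<close>

lemma nn_integral_small_potential:
  fixes v w :: "'a::euclidean_space \<Rightarrow> real"
  defines "n \<equiv> real DIM('a)"
  assumes \<beta>: "\<beta> > 0" and Q: "Q > 0" and p: "p > 0" and Qp: "\<beta> / Q + 1 / p = 1"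
    and \<sigma>: "\<sigma> * \<beta> = 2 + \<gamma>" and N: "N \<ge> 0"
    and d: "0 \<le> n - 2 - \<sigma>" "n - 2 - \<sigma> \<le> b" and c: "0 \<le> c" "c \<le> n - 2 - \<sigma>" "c \<le> b - (n - 2 - \<sigma>)"
    and v: "annular_control c \<beta> Q \<sigma> \<eta> v" and w: "annular_bound p \<sigma> N w"
  shows "(\<integral>\<^sup>+y. ennreal (max (2 powr real_of_int j) (norm y) powr (- b) * (norm y powr \<gamma> * \<bar>v y\<bar> powr \<beta> * \<bar>w y\<bar>)) \<partial>lebesgue)
    \<le> ennreal (2 powr b * 2 * 2 powr \<bar>\<gamma>\<bar> * \<eta> * N * 2 powr (real_of_int j * (n - 2 - \<sigma> - b)))"
proof -
  let ?f = "\<lambda>y::'a. max (2 powr real_of_int j) (norm y) powr (- b) * (norm y powr \<gamma> * \<bar>v y\<bar> powr \<beta> * \<bar>w y\<bar>)"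
  let ?d = "n - 2 - \<sigma>"
  have [measurable]: "v \<in> borel_measurable lebesgue" "w \<in> borel_measurable lebesgue"
    using v w by (auto simp: annular_control_def annular_bound_def)
  have nm [measurable]: "norm \<in> borel_measurable (lebesgue :: 'a measure)"
    by (intro measurable_completion) auto
  obtain \<nu> where \<nu>: "\<And>k. 0 \<le> \<nu> k"
    "\<And>k. (\<integral>\<^sup>+x. ennreal (\<bar>v x\<bar> powr Q) * indicator (annulus k) x \<partial>lebesgue)
            \<le> ennreal ((\<nu> k * 2 powr (- real_of_int k * (\<sigma> - n / Q))) powr Q)"
    "\<And>j F. finite F \<Longrightarrow> (\<Sum>k\<in>F. 2 powr (- c * \<bar>real_of_int k - real_of_int j\<bar>) * \<nu> k powr \<beta>) \<le> \<eta>"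
    using v unfolding annular_control_def n_def by blast
  define E where "E = 2 powr b * 2 powr (real_of_int j * (?d - b))"
  define D where "D = 2 * 2 powr \<bar>\<gamma>\<bar> * N * E"
  define a where "a k = D * (2 powr (- c * \<bar>real_of_int k - real_of_int j\<bar>) * \<nu> k powr \<beta>)" for k
  have D: "D \<ge> 0" "E \<ge> 0" using N by (auto simp: D_def E_def)
  have "(\<integral>\<^sup>+y. ennreal (?f y) \<partial>lebesgue) \<le> ennreal (D * \<eta>)"
  proof (rule nn_integral_annuli_le[where a = a])
    show "(\<lambda>y. ennreal (?f y)) \<in> borel_measurable lebesgue"
      by measurable
    show "a k \<ge> 0" for k using D by (simp add: a_def)
    show "(\<Sum>k\<in>F. a k) \<le> D * \<eta>" if "finite F" for F
      unfolding a_def sum_distrib_left[symmetric] using D \<nu>(3)[OF that] by (intro mult_left_mono) auto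
    fix k
    define e where "e = E * 2 powr (- c * \<bar>real_of_int k - real_of_int j\<bar>) * 2 powr (- real_of_int k * ?d)"
    have e: "e \<ge> 0" using D by (simp add: e_def)
    have "(\<integral>\<^sup>+y. ennreal (?f y) * indicator (annulus k) y \<partial>lebesgue)
      \<le> (\<integral>\<^sup>+y. ennreal e * (ennreal (norm y powr \<gamma> * \<bar>v y\<bar> powr \<beta> * \<bar>w y\<bar>) * indicator (annulus k) y) \<partial>lebesgue)"
    proof (intro nn_integral_mono)
      fix y :: 'a
      have "max (2 powr real_of_int j) (norm y) powr (- b) \<le> e" if "y \<in> annulus k"
      proof -
        have "max (2 powr real_of_int j) (norm y) powr (- b) * 2 powr (real_of_int k * ?d) * 2 powr (- real_of_int k * ?d) \<le> e"
          unfolding e_def E_def using max_powr_shell_le[OF d c that, of j] by (intro mult_right_mono) auto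
        moreover have "2 powr (real_of_int k * ?d) * 2 powr (- real_of_int k * ?d) = (1::real)" by (simp flip: powr_add)
        ultimately show ?thesis by (simp only: mult.assoc mult_1_right)
      qed
      then show "ennreal (?f y) * indicator (annulus k) y
        \<le> ennreal e * (ennreal (norm y powr \<gamma> * \<bar>v y\<bar> powr \<beta> * \<bar>w y\<bar>) * indicator (annulus k) y)"
        using e by (auto simp: indicator_def simp flip: ennreal_mult intro!: ennreal_leI mult_right_mono)
    qed
    also have "\<dots> = ennreal e * (\<integral>\<^sup>+y. ennreal (norm y powr \<gamma> * \<bar>v y\<bar> powr \<beta> * \<bar>w y\<bar>) * indicator (annulus k) y \<partial>lebesgue)"
      by (rule nn_integral_cmult) measurable
    also have "\<dots> \<le> ennreal e * ennreal (2 * 2 powr \<bar>\<gamma>\<bar> * \<nu> k powr \<beta> * N * 2 powr (real_of_int k * (real DIM('a) - 2 - \<sigma>)))"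
      using w \<nu>(1,2)[of k] \<beta> Q p Qp \<sigma> N unfolding annular_bound_def n_def
      by (intro mult_left_mono nn_integral_annulus_weighted[where Q = Q and p = p]) auto
    also have "\<dots> = ennreal (e * (2 * 2 powr \<bar>\<gamma>\<bar> * \<nu> k powr \<beta> * N * 2 powr (real_of_int k * ?d)))"
      using e N by (simp add: n_def ennreal_mult)
    also have "e * (2 * 2 powr \<bar>\<gamma>\<bar> * \<nu> k powr \<beta> * N * 2 powr (real_of_int k * ?d)) = a k"
    proof -
      have "2 powr (- real_of_int k * ?d) * 2 powr (real_of_int k * ?d) = 1" by (simp flip: powr_add)
      moreover have "e * (2 * 2 powr \<bar>\<gamma>\<bar> * \<nu> k powr \<beta> * N * 2 powr (real_of_int k * ?d))
        = a k * (2 powr (- real_of_int k * ?d) * 2 powr (real_of_int k * ?d))"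
        unfolding e_def a_def D_def by (simp only: mult_ac)
      ultimately show ?thesis by simp
    qed
    finally show "(\<integral>\<^sup>+y. ennreal (?f y) * indicator (annulus k) y \<partial>lebesgue) \<le> ennreal (a k)" .
  qed
  also have "D * \<eta> = 2 powr b * 2 * 2 powr \<bar>\<gamma>\<bar> * \<eta> * N * 2 powr (real_of_int j * (n - 2 - \<sigma> - b))"
    by (simp add: D_def E_def mult_ac)
  finally show ?thesis .
qed

text \<open>Writing max R |y|^(-b) \<le> R^(e - b) |y|^(-e) moves e powers from R to |y|. The
  condition \<gamma> - e + n - \<sigma> > 0 then gives convergence at the origin, and the support of
  \<phi> stops the sum at annulus K. C depends on \<phi> through M and K, but not on w, N or
  R.\<close>

lemma nn_integral_bounded_potential:
  fixes \<phi> :: "'a::euclidean_space \<Rightarrow> real"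
  defines "n \<equiv> real DIM('a)"
  assumes \<phi> [measurable]: "\<phi> \<in> borel_measurable lebesgue" and M: "\<And>y. \<bar>\<phi> y\<bar> \<le> M"
    and supp: "\<And>y. \<phi> y \<noteq> 0 \<Longrightarrow> norm y < 2 powr real_of_int K"
    and \<beta>: "\<beta> > 0" and p: "p > 1" and e: "0 \<le> e" "e \<le> b" and pos: "\<gamma> - e + n - \<sigma> > 0"
  shows "\<exists>C>0. \<forall>N w R. N \<ge> 0 \<longrightarrow> R > 0 \<longrightarrow> annular_bound p \<sigma> N w \<longrightarrow>
    (\<integral>\<^sup>+y. ennreal (max R (norm y) powr (- b) * (norm y powr \<gamma> * \<bar>\<phi> y\<bar> powr \<beta> * \<bar>w y\<bar>)) \<partial>lebesgue)
    \<le> ennreal (C * N * R powr (e - b))"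
proof -
  let ?f = "\<lambda>R w (y::'a). max R (norm y) powr (- b) * (norm y powr \<gamma> * \<bar>\<phi> y\<bar> powr \<beta> * \<bar>w y\<bar>)"
  define x where "x = \<gamma> - e + n - \<sigma>"
  have x: "x > 0" using pos by (simp add: x_def)
  obtain C1 where C1: "C1 > 0" "\<And>k. emeasure lborel (annulus k :: 'a set) \<le> ennreal (C1 * 2 powr (n * real_of_int k))"
    using emeasure_annulus_le unfolding n_def by blast
  obtain C2 where C2: "C2 > 0" "\<And>F j. finite F \<Longrightarrow> (\<Sum>k\<in>F. 2 powr (- x * \<bar>real_of_int k - real_of_int j\<bar>)) \<le> C2"
    using sum_powr_abs_le[OF x] by blast
  define m where "m = p / (p - 1)"
  have m: "m > 0" "1 / m + 1 / p = 1" using p by (auto simp: m_def field_simps)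
  define L where "L = 2 * C1 powr (1 / m)"
  have L: "L > 0" using C1 by (simp add: L_def)
  have M0: "M \<ge> 0" using M[of 0] by linarith
  have nm [measurable]: "norm \<in> borel_measurable (lebesgue :: 'a measure)"
    by (intro measurable_completion) auto
  \<comment> \<open>The summand 1 keeps C positive when M = 0.\<close>
  define C where "C = (M powr \<beta> + 1) * 2 powr \<bar>\<gamma> - e\<bar> * L * 2 powr (real_of_int K * x) * C2"
  have C: "C > 0" using C2 L by (auto simp: C_def intro!: mult_pos_pos add_nonneg_pos)
  have main: "(\<integral>\<^sup>+y. ennreal (?f R w y) \<partial>lebesgue)
    \<le> ennreal (C * N * R powr (e - b))" if N: "N \<ge> 0" and R: "R > 0" and w: "annular_bound p \<sigma> N w" for N R w
  proof -
    have [measurable]: "w \<in> borel_measurable lebesgue" using w by (simp add: annular_bound_def)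
    have w1: "(\<integral>\<^sup>+y. ennreal \<bar>w y\<bar> * indicator (annulus k) y \<partial>lebesgue) \<le> ennreal (L * N * 2 powr (real_of_int k * (n - \<sigma>)))" for k
    proof -
      let ?i = "\<lambda>x::'a. indicator (annulus k) x :: real"
      have "(\<integral>\<^sup>+y. ennreal (?i y * (\<bar>w y\<bar> * ?i y)) \<partial>lebesgue) \<le> ennreal (2 * (C1 * 2 powr (n * real_of_int k)) powr (1 / m) * (N * 2 powr (- real_of_int k * (\<sigma> - n / p))))"
      proof (rule Hoelder_type_inequality[where m = m and p = p])
        have "(\<integral>\<^sup>+x. ennreal (?i x powr m) \<partial>lebesgue) = (\<integral>\<^sup>+x. indicator (annulus k :: 'a set) x \<partial>lebesgue)"
          by (intro nn_integral_cong) (auto simp: indicator_def)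
        also have "\<dots> = emeasure lborel (annulus k :: 'a set)" by simp
        also note C1(2)[of k]
        also have "C1 * 2 powr (n * real_of_int k) = ((C1 * 2 powr (n * real_of_int k)) powr (1 / m)) powr m"
          using C1 m by (simp add: powr_powr)
        finally show "(\<integral>\<^sup>+x. ennreal (?i x powr m) \<partial>lebesgue) \<le> ennreal (((C1 * 2 powr (n * real_of_int k)) powr (1 / m)) powr m)" .
        have "(\<integral>\<^sup>+x. ennreal ((\<bar>w x\<bar> * ?i x) powr p) \<partial>lebesgue)
          = (\<integral>\<^sup>+x. ennreal (\<bar>w x\<bar> powr p) * indicator (annulus k) x \<partial>lebesgue)"
          using p by (intro nn_integral_cong) (auto simp: indicator_def)
        also have "\<dots> \<le> ennreal ((N * 2 powr (- real_of_int k * (\<sigma> - n / p))) powr p)"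
          using w unfolding annular_bound_def n_def by blast
        finally show "(\<integral>\<^sup>+x. ennreal ((\<bar>w x\<bar> * ?i x) powr p) \<partial>lebesgue) \<le> ennreal ((N * 2 powr (- real_of_int k * (\<sigma> - n / p))) powr p)" .
      qed (use p m N in auto)
      also have "2 * (C1 * 2 powr (n * real_of_int k)) powr (1 / m) * (N * 2 powr (- real_of_int k * (\<sigma> - n / p)))
        = L * N * (2 powr (n * real_of_int k * (1 / m)) * 2 powr (- real_of_int k * (\<sigma> - n / p)))"
        using C1 by (simp add: L_def powr_mult powr_powr)
      also have "2 powr (n * real_of_int k * (1 / m)) * 2 powr (- real_of_int k * (\<sigma> - n / p)) = (2::real) powr (real_of_int k * (n * (1 / m + 1 / p) - \<sigma>))"
        by (simp add: algebra_simps flip: powr_add)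
      also have "n * (1 / m + 1 / p) - \<sigma> = n - \<sigma>" using m by simp
      finally have "(\<integral>\<^sup>+y. ennreal (?i y * (\<bar>w y\<bar> * ?i y)) \<partial>lebesgue) \<le> ennreal (L * N * 2 powr (real_of_int k * (n - \<sigma>)))" .
      moreover have "(\<integral>\<^sup>+y. ennreal (?i y * (\<bar>w y\<bar> * ?i y)) \<partial>lebesgue) = (\<integral>\<^sup>+y. ennreal \<bar>w y\<bar> * indicator (annulus k) y \<partial>lebesgue)"
        by (intro nn_integral_cong) (auto simp: indicator_def)
      ultimately show ?thesis by simp
    qed
    define D where "D = R powr (e - b) * (M powr \<beta> + 1) * 2 powr \<bar>\<gamma> - e\<bar>"
    have D: "D \<ge> 0" by (auto simp: D_def)
    \<comment> \<open>The factor |y|^(\<gamma> - e) and the L^1 bound on w together give 2^(k x);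
      for k \<le> K this equals 2^(K x) 2^(-x |k - K|).\<close>
    define a where "a k = D * (L * N) * 2 powr (real_of_int K * x) * 2 powr (- x * \<bar>real_of_int k - real_of_int K\<bar>)" for k
    have "(\<integral>\<^sup>+y. ennreal (?f R w y) \<partial>lebesgue)
      \<le> ennreal (D * (L * N) * 2 powr (real_of_int K * x) * C2)"
    proof (rule nn_integral_annuli_le[where a = a])
      show "(\<lambda>y. ennreal (?f R w y)) \<in> borel_measurable lebesgue"
        by measurable
      show "a k \<ge> 0" for k using D L N by (simp add: a_def)
      show "(\<Sum>k\<in>F. a k) \<le> D * (L * N) * 2 powr (real_of_int K * x) * C2" if "finite F" for F
        unfolding a_def sum_distrib_left[symmetric] using D L N C2(2)[OF that] by (intro mult_left_mono) auto
      fix k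
      show "(\<integral>\<^sup>+y. ennreal (?f R w y) * indicator (annulus k) y \<partial>lebesgue) \<le> ennreal (a k)"
      proof (cases "k \<le> K")
        case True
        have "(\<integral>\<^sup>+y. ennreal (?f R w y) * indicator (annulus k) y \<partial>lebesgue)
          \<le> (\<integral>\<^sup>+y. ennreal (D * 2 powr (real_of_int k * (\<gamma> - e))) * (ennreal \<bar>w y\<bar> * indicator (annulus k) y) \<partial>lebesgue)"
        proof (intro nn_integral_mono)
          fix y :: 'a
          have "max R (norm y) powr (- b) * (norm y powr \<gamma> * \<bar>\<phi> y\<bar> powr \<beta>) \<le> D * 2 powr (real_of_int k * (\<gamma> - e))" if y: "y \<in> annulus k"
          proof -
            have y0: "norm y > 0" using annulus_nonzero[OF y] by simp
            have "max R (norm y) powr (- b) = max R (norm y) powr (e - b) * max R (norm y) powr (- e)"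
              by (simp flip: powr_add)
            also have "\<dots> \<le> R powr (e - b) * norm y powr (- e)"
              using R y0 e by (intro mult_mono powr_mono2') auto
            finally have 1: "max R (norm y) powr (- b) \<le> R powr (e - b) * norm y powr (- e)" .
            have "\<bar>\<phi> y\<bar> powr \<beta> \<le> M powr \<beta>" using M \<beta> by (intro powr_mono2) auto
            also have "\<dots> \<le> M powr \<beta> + 1" by simp
            finally have 2: "norm y powr \<gamma> * \<bar>\<phi> y\<bar> powr \<beta> \<le> norm y powr \<gamma> * (M powr \<beta> + 1)" by (intro mult_left_mono) auto
            have "max R (norm y) powr (- b) * (norm y powr \<gamma> * \<bar>\<phi> y\<bar> powr \<beta>) \<le> R powr (e - b) * norm y powr (- e) * (norm y powr \<gamma> * (M powr \<beta> + 1))"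
              by (intro mult_mono[OF 1 2]) auto
            also have "\<dots> = R powr (e - b) * (M powr \<beta> + 1) * norm y powr (\<gamma> - e)"
              using y0 by (simp add: powr_diff powr_minus field_simps)
            also have "\<dots> \<le> R powr (e - b) * (M powr \<beta> + 1) * (2 powr \<bar>\<gamma> - e\<bar> * 2 powr (real_of_int k * (\<gamma> - e)))"
              by (intro mult_left_mono norm_powr_annulus_le y) auto
            finally show ?thesis by (simp add: D_def mult_ac)
          qed
          then have "max R (norm y) powr (- b) * (norm y powr \<gamma> * \<bar>\<phi> y\<bar> powr \<beta>) * \<bar>w y\<bar> \<le> D * 2 powr (real_of_int k * (\<gamma> - e)) * \<bar>w y\<bar>" if y: "y \<in> annulus k"
            using that by (intro mult_right_mono) auto
          then show "ennreal (?f R w y) * indicator (annulus k) y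
            \<le> ennreal (D * 2 powr (real_of_int k * (\<gamma> - e))) * (ennreal \<bar>w y\<bar> * indicator (annulus k) y)"
            using D by (auto simp: indicator_def mult.assoc simp flip: ennreal_mult intro!: ennreal_leI)
        qed
        also have "\<dots> = ennreal (D * 2 powr (real_of_int k * (\<gamma> - e))) * (\<integral>\<^sup>+y. ennreal \<bar>w y\<bar> * indicator (annulus k) y \<partial>lebesgue)"
          by (rule nn_integral_cmult) measurable
        also have "\<dots> \<le> ennreal (D * 2 powr (real_of_int k * (\<gamma> - e))) * ennreal (L * N * 2 powr (real_of_int k * (n - \<sigma>)))"
          by (intro mult_left_mono w1) auto
        also have "\<dots> = ennreal (D * (L * N) * (2 powr (real_of_int k * (\<gamma> - e)) * 2 powr (real_of_int k * (n - \<sigma>))))"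
          using D L N by (simp add: mult_ac flip: ennreal_mult)
        also have "2 powr (real_of_int k * (\<gamma> - e)) * 2 powr (real_of_int k * (n - \<sigma>)) = (2::real) powr (real_of_int K * x) * 2 powr (- x * \<bar>real_of_int k - real_of_int K\<bar>)"
          using True by (simp add: x_def algebra_simps flip: powr_add)
        finally show ?thesis by (simp add: a_def mult_ac)
      next
        case False
        then have "(2::real) powr real_of_int K \<le> 2 powr (real_of_int k - 1)" by (intro powr_mono) auto
        then have z: "\<phi> y = 0" if "y \<in> annulus k" for y
          using supp[of y] that unfolding annulus_def mem_Collect_eq by linarith
        have "(\<integral>\<^sup>+y. ennreal (?f R w y) * indicator (annulus k) y \<partial>lebesgue) = (\<integral>\<^sup>+(y::'a). 0 \<partial>lebesgue)"
          using z by (intro nn_integral_cong) (auto simp: indicator_def)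
        then show ?thesis by simp
      qed
    qed
    also have "D * (L * N) * 2 powr (real_of_int K * x) * C2 = C * N * R powr (e - b)"
      by (simp add: D_def C_def mult_ac)
    finally show ?thesis .
  qed
  show ?thesis using C by (intro exI[of _ C] conjI allI impI) (assumption | (rule main; assumption))+
qed

section \<open>From Herz norms to bounds on annuli\<close>

lemma epowr_le_ennrealD:
  assumes "epowr x p \<le> ennreal y" "p > 0" "y \<ge> 0"
  shows "x \<le> ennreal (y powr (1 / p))"
proof -
  have xt: "x \<noteq> top" using assms by (auto simp: epowr_def top_unique)
  then have "enn2real x powr p \<le> y" using assms by (simp add: epowr_def)
  then have "(enn2real x powr p) powr (1 / p) \<le> y powr (1 / p)"
    using assms by (intro powr_mono2) auto
  then have "enn2real x \<le> y powr (1 / p)" using assms by (simp add: powr_powr)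
  then have "ennreal (enn2real x) \<le> ennreal (y powr (1 / p))" by (rule ennreal_leI)
  moreover have "ennreal (enn2real x) = x" using xt by (simp add: less_top)
  ultimately show ?thesis by (simp only:)
qed

lemma sum_le_infsum_ennreal:
  fixes f :: "'x \<Rightarrow> ennreal"
  assumes "finite F"
  shows "sum f F \<le> infsum f UNIV"
proof -
  have "sum f F = infsum f F" using assms by simp
  also have "\<dots> \<le> infsum f UNIV"
    by (intro infsum_mono_neutral nonneg_summable_on_complete) auto
  finally show ?thesis .
qed

text \<open>For finite q this only removes the root. For q = \<infinity> the essential supremum
  controls the L^Q norm for the chosen finite Q, because annulus k has measure at most a constant
  times 2^(n k); this factor accounts for the term n / Q in the exponent.\<close>

lemma Lq_norm_annulus_imp:
  defines "n \<equiv> real DIM('a::euclidean_space)"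
  assumes Q: "Q > 0" and q: "(q = ereal Q \<and> s = \<sigma> - n / Q) \<or> (q = \<infinity> \<and> s = \<sigma>)"
  shows "\<exists>C>0. \<forall>(f::'a \<Rightarrow> real) k y. f \<in> borel_measurable lebesgue \<longrightarrow> y \<ge> 0 \<longrightarrow>
     ennreal (2 powr (real_of_int k * s)) * Lq_norm q (\<lambda>x. indicator (annulus k) x * f x) \<le> ennreal y \<longrightarrow>
     (\<integral>\<^sup>+x. ennreal (\<bar>f x\<bar> powr Q) * indicator (annulus k) x \<partial>lebesgue)
       \<le> ennreal ((C * y * 2 powr (- real_of_int k * (\<sigma> - n / Q))) powr Q)"
proof -
  let ?I = "\<lambda>(f::'a \<Rightarrow> real) k. \<integral>\<^sup>+x. ennreal (\<bar>f x\<bar> powr Q) * indicator (annulus k) x \<partial>lebesgue"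
  obtain C1 where C1: "C1 > 0" "\<And>k. emeasure lborel (annulus k :: 'a set) \<le> ennreal (C1 * 2 powr (n * real_of_int k))"
    using emeasure_annulus_le unfolding n_def by blast
  define C where "C = max 1 (C1 powr (1 / Q))"
  have C: "C > 0" "1 \<le> C" "C1 powr (1 / Q) \<le> C" by (auto simp: C_def)
  have main: "?I f k
       \<le> ennreal ((C * y * 2 powr (- real_of_int k * (\<sigma> - n / Q))) powr Q)"
    if f [measurable]: "f \<in> borel_measurable lebesgue" and y: "y \<ge> 0"
      and le: "ennreal (2 powr (real_of_int k * s)) * Lq_norm q (\<lambda>x. indicator (annulus k) x * f x) \<le> ennreal y"
    for f :: "'a \<Rightarrow> real" and k y
  proof -
    let ?z = "y * 2 powr (- real_of_int k * s)"
    let ?L = "Lq_norm q (\<lambda>x. indicator (annulus k) x * f x)"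
    have "?L = ennreal (2 powr (- real_of_int k * s)) * (ennreal (2 powr (real_of_int k * s)) * ?L)"
      by (simp add: mult.assoc[symmetric] flip: ennreal_mult powr_add)
    also have "\<dots> \<le> ennreal (2 powr (- real_of_int k * s)) * ennreal y"
      by (intro mult_left_mono le) auto
    also have "\<dots> = ennreal ?z" using y by (simp add: mult.commute flip: ennreal_mult)
    finally have L: "?L \<le> ennreal ?z" .
    show ?thesis
    proof (cases "q = \<infinity>")
      case False
      then have q': "q = ereal Q" "s = \<sigma> - n / Q" using q by auto
      have "?I f k
        = (\<integral>\<^sup>+x. ennreal (\<bar>indicator (annulus k) x * f x\<bar> powr Q) \<partial>lebesgue)"
        using Q by (intro nn_integral_cong) (auto simp: indicator_def)
      also have "\<dots> \<le> ennreal (?z powr (1 / (1 / Q)))"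
        using L y Q unfolding q' Lq_norm_def by (intro epowr_le_ennrealD) auto
      also have "?z powr (1 / (1 / Q)) \<le> (C * y * 2 powr (- real_of_int k * (\<sigma> - n / Q))) powr Q"
        using y Q C mult_right_mono[OF C(2), of ?z] unfolding q'(2)
        by (simp add: mult.assoc) (intro powr_mono2, auto)
      finally show ?thesis by (simp add: ennreal_leI)
    next
      case True
      then have s: "s = \<sigma>" using q by auto
      let ?g = "\<lambda>x. ereal \<bar>indicator (annulus k) x * f x\<bar>"
      \<comment> \<open>\<open>e2ennreal\<close> sends negative values to 0, so the sign is
        distinguished before the bound is pulled back.\<close>
      have "esssup lebesgue ?g \<le> ereal ?z"
      proof (cases "esssup lebesgue ?g \<ge> 0")
        case True
        have "e2ennreal (esssup lebesgue ?g) \<le> ennreal ?z"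
          using L \<open>q = \<infinity>\<close> by (simp add: Lq_norm_def)
        then have "enn2ereal (e2ennreal (esssup lebesgue ?g)) \<le> enn2ereal (ennreal ?z)"
          by (simp add: less_eq_ennreal.rep_eq)
        then show ?thesis using True y by (simp add: enn2ereal_e2ennreal)
      next
        case False
        then have "esssup lebesgue ?g \<le> 0" by simp
        also have "0 \<le> ereal ?z" using y by simp
        finally show ?thesis .
      qed
      moreover have "AE x in lebesgue. ?g x \<le> esssup lebesgue ?g" by (rule esssup_AE)
      ultimately have ae: "AE x in lebesgue. \<bar>indicator (annulus k) x * f x\<bar> \<le> ?z"
        by (auto elim!: eventually_mono dest: order_trans)
      have "?I f k \<le> (\<integral>\<^sup>+x. ennreal (?z powr Q) * indicator (annulus k :: 'a set) x \<partial>lebesgue)"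
        using ae Q by (intro nn_integral_mono_AE) (auto elim!: eventually_mono simp: indicator_def intro!: ennreal_leI powr_mono2)
      also have "\<dots> = ennreal (?z powr Q) * emeasure lborel (annulus k :: 'a set)"
        by (subst nn_integral_cmult_indicator) auto
      also have "\<dots> \<le> ennreal (?z powr Q) * ennreal (C1 * 2 powr (n * real_of_int k))"
        by (intro mult_left_mono C1) auto
      also have "\<dots> = ennreal (?z powr Q * (C1 * 2 powr (n * real_of_int k)))"
        using C1 by (simp add: ennreal_mult)
      also have "?z powr Q * (C1 * 2 powr (n * real_of_int k)) = (C1 powr (1 / Q) * y * 2 powr (- real_of_int k * (\<sigma> - n / Q))) powr Q"
        using C1 y Q unfolding s by (simp add: powr_mult powr_powr algebra_simps flip: powr_add)
      also have "\<dots> \<le> (C * y * 2 powr (- real_of_int k * (\<sigma> - n / Q))) powr Q"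
        using C y Q by (intro powr_mono2 mult_right_mono) auto
      finally show ?thesis by (simp add: ennreal_leI)
    qed
  qed
  show ?thesis using C by (intro exI[of _ C] conjI allI impI) (assumption | (rule main; assumption))+
qed

text \<open>For r = \<infinity> every \<nu> k is at most \<epsilon> and c > 0 makes the kernel
  summable. For finite r \<le> \<beta> the sequence is small in l^r, and l^r embeds in l^\<beta>
  through \<nu>^\<beta> \<le> \<epsilon>^(\<beta> - r) \<nu>^r. Either way the total is of order
  \<epsilon>^\<beta>.\<close>

lemma herz_norm_imp_annular_control:
  fixes q r :: ereal
  defines "n \<equiv> real DIM('a::euclidean_space)"
  assumes Q: "Q > 0" and q: "(q = ereal Q \<and> s = \<sigma> - n / Q) \<or> (q = \<infinity> \<and> s = \<sigma>)"
    and \<beta>: "\<beta> > 0" and r: "r > 0" "(r = \<infinity> \<and> c > 0) \<or> (r \<le> ereal \<beta> \<and> c \<ge> 0)"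
  shows "\<exists>D>0. \<forall>\<epsilon> (f::'a \<Rightarrow> real). \<epsilon> > 0 \<longrightarrow> f \<in> borel_measurable lebesgue \<longrightarrow>
     herz_norm s q r f \<le> ennreal \<epsilon> \<longrightarrow> annular_control c \<beta> Q \<sigma> (D * \<epsilon> powr \<beta>) f"
proof -
  let ?g = "\<lambda>k j. 2 powr (- c * \<bar>real_of_int k - real_of_int j\<bar>)"
  obtain C where C: "C > 0" "\<And>(f::'a \<Rightarrow> real) k y. f \<in> borel_measurable lebesgue \<Longrightarrow> y \<ge> 0 \<Longrightarrow>
     ennreal (2 powr (real_of_int k * s)) * Lq_norm q (\<lambda>x. indicator (annulus k) x * f x) \<le> ennreal y \<Longrightarrow>
     (\<integral>\<^sup>+x. ennreal (\<bar>f x\<bar> powr Q) * indicator (annulus k) x \<partial>lebesgue)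
       \<le> ennreal ((C * y * 2 powr (- real_of_int k * (\<sigma> - n / Q))) powr Q)"
    using Lq_norm_annulus_imp[where 'a = 'a and q = q and s = s, OF Q] q unfolding n_def by blast
  have "\<exists>D2>0. r = \<infinity> \<longrightarrow> (\<forall>(F::int set) j. finite F \<longrightarrow> (\<Sum>k\<in>F. (?g k j)) \<le> D2)"
  proof (cases "r = \<infinity>")
    case True
    then have "c > 0" using r by auto
    then show ?thesis using sum_powr_abs_le by blast
  qed (auto intro: exI[of _ 1])
  then obtain D2 where D2: "D2 > 0" "\<And>(F::int set) j. r = \<infinity> \<Longrightarrow> finite F \<Longrightarrow> (\<Sum>k\<in>F. (?g k j)) \<le> D2"
    by blast
  \<comment> \<open>\<open>D2\<close> serves the case r = \<infinity>, the summand 1 the case of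
    finite r.\<close>
  define D where "D = C powr \<beta> * (D2 + 1)"
  have D: "D > 0" using C D2 by (simp add: D_def)
  have main: "annular_control c \<beta> Q \<sigma> (D * \<epsilon> powr \<beta>) f"
    if \<epsilon>: "\<epsilon> > 0" and f: "f \<in> borel_measurable lebesgue" and le: "herz_norm s q r f \<le> ennreal \<epsilon>" for \<epsilon> and f :: "'a \<Rightarrow> real"
  proof -
    define X where "X k = ennreal (2 powr (real_of_int k * s)) * Lq_norm q (\<lambda>x. indicator (annulus k) x * f x)" for k
    define \<nu> where "\<nu> k = enn2real (X k)" for k
    have "(\<forall>k. X k \<le> ennreal \<epsilon>) \<and> (r \<noteq> \<infinity> \<longrightarrow> (\<forall>F. finite F \<longrightarrow> (\<Sum>k\<in>F. epowr (X k) (real_of_ereal r)) \<le> ennreal (\<epsilon> powr real_of_ereal r)))"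
    proof (cases "r = \<infinity>")
      case True
      then have "(SUP k. X k) \<le> ennreal \<epsilon>" using le by (simp add: herz_norm_def X_def)
      then show ?thesis using True by (auto simp: SUP_le_iff)
    next
      case False
      define \<rho> where "\<rho> = real_of_ereal r"
      have \<rho>: "\<rho> > 0" using r False by (cases r) (auto simp: \<rho>_def)
      have "epowr (\<Sum>\<^sub>\<infinity>k. epowr (X k) \<rho>) (1 / \<rho>) \<le> ennreal \<epsilon>"
        using le False by (simp add: herz_norm_def X_def \<rho>_def)
      then have "(\<Sum>\<^sub>\<infinity>k. epowr (X k) \<rho>) \<le> ennreal (\<epsilon> powr (1 / (1 / \<rho>)))"
        using \<rho> \<epsilon> by (intro epowr_le_ennrealD) auto
      then have S: "(\<Sum>k\<in>F. epowr (X k) \<rho>) \<le> ennreal (\<epsilon> powr \<rho>)" if "finite F" for F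
        using sum_le_infsum_ennreal[OF that, of "\<lambda>k. epowr (X k) \<rho>"] by simp
      have "X k \<le> ennreal \<epsilon>" for k
      proof -
        have "X k \<le> ennreal ((\<epsilon> powr \<rho>) powr (1 / \<rho>))"
          using S[of "{k}"] \<rho> by (intro epowr_le_ennrealD) auto
        then show ?thesis using \<rho> \<epsilon> by (simp add: powr_powr)
      qed
      with S show ?thesis by (simp add: \<rho>_def)
    qed
    then have X: "\<And>k. X k \<le> ennreal \<epsilon>"
      and S: "\<And>F. r \<noteq> \<infinity> \<Longrightarrow> finite F \<Longrightarrow> (\<Sum>k\<in>F. epowr (X k) (real_of_ereal r)) \<le> ennreal (\<epsilon> powr real_of_ereal r)"
      by auto
    have Xt: "X k < top" for k using X[of k] by (rule order_le_less_trans) simp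
    have X\<nu>: "X k = ennreal (\<nu> k)" for k using Xt[of k] by (simp add: \<nu>_def)
    have \<nu>0: "\<nu> k \<ge> 0" for k by (simp add: \<nu>_def)
    have \<nu>\<epsilon>: "\<nu> k \<le> \<epsilon>" for k using X[of k] \<epsilon> by (simp add: X\<nu>)
    have sum: "(\<Sum>k\<in>F. (?g k j) * (C * \<nu> k) powr \<beta>) \<le> D * \<epsilon> powr \<beta>"
      if F: "finite F" for F and j :: int
    proof (cases "r = \<infinity>")
      case True
      have "(\<Sum>k\<in>F. (?g k j) * (C * \<nu> k) powr \<beta>)
        \<le> (\<Sum>k\<in>F. (?g k j) * (C * \<epsilon>) powr \<beta>)"
        using C \<beta> \<nu>0 \<nu>\<epsilon> by (intro sum_mono mult_left_mono powr_mono2) auto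
      also have "\<dots> = (\<Sum>k\<in>F. (?g k j)) * (C * \<epsilon>) powr \<beta>"
        by (simp only: sum_distrib_right)
      also have "\<dots> \<le> D2 * (C * \<epsilon>) powr \<beta>"
        using D2(2)[OF True F] by (intro mult_right_mono) auto
      also have "\<dots> \<le> (D2 + 1) * (C * \<epsilon>) powr \<beta>"
        by (intro mult_right_mono) auto
      also have "\<dots> = D * \<epsilon> powr \<beta>"
        using C \<epsilon> by (simp add: D_def powr_mult)
      finally show ?thesis .
    next
      case False
      define \<rho> where "\<rho> = real_of_ereal r"
      have \<rho>: "\<rho> > 0" "\<rho> \<le> \<beta>" "c \<ge> 0" using r False by (cases r; auto simp: \<rho>_def)+
      have "ennreal (\<Sum>k\<in>F. \<nu> k powr \<rho>) = (\<Sum>k\<in>F. epowr (X k) \<rho>)"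
        by (subst sum_ennreal[symmetric]) (auto simp: X\<nu> epowr_def \<nu>0)
      also have "\<dots> \<le> ennreal (\<epsilon> powr \<rho>)" using S[OF False F] by (simp add: \<rho>_def)
      finally have S': "(\<Sum>k\<in>F. \<nu> k powr \<rho>) \<le> \<epsilon> powr \<rho>" by simp
      have "(\<Sum>k\<in>F. (?g k j) * (C * \<nu> k) powr \<beta>)
        \<le> (\<Sum>k\<in>F. C powr \<beta> * (\<epsilon> powr (\<beta> - \<rho>) * \<nu> k powr \<rho>))"
      proof (intro sum_mono)
        fix k
        have "(?g k j) \<le> 2 powr 0"
          using \<rho> by (intro powr_mono) (auto simp: mult_nonneg_nonneg)
        then have "(?g k j) * (C * \<nu> k) powr \<beta> \<le> 1 * (C * \<nu> k) powr \<beta>"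
          by (intro mult_right_mono) auto
        also have "\<dots> = C powr \<beta> * (\<nu> k powr (\<beta> - \<rho>) * \<nu> k powr \<rho>)"
          using C \<nu>0 by (simp add: powr_mult flip: powr_add)
        also have "\<dots> \<le> C powr \<beta> * (\<epsilon> powr (\<beta> - \<rho>) * \<nu> k powr \<rho>)"
          using \<nu>0 \<nu>\<epsilon> \<rho> by (intro mult_left_mono mult_right_mono powr_mono2) auto
        finally show "(?g k j) * (C * \<nu> k) powr \<beta> \<le> C powr \<beta> * (\<epsilon> powr (\<beta> - \<rho>) * \<nu> k powr \<rho>)" .
      qed
      also have "\<dots> = C powr \<beta> * (\<epsilon> powr (\<beta> - \<rho>) * (\<Sum>k\<in>F. \<nu> k powr \<rho>))"
        by (simp only: sum_distrib_left)
      also have "\<dots> \<le> C powr \<beta> * (\<epsilon> powr (\<beta> - \<rho>) * \<epsilon> powr \<rho>)"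
        using S' by (intro mult_left_mono) auto
      also have "\<dots> = C powr \<beta> * 1 * \<epsilon> powr \<beta>" by (simp flip: powr_add)
      also have "\<dots> \<le> D * \<epsilon> powr \<beta>" unfolding D_def using D2 by (intro mult_right_mono mult_left_mono) auto
      finally show ?thesis .
    qed
    show ?thesis
      unfolding annular_control_def
    proof (intro conjI exI[of _ "\<lambda>k. C * \<nu> k"] allI impI f sum)
      fix k
      show "0 \<le> C * \<nu> k" using C \<nu>0 by simp
      show "(\<integral>\<^sup>+x. ennreal (\<bar>f x\<bar> powr Q) * indicator (annulus k) x \<partial>lebesgue)
            \<le> ennreal ((C * \<nu> k * 2 powr (- real_of_int k * (\<sigma> - real DIM('a) / Q))) powr Q)"
        using C(2)[OF f \<nu>0, of k k] X\<nu>[of k] unfolding n_def X_def by simp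
    qed
  qed
  show ?thesis using D by (intro exI[of _ D] conjI allI impI) (assumption | (rule main; assumption))+
qed

text \<open>Inclusion of L^Q in L^p on sets of finite measure; since \<sigma> is the scaling index,
  the powers of 2^k match and N is independent of k.\<close>

lemma annular_bound_exponent_le:
  assumes p: "0 < p" "p \<le> Q" and e: "e > 0"
  shows "\<exists>N>0. \<forall>v::'a::euclidean_space \<Rightarrow> real. annular_bound Q \<sigma> e v \<longrightarrow> annular_bound p \<sigma> N v"
proof -
  let ?n = "real DIM('a)"
  let ?B = "\<lambda>k p. 2 powr (- real_of_int k * (\<sigma> - ?n / p))"
  obtain C1 where C1: "C1 > 0" "\<And>k. emeasure lborel (annulus k :: 'a set) \<le> ennreal (C1 * 2 powr (?n * real_of_int k))"
    using emeasure_annulus_le by blast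
  define N where "N = e * (C1 + 1) powr (1 / p)"
  have N: "N > 0" using e C1 by (simp add: N_def)
  have main: "annular_bound p \<sigma> N v" if v: "annular_bound Q \<sigma> e v" for v :: "'a \<Rightarrow> real"
  proof -
    have v' [measurable]: "v \<in> borel_measurable lebesgue" using v by (simp add: annular_bound_def)
    let ?I = "\<lambda>k. \<integral>\<^sup>+x. ennreal (\<bar>v x\<bar> powr Q) * indicator (annulus k) x \<partial>lebesgue"
    have "(\<integral>\<^sup>+x. ennreal (\<bar>v x\<bar> powr p) * indicator (annulus k) x \<partial>lebesgue)
        \<le> ennreal ((N * ?B k p) powr p)" for k
    proof -
      \<comment> \<open>The size of v on annulus k predicted by the Q-bound. Splitting the values of
        |v| at this level makes both parts of the integral comparable.\<close>
      define l where "l = e * 2 powr (- real_of_int k * \<sigma>)"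
      have l: "l > 0" using e by (simp add: l_def)
      have pw: "u powr p \<le> l powr p + l powr (p - Q) * u powr Q" if "u \<ge> 0" for u
      proof (cases "u \<le> l")
        case True
        then have "u powr p \<le> l powr p" using that p by (intro powr_mono2) auto
        moreover have "0 \<le> l powr (p - Q) * u powr Q" by simp
        ultimately show ?thesis by linarith
      next
        case False
        have "u powr p = u powr (p - Q) * u powr Q" by (simp flip: powr_add)
        also have "\<dots> \<le> l powr (p - Q) * u powr Q"
          using False l p by (intro mult_right_mono powr_mono2') auto
        finally show ?thesis using powr_ge_zero[of l p] by linarith
      qed
      have "(\<integral>\<^sup>+x. ennreal (\<bar>v x\<bar> powr p) * indicator (annulus k) x \<partial>lebesgue)
        \<le> (\<integral>\<^sup>+x. ennreal (l powr p) * indicator (annulus k) x + ennreal (l powr (p - Q)) * (ennreal (\<bar>v x\<bar> powr Q) * indicator (annulus k) x) \<partial>lebesgue)"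
        using pw by (intro nn_integral_mono) (auto simp: indicator_def ennreal_leI simp flip: ennreal_mult ennreal_plus)
      also have "\<dots> = (\<integral>\<^sup>+x. ennreal (l powr p) * indicator (annulus k :: 'a set) x \<partial>lebesgue) + (\<integral>\<^sup>+x. ennreal (l powr (p - Q)) * (ennreal (\<bar>v x\<bar> powr Q) * indicator (annulus k) x) \<partial>lebesgue)"
        by (rule nn_integral_add) measurable
      also have "(\<integral>\<^sup>+x. ennreal (l powr p) * indicator (annulus k :: 'a set) x \<partial>lebesgue) = ennreal (l powr p) * emeasure lborel (annulus k :: 'a set)"
        by (subst nn_integral_cmult_indicator) auto
      also have "(\<integral>\<^sup>+x. ennreal (l powr (p - Q)) * (ennreal (\<bar>v x\<bar> powr Q) * indicator (annulus k) x) \<partial>lebesgue)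
        = ennreal (l powr (p - Q)) * ?I k"
        by (rule nn_integral_cmult) measurable
      also have "ennreal (l powr p) * emeasure lborel (annulus k :: 'a set) + ennreal (l powr (p - Q)) * ?I k
        \<le> ennreal (l powr p) * ennreal (C1 * 2 powr (?n * real_of_int k)) + ennreal (l powr (p - Q)) * ennreal ((e * ?B k Q) powr Q)"
        using v unfolding annular_bound_def by (intro add_mono mult_left_mono C1) auto
      also have "\<dots> = ennreal (l powr p * (C1 * 2 powr (?n * real_of_int k)) + l powr (p - Q) * (e * ?B k Q) powr Q)"
        using C1 by (simp add: ennreal_mult ennreal_plus)
      also have "(e * ?B k Q) powr Q = l powr Q * 2 powr (?n * real_of_int k)"
      proof -
        have "?B k Q = 2 powr (- real_of_int k * \<sigma>) * 2 powr (?n * real_of_int k / Q)"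
          by (simp add: algebra_simps flip: powr_add)
        then have "e * ?B k Q = l * 2 powr (?n * real_of_int k / Q)"
          by (simp only: l_def mult.assoc)
        then show ?thesis using l p by (simp add: powr_mult powr_powr)
      qed
      also have "l powr p * (C1 * 2 powr (?n * real_of_int k)) + l powr (p - Q) * (l powr Q * 2 powr (?n * real_of_int k))
        = l powr p * (C1 + 1) * 2 powr (?n * real_of_int k)"
      proof -
        have "l powr (p - Q) * l powr Q = l powr p" by (simp flip: powr_add)
        then show ?thesis by (simp only: mult.assoc[symmetric]) (simp add: algebra_simps)
      qed
      also have "l powr p * (C1 + 1) * 2 powr (?n * real_of_int k) = (N * ?B k p) powr p"
      proof -
        have "?B k p = 2 powr (- real_of_int k * \<sigma>) * 2 powr (?n * real_of_int k / p)"
          by (simp add: algebra_simps flip: powr_add)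
        then have "N * ?B k p = l * (C1 + 1) powr (1 / p) * 2 powr (?n * real_of_int k / p)"
          by (simp only: l_def N_def mult_ac)
        then show ?thesis using l p C1 by (simp add: powr_mult powr_powr)
      qed
      finally show ?thesis .
    qed
    then show ?thesis by (simp add: annular_bound_def v')
  qed
  show ?thesis using N main by blast
qed

lemma annular_bound_diff:
  assumes p: "p \<ge> 1" and N: "N \<ge> 0" and f: "annular_bound p \<sigma> N f" and g: "annular_bound p \<sigma> N g"
  shows "annular_bound p \<sigma> (4 * N) (\<lambda>x. f x - g x)"
proof -
  have [measurable]: "f \<in> borel_measurable lebesgue" "g \<in> borel_measurable lebesgue"
    using f g by (auto simp: annular_bound_def)
  have "(\<integral>\<^sup>+x. ennreal (\<bar>f x - g x\<bar> powr p) * indicator (annulus k) x \<partial>lebesgue)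
      \<le> ennreal ((4 * N * 2 powr (- real_of_int k * (\<sigma> - real DIM('a) / p))) powr p)" for k
  proof -
    let ?A = "(N * 2 powr (- real_of_int k * (\<sigma> - real DIM('a) / p))) powr p"
    have pw: "\<bar>a - b\<bar> powr p \<le> 2 powr p * \<bar>a\<bar> powr p + 2 powr p * \<bar>b\<bar> powr p" for a b :: real
    proof -
      have "\<bar>a - b\<bar> \<le> 2 * max \<bar>a\<bar> \<bar>b\<bar>" by (auto simp: max_def)
      then have "\<bar>a - b\<bar> powr p \<le> (2 * max \<bar>a\<bar> \<bar>b\<bar>) powr p" using p by (intro powr_mono2) auto
      also have "\<dots> = 2 powr p * max \<bar>a\<bar> \<bar>b\<bar> powr p" by (simp add: powr_mult)
      also have "\<dots> \<le> 2 powr p * (\<bar>a\<bar> powr p + \<bar>b\<bar> powr p)"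
        by (intro mult_left_mono) (auto simp: max_def)
      finally show ?thesis by (simp add: distrib_left)
    qed
    have "(\<integral>\<^sup>+x. ennreal (\<bar>f x - g x\<bar> powr p) * indicator (annulus k) x \<partial>lebesgue)
      \<le> (\<integral>\<^sup>+x. ennreal (2 powr p) * (ennreal (\<bar>f x\<bar> powr p) * indicator (annulus k) x) + ennreal (2 powr p) * (ennreal (\<bar>g x\<bar> powr p) * indicator (annulus k) x) \<partial>lebesgue)"
      using pw by (intro nn_integral_mono) (auto simp: indicator_def ennreal_leI simp flip: ennreal_mult ennreal_plus)
    also have "\<dots> = ennreal (2 powr p) * (\<integral>\<^sup>+x. ennreal (\<bar>f x\<bar> powr p) * indicator (annulus k) x \<partial>lebesgue) + ennreal (2 powr p) * (\<integral>\<^sup>+x. ennreal (\<bar>g x\<bar> powr p) * indicator (annulus k) x \<partial>lebesgue)"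
      by (subst nn_integral_add) (auto simp: nn_integral_cmult)
    also have "\<dots> \<le> ennreal (2 powr p) * ennreal ?A + ennreal (2 powr p) * ennreal ?A"
      using f g unfolding annular_bound_def by (intro add_mono mult_left_mono) auto
    also have "\<dots> = ennreal (2 * (2 powr p * ?A))"
      by (simp flip: ennreal_mult ennreal_plus)
    \<comment> \<open>Absorbing the number of summands into another 2^p, possible as p \<ge> 1, is
      what makes the constant 4.\<close>
    also have "2 * (2 powr p * ?A) \<le> 2 powr p * (2 powr p * ?A)"
      using p powr_mono[of 1 p 2] by (intro mult_right_mono) auto
    also have "2 powr p * (2 powr p * ?A) = (4 * N * 2 powr (- real_of_int k * (\<sigma> - real DIM('a) / p))) powr p"
    proof -
      have "(4::real) powr p = 2 powr p * 2 powr p" using powr_mult[of 2 2 p] by simp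
      then show ?thesis using N by (simp add: powr_mult)
    qed
    finally show ?thesis by (simp add: ennreal_leI)
  qed
  then show ?thesis by (simp add: annular_bound_def)
qed

section \<open>Measurability in time and the equation for the difference\<close>

text \<open>The sum over the single index k with j = k has weight 1, so each
  \<open>\<nu> k powr \<beta>\<close> is itself at most \<eta>.\<close>

lemma annular_control_imp_bound:
  assumes Q: "Q > 0" and \<beta>: "\<beta> > 0" and \<eta>: "\<eta> \<ge> 0" and v: "annular_control c \<beta> Q \<sigma> \<eta> v"
  shows "annular_bound Q \<sigma> (\<eta> powr (1 / \<beta>)) (v :: 'a::euclidean_space \<Rightarrow> real)"
proof -
  have v': "v \<in> borel_measurable lebesgue" using v by (simp add: annular_control_def)
  obtain \<nu> where \<nu>: "\<And>k. 0 \<le> \<nu> k"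
    "\<And>k. (\<integral>\<^sup>+x. ennreal (\<bar>v x\<bar> powr Q) * indicator (annulus k) x \<partial>lebesgue)
            \<le> ennreal ((\<nu> k * 2 powr (- real_of_int k * (\<sigma> - real DIM('a) / Q))) powr Q)"
    "\<And>j F. finite F \<Longrightarrow> (\<Sum>k\<in>F. 2 powr (- c * \<bar>real_of_int k - real_of_int j\<bar>) * \<nu> k powr \<beta>) \<le> \<eta>"
    using v unfolding annular_control_def by blast
  have \<nu>e: "\<nu> k \<le> \<eta> powr (1 / \<beta>)" for k
  proof -
    have "(\<nu> k powr \<beta>) powr (1 / \<beta>) \<le> \<eta> powr (1 / \<beta>)"
      using \<nu>(3)[of "{k}" k] \<beta> by (intro powr_mono2) auto
    then show ?thesis using \<beta> \<nu>(1)[of k] by (simp add: powr_powr)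
  qed
  have "(\<integral>\<^sup>+x. ennreal (\<bar>v x\<bar> powr Q) * indicator (annulus k) x \<partial>lebesgue)
            \<le> ennreal ((\<eta> powr (1 / \<beta>) * 2 powr (- real_of_int k * (\<sigma> - real DIM('a) / Q))) powr Q)" for k
    using \<nu>(1)[of k] \<nu>e[of k] Q by (intro order_trans[OF \<nu>(2)] ennreal_leI powr_mono2 mult_right_mono) auto
  then show ?thesis using v' by (simp add: annular_bound_def)
qed

lemma annular_bound_cong_AE:
  assumes "annular_bound p \<sigma> N v" "w \<in> borel_measurable lebesgue" "AE x in lebesgue. v x = w x"
  shows "annular_bound p \<sigma> N w"
proof -
  have "(\<integral>\<^sup>+x. ennreal (\<bar>w x\<bar> powr p) * indicator (annulus k) x \<partial>lebesgue) = (\<integral>\<^sup>+x. ennreal (\<bar>v x\<bar> powr p) * indicator (annulus k) x \<partial>lebesgue)" for k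
    using assms(3) by (intro nn_integral_cong_AE) (auto elim: eventually_mono)
  then show ?thesis using assms(1,2) by (simp add: annular_bound_def)
qed

lemma AE_annulusI:
  assumes "\<And>k. AE x in lebesgue. x \<in> annulus k \<longrightarrow> P x"
  shows "AE x in (lebesgue :: 'a::euclidean_space measure). P x"
proof -
  have "AE x in lebesgue. \<forall>k. x \<in> annulus k \<longrightarrow> P x" using assms by (subst AE_all_countable) auto
  moreover have "AE x in lebesgue. x \<noteq> (0::'a)"
    by (intro AE_completion AE_lborel_singleton)
  ultimately show ?thesis by eventually_elim (use in_annulus_ex in blast)
qed

lemma annular_bound_geometric_imp_zero:
  fixes w :: "'a::euclidean_space \<Rightarrow> real"
  assumes p: "p > 0" and N0: "N0 \<ge> 0" and b: "\<And>i::nat. annular_bound p \<sigma> (N0 / 2 ^ i) w"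
  shows "AE x in lebesgue. w x = 0"
proof (rule AE_annulusI)
  fix k
  have [measurable]: "w \<in> borel_measurable lebesgue" using b[of 0] unfolding annular_bound_def by blast
  let ?X = "2 powr (- real_of_int k * (\<sigma> - real DIM('a) / p))"
  let ?I = "\<integral>\<^sup>+x. ennreal (\<bar>w x\<bar> powr p) * indicator (annulus k) x \<partial>lebesgue"
  have "(\<lambda>i. ennreal ((N0 / 2 ^ i * ?X) powr p)) \<longlonglongrightarrow> ennreal 0"
  proof (intro tendsto_ennrealI tendsto_zero_powrI)
    show "(\<lambda>i. N0 / 2 ^ i * ?X) \<longlonglongrightarrow> 0"
    proof -
      have "(\<lambda>i. N0 * (1 / 2) ^ i * ?X) \<longlonglongrightarrow> N0 * 0 * ?X"
        by (intro tendsto_intros LIMSEQ_power_zero) auto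
      moreover have "(\<lambda>i. N0 * (1 / 2) ^ i * ?X) = (\<lambda>i. N0 / 2 ^ i * ?X)"
        by (simp add: power_divide)
      ultimately show ?thesis by (simp only: mult_zero_right mult_zero_left)
    qed
  qed (use p N0 in auto)
  moreover have "?I \<le> ennreal ((N0 / 2 ^ i * ?X) powr p)" for i
    using b[of i] unfolding annular_bound_def by blast
  ultimately have "?I \<le> ennreal 0" by (intro LIMSEQ_le_const) auto
  then have "?I = 0" by simp
  then have "AE x in lebesgue. ennreal (\<bar>w x\<bar> powr p) * indicator (annulus k) x = 0"
    by (subst (asm) nn_integral_0_iff_AE) auto
  then show "AE x in lebesgue. x \<in> annulus k \<longrightarrow> w x = 0"
    by eventually_elim (auto simp: ennreal_eq_0_iff)
qed

text \<open>By compactness of the time interval, finitely many values u t approximate the whole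
  curve. The approximation g is a step function in time with these values, for which joint
  measurability is immediate.\<close>

lemma ex_jointly_measurable_approximation:
  fixes u :: "real \<Rightarrow> 'a::euclidean_space \<Rightarrow> real"
  assumes u: "\<And>t. t \<in> {0..T} \<Longrightarrow> u t \<in> borel_measurable lebesgue"
    and cont: "\<And>t. t \<in> {0..T} \<Longrightarrow> \<exists>\<delta>>0. \<forall>t'\<in>{0..T}. \<bar>t' - t\<bar> < \<delta> \<longrightarrow> annular_bound Q \<sigma> N (\<lambda>x. u t' x - u t x)"
  shows "\<exists>g. case_prod g \<in> borel_measurable borel \<and> (\<forall>t\<in>{0..T}. annular_bound Q \<sigma> N (\<lambda>x. u t x - g t x))"
proof -
  have "\<forall>t\<in>{0..T}. \<exists>\<delta>. \<delta> > 0 \<and> (\<forall>t'\<in>{0..T}. \<bar>t' - t\<bar> < \<delta> \<longrightarrow> annular_bound Q \<sigma> N (\<lambda>x. u t' x - u t x))"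
    using cont by blast
  then obtain \<delta> where "\<forall>t\<in>{0..T}. \<delta> t > 0 \<and> (\<forall>t'\<in>{0..T}. \<bar>t' - t\<bar> < \<delta> t \<longrightarrow> annular_bound Q \<sigma> N (\<lambda>x. u t' x - u t x))"
    by (rule bchoice[THEN exE])
  then have \<delta>: "\<And>t. t \<in> {0..T} \<Longrightarrow> \<delta> t > 0"
    "\<And>t t'. t \<in> {0..T} \<Longrightarrow> t' \<in> {0..T} \<Longrightarrow> \<bar>t' - t\<bar> < \<delta> t \<Longrightarrow> annular_bound Q \<sigma> N (\<lambda>x. u t' x - u t x)"
    by blast+
  \<comment> \<open>The product structure is the one of Borel sets, so each Lebesgue measurable u t
    is replaced by a Borel function equal to it almost everywhere.\<close>
  have "\<forall>t\<in>{0..T}. \<exists>v. v \<in> borel_measurable borel \<and> (AE x in lebesgue. u t x = v x)"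
  proof
    fix t assume "t \<in> {0..T}"
    from completion_ex_borel_measurable_real[OF u[OF this]]
    obtain v where "v \<in> borel_measurable lborel" "AE x in lborel. u t x = v x" by blast
    then show "\<exists>v. v \<in> borel_measurable borel \<and> (AE x in lebesgue. u t x = v x)"
      by (intro exI[of _ v] conjI AE_completion) auto
  qed
  then obtain v where "\<forall>t\<in>{0..T}. v t \<in> borel_measurable borel \<and> (AE x in lebesgue. u t x = v t x)"
    by (rule bchoice[THEN exE])
  then have v: "\<And>t. t \<in> {0..T} \<Longrightarrow> v t \<in> borel_measurable borel"
    "\<And>t. t \<in> {0..T} \<Longrightarrow> AE x in lebesgue. u t x = v t x"
    by blast+
  obtain S where S: "S \<subseteq> {0..T}" "finite S" "{0..T} \<subseteq> (\<Union>t\<in>S. ball t (\<delta> t))"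
  proof (rule compactE_image[of "{0..T}" "{0..T}" "\<lambda>t. ball t (\<delta> t)"])
    show "{0..T} \<subseteq> (\<Union>t\<in>{0..T}. ball t (\<delta> t))" using \<delta>(1) by fastforce
  qed auto
  \<comment> \<open>The covering intervals made disjoint: a time belongs to the piece of the
    smallest centre whose interval contains it.\<close>
  define B where "B t = ball t (\<delta> t) - (\<Union>t'\<in>{t'\<in>S. t' < t}. ball t' (\<delta> t'))" for t
  have [measurable]: "B t \<in> sets borel" for t unfolding B_def using S(2) by (intro sets.Diff sets.finite_UN) auto
  define g where "g \<tau> x = (\<Sum>t\<in>S. indicator (B t) \<tau> * v t x)" for \<tau> x
  have gm: "case_prod g \<in> borel_measurable (borel \<Otimes>\<^sub>M borel)"
  proof -
    have "(\<lambda>z. indicator (B t) (fst z) * v t (snd z) :: real) \<in> borel_measurable (borel \<Otimes>\<^sub>M borel)" if "t \<in> S" for t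
    proof -
      have [measurable]: "v t \<in> borel_measurable borel" using that S v by auto
      show ?thesis by measurable
    qed
    then show ?thesis unfolding g_def case_prod_beta by (intro borel_measurable_sum) auto
  qed
  have "annular_bound Q \<sigma> N (\<lambda>x. u \<tau> x - g \<tau> x)" if \<tau>: "\<tau> \<in> {0..T}" for \<tau>
  proof -
    let ?S = "{t\<in>S. \<tau> \<in> ball t (\<delta> t)}"
    define t where "t = Min ?S"
    have "\<tau> \<in> (\<Union>t\<in>S. ball t (\<delta> t))" using S(3) \<tau> by blast
    then have fin: "finite ?S" "?S \<noteq> {}" using S(2) by auto
    have tS: "t \<in> S" "\<tau> \<in> ball t (\<delta> t)" using Min_in[OF fin] by (auto simp: t_def)
    have tm: "t \<le> t'" if "t' \<in> S" "\<tau> \<in> ball t' (\<delta> t')" for t'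
      unfolding t_def using fin that by (intro Min_le) auto
    have ind: "indicator (B t') \<tau> = (if t' = t then 1 else 0 :: real)" if "t' \<in> S" for t'
    proof (cases "t' = t")
      case True
      have "\<tau> \<in> B t"
        unfolding B_def
      proof (intro DiffI notI)
        assume "\<tau> \<in> (\<Union>t'\<in>{t'\<in>S. t' < t}. ball t' (\<delta> t'))"
        then obtain t' where "t' \<in> S" "t' < t" "\<tau> \<in> ball t' (\<delta> t')" by blast
        then show False using tm[of t'] by linarith
      qed (rule tS)
      then show ?thesis using True by simp
    next
      case False
      have "\<tau> \<notin> B t'"
      proof
        assume "\<tau> \<in> B t'"
        then have t': "\<tau> \<in> ball t' (\<delta> t')" "\<tau> \<notin> (\<Union>t''\<in>{t''\<in>S. t'' < t'}. ball t'' (\<delta> t''))"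
          unfolding B_def by blast+
        have "t < t'" using tm[OF that t'(1)] False by linarith
        then show False using t'(2) tS by blast
      qed
      then show ?thesis using False by simp
    qed
    have g: "g \<tau> x = v t x" for x
    proof -
      have "g \<tau> x = (\<Sum>t'\<in>S. if t' = t then v t x else 0)"
        unfolding g_def using ind by (intro sum.cong) auto
      then show ?thesis using tS S by simp
    qed
    have t: "t \<in> {0..T}" using tS S by auto
    have "annular_bound Q \<sigma> N (\<lambda>x. u \<tau> x - u t x)"
      using tS \<tau> t by (intro \<delta>) (auto simp: dist_real_def)
    moreover have "AE x in lebesgue. u \<tau> x - u t x = u \<tau> x - g \<tau> x"
      using v(2)[OF t] by eventually_elim (simp add: g)
    moreover have "(\<lambda>x. u \<tau> x - g \<tau> x) \<in> borel_measurable lebesgue"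
      unfolding g
    proof (rule borel_measurable_diff[OF u[OF \<tau>]])
      have "v t \<in> borel_measurable lborel" using v(1)[OF t] by simp
      then show "v t \<in> borel_measurable lebesgue" by (rule measurable_completion)
    qed
    ultimately show ?thesis using annular_bound_cong_AE by blast
  qed
  then show ?thesis using gm[unfolded borel_prod] by blast
qed

text \<open>The approximations converge at the rate 2^(-m) at every time. On each annulus the Q-th
  powers of the errors therefore have summable integrals, which gives convergence almost everywhere
  of the whole sequence. A subsequence would depend on t and spoil measurability in time.\<close>

lemma ex_jointly_measurable_version:
  fixes u :: "real \<Rightarrow> 'a::euclidean_space \<Rightarrow> real"
  assumes Q: "Q > 0"
    and u: "\<And>t. t \<in> {0..T} \<Longrightarrow> u t \<in> borel_measurable lebesgue"
    and cont: "\<And>t N. t \<in> {0..T} \<Longrightarrow> N > 0 \<Longrightarrow> \<exists>\<delta>>0. \<forall>t'\<in>{0..T}. \<bar>t' - t\<bar> < \<delta> \<longrightarrow> annular_bound Q \<sigma> N (\<lambda>x. u t' x - u t x)"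
  shows "\<exists>g. case_prod g \<in> borel_measurable borel \<and> (\<forall>t\<in>{0..T}. AE x in lebesgue. g t x = u t x)"
proof -
  have "\<exists>g. case_prod g \<in> borel_measurable borel \<and> (\<forall>t\<in>{0..T}. annular_bound Q \<sigma> ((1/2) ^ m) (\<lambda>x. u t x - g t x))" for m :: nat
    using u cont by (intro ex_jointly_measurable_approximation) auto
  then obtain g where g: "\<And>m. case_prod (g m) \<in> borel_measurable borel"
    "\<And>m t. t \<in> {0..T} \<Longrightarrow> annular_bound Q \<sigma> ((1/2) ^ m) (\<lambda>x. u t x - g m t x)"
    by metis
  note [measurable] = g(1)
  \<comment> \<open>Taking \<open>lim\<close> at every point keeps G Borel; its value where the
    sequence diverges concerns, for each t, only a null set of x.\<close>
  define G where "G t x = lim (\<lambda>m. g m t x)" for t x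
  have "(\<lambda>z. lim (\<lambda>m. case_prod (g m) z)) \<in> borel_measurable borel" by measurable
  then have "case_prod G \<in> borel_measurable borel" by (simp add: G_def case_prod_beta')
  moreover have "AE x in lebesgue. G t x = u t x" if t: "t \<in> {0..T}" for t
  proof (rule AE_annulusI)
    fix k
    let ?X = "2 powr (- real_of_int k * (\<sigma> - real DIM('a) / Q))"
    have [measurable]: "(\<lambda>x. u t x - g m t x) \<in> borel_measurable lebesgue" for m
      using g(2)[OF t] by (simp add: annular_bound_def)
    let ?F = "\<lambda>m x. ennreal (\<bar>u t x - g m t x\<bar> powr Q) * indicator (annulus k) x"
    have "(\<integral>\<^sup>+x. (\<Sum>m. ?F m x) \<partial>lebesgue) = (\<Sum>m. \<integral>\<^sup>+x. ?F m x \<partial>lebesgue)"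
      by (rule nn_integral_suminf) measurable
    also have "\<dots> \<le> (\<Sum>m. ennreal (((1/2) ^ m * ?X) powr Q))"
      using g(2)[OF t] unfolding annular_bound_def by (intro suminf_le) auto
    also have "\<dots> = (\<Sum>m. ennreal (?X powr Q * ((1/2) powr Q) ^ m))"
      by (intro suminf_cong) (simp add: powr_mult mult.commute powr_realpow[symmetric] powr_powr)
    also have "\<dots> = ennreal (\<Sum>m. ?X powr Q * ((1/2) powr Q) ^ m)"
    proof (intro suminf_ennreal2 summable_mult summable_geometric)
      have "(1/2::real) powr Q < 1" using Q powr_less_mono2[of Q "1/2" 1] by simp
      then show "norm ((1/2::real) powr Q) < 1" by simp
    qed auto
    finally have "(\<integral>\<^sup>+x. (\<Sum>m. ?F m x) \<partial>lebesgue) \<noteq> \<infinity>"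
      by (auto simp: top_unique)
    then have "AE x in lebesgue. (\<Sum>m. ?F m x) \<noteq> \<infinity>"
      by (intro nn_integral_PInf_AE) measurable
    then show "AE x in lebesgue. x \<in> annulus k \<longrightarrow> G t x = u t x"
    proof eventually_elim
      case (elim x)
      show ?case
      proof
        assume "x \<in> annulus k"
        then have "(\<Sum>m. ennreal (\<bar>u t x - g m t x\<bar> powr Q)) \<noteq> top" using elim by simp
        then have "summable (\<lambda>m. \<bar>u t x - g m t x\<bar> powr Q)"
          by (intro summable_suminf_not_top) auto
        then have lim: "(\<lambda>m. \<bar>u t x - g m t x\<bar> powr Q) \<longlonglongrightarrow> 0" by (rule summable_LIMSEQ_zero)
        have "(\<lambda>m. (\<bar>u t x - g m t x\<bar> powr Q) powr (1 / Q)) \<longlonglongrightarrow> 0"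
          using Q by (intro tendsto_zero_powrI[OF lim tendsto_const]) auto
        then have "(\<lambda>m. \<bar>u t x - g m t x\<bar>) \<longlonglongrightarrow> 0" using Q by (simp add: powr_powr)
        then have "(\<lambda>m. u t x - g m t x) \<longlonglongrightarrow> 0" by (simp add: tendsto_rabs_zero_iff)
        then have "(\<lambda>m. u t x - (u t x - g m t x)) \<longlonglongrightarrow> u t x - 0" by (intro tendsto_diff tendsto_const)
        then show "G t x = u t x" unfolding G_def by (intro limI) simp
      qed
    qed
  qed
  ultimately show ?thesis by blast
qed

section \<open>The power nonlinearity and the difference of two Duhamel formulas\<close>

lemma power_nonlinearity_Lipschitz:
  assumes \<beta>: "\<beta> > (0::real)"
  shows "\<exists>C>0. \<forall>a b. \<bar>\<bar>a\<bar> powr \<beta> * a - \<bar>b\<bar> powr \<beta> * b\<bar> \<le> C * max \<bar>a\<bar> \<bar>b\<bar> powr \<beta> * \<bar>a - b\<bar>"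
proof -
  \<comment> \<open>An integer exponent makes Bernoulli's inequality available; since m \<ge>
    \<beta>, x^m \<le> x^\<beta> on [0, 1].\<close>
  define m where "m = nat \<lceil>\<beta>\<rceil>"
  have m: "\<beta> \<le> real m" by (simp add: m_def real_nat_ceiling_ge)
  have key: "\<bar>\<bar>a\<bar> powr \<beta> * a - \<bar>b\<bar> powr \<beta> * b\<bar> \<le> (1 + real m) * \<bar>a\<bar> powr \<beta> * \<bar>a - b\<bar>" if ab: "\<bar>b\<bar> \<le> \<bar>a\<bar>" for a b :: real
  proof (cases "a = 0")
    case True
    then show ?thesis using ab by simp
  next
    case False
    define x where "x = \<bar>b\<bar> / \<bar>a\<bar>"
    have x: "0 \<le> x" "x \<le> 1" using ab False by (auto simp: x_def)
    \<comment> \<open>After division by powers of |a| this is the bound for the second term in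
      |a|^\<beta> (a - b) + (|a|^\<beta> - |b|^\<beta>) b, valid for every positive \<beta>,
      including \<beta> < 1.\<close>
    have "x * (1 - x powr \<beta>) \<le> real m * (1 - x)"
    proof (cases "x = 0")
      case True
      then show ?thesis by simp
    next
      case False
      have "1 + real m * (x - 1) \<le> (1 + (x - 1)) ^ m"
        using x by (intro Bernoulli_inequality) auto
      also have "\<dots> = x powr real m" using x False by (simp add: powr_realpow)
      also have "\<dots> \<le> x powr \<beta>" using m x by (intro powr_mono') auto
      finally have "1 - x powr \<beta> \<le> real m * (1 - x)" by (simp add: algebra_simps)
      moreover have "x * (1 - x powr \<beta>) \<le> 1 * (1 - x powr \<beta>)"
        using x \<beta> by (intro mult_right_mono) (auto intro: powr_le1)
      ultimately show ?thesis unfolding mult_1 by (rule order_trans[rotated])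
    qed
    then have "\<bar>a\<bar> powr \<beta> * \<bar>a\<bar> * (x * (1 - x powr \<beta>)) \<le> \<bar>a\<bar> powr \<beta> * \<bar>a\<bar> * (real m * (1 - x))"
      by (intro mult_left_mono) auto
    moreover have "\<bar>a\<bar> powr \<beta> * \<bar>a\<bar> * (x * (1 - x powr \<beta>)) = \<bar>b\<bar> * (\<bar>a\<bar> powr \<beta> - \<bar>b\<bar> powr \<beta>)"
      using False by (simp add: x_def powr_divide field_simps)
    moreover have "\<bar>a\<bar> powr \<beta> * \<bar>a\<bar> * (real m * (1 - x)) = real m * \<bar>a\<bar> powr \<beta> * (\<bar>a\<bar> - \<bar>b\<bar>)"
      using False by (simp add: x_def field_simps)
    ultimately have 1: "\<bar>b\<bar> * (\<bar>a\<bar> powr \<beta> - \<bar>b\<bar> powr \<beta>) \<le> real m * \<bar>a\<bar> powr \<beta> * (\<bar>a\<bar> - \<bar>b\<bar>)" by simp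
    also have "\<dots> \<le> real m * \<bar>a\<bar> powr \<beta> * \<bar>a - b\<bar>" by (intro mult_left_mono) auto
    finally have 2: "\<bar>b\<bar> * (\<bar>a\<bar> powr \<beta> - \<bar>b\<bar> powr \<beta>) \<le> real m * \<bar>a\<bar> powr \<beta> * \<bar>a - b\<bar>" .
    have "\<bar>b\<bar> powr \<beta> \<le> \<bar>a\<bar> powr \<beta>" using ab \<beta> by (intro powr_mono2) auto
    then have 3: "\<bar>(\<bar>a\<bar> powr \<beta> - \<bar>b\<bar> powr \<beta>) * b\<bar> = \<bar>b\<bar> * (\<bar>a\<bar> powr \<beta> - \<bar>b\<bar> powr \<beta>)"
      by (simp add: abs_mult)
    have "\<bar>a\<bar> powr \<beta> * a - \<bar>b\<bar> powr \<beta> * b = \<bar>a\<bar> powr \<beta> * (a - b) + (\<bar>a\<bar> powr \<beta> - \<bar>b\<bar> powr \<beta>) * b"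
      by (simp add: algebra_simps)
    then have "\<bar>\<bar>a\<bar> powr \<beta> * a - \<bar>b\<bar> powr \<beta> * b\<bar> \<le> \<bar>\<bar>a\<bar> powr \<beta> * (a - b)\<bar> + \<bar>(\<bar>a\<bar> powr \<beta> - \<bar>b\<bar> powr \<beta>) * b\<bar>"
      by (simp only: abs_triangle_ineq)
    also have "\<dots> \<le> \<bar>a\<bar> powr \<beta> * \<bar>a - b\<bar> + real m * \<bar>a\<bar> powr \<beta> * \<bar>a - b\<bar>"
      unfolding 3 using 2 by (simp add: abs_mult)
    finally show ?thesis by (simp add: algebra_simps)
  qed
  have "\<bar>\<bar>a\<bar> powr \<beta> * a - \<bar>b\<bar> powr \<beta> * b\<bar> \<le> (1 + real m) * max \<bar>a\<bar> \<bar>b\<bar> powr \<beta> * \<bar>a - b\<bar>" for a b :: real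
  proof (cases "\<bar>b\<bar> \<le> \<bar>a\<bar>")
    case True
    then show ?thesis using key[OF True] by (simp add: max_def)
  next
    case False
    then show ?thesis using key[of a b] by (simp add: max_def abs_minus_commute)
  qed
  then show ?thesis by (intro exI[of _ "1 + real m"]) auto
qed

text \<open>To be used with a0 the common value of the solutions at the starting time and \<phi> its
  test function: the first three terms are small and critical, the last is bounded with bounded
  support. Each of |a| and |b| is at most a sum of three of the four distances, hence at most four
  times the largest.\<close>

lemma power_nonlinearity_split:
  assumes \<beta>: "\<beta> > (0::real)"
  shows "\<exists>C>0. \<forall>a b a0 \<phi>. \<bar>\<bar>a\<bar> powr \<beta> * a - \<bar>b\<bar> powr \<beta> * b\<bar>
    \<le> C * (\<bar>a - a0\<bar> powr \<beta> + \<bar>b - a0\<bar> powr \<beta> + \<bar>a0 - \<phi>\<bar> powr \<beta> + \<bar>\<phi>\<bar> powr \<beta>) * \<bar>a - b\<bar>"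
proof -
  let ?S = "\<lambda>a b a0 \<phi>. \<bar>a - a0\<bar> powr \<beta> + \<bar>b - a0\<bar> powr \<beta> + \<bar>a0 - \<phi>\<bar> powr \<beta> + \<bar>\<phi>\<bar> powr \<beta>"
  obtain C where C: "C > 0" "\<And>a b. \<bar>\<bar>a\<bar> powr \<beta> * a - \<bar>b\<bar> powr \<beta> * b\<bar> \<le> C * max \<bar>a\<bar> \<bar>b\<bar> powr \<beta> * \<bar>a - b\<bar>"
    using power_nonlinearity_Lipschitz[OF \<beta>] by blast
  have "\<bar>\<bar>a\<bar> powr \<beta> * a - \<bar>b\<bar> powr \<beta> * b\<bar>
    \<le> (C * 4 powr \<beta>) * (?S a b a0 \<phi>) * \<bar>a - b\<bar>" for a b a0 \<phi>
  proof -
    define M where "M = max (max \<bar>a - a0\<bar> \<bar>b - a0\<bar>) (max \<bar>a0 - \<phi>\<bar> \<bar>\<phi>\<bar>)"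
    have M: "M \<in> {\<bar>a - a0\<bar>, \<bar>b - a0\<bar>, \<bar>a0 - \<phi>\<bar>, \<bar>\<phi>\<bar>}" by (auto simp: M_def max_def)
    have le: "\<bar>a - a0\<bar> \<le> M" "\<bar>b - a0\<bar> \<le> M" "\<bar>a0 - \<phi>\<bar> \<le> M" "\<bar>\<phi>\<bar> \<le> M"
      by (simp_all add: M_def le_max_iff_disj)
    then have "\<bar>a\<bar> \<le> 4 * M" "\<bar>b\<bar> \<le> 4 * M" by linarith+
    then have "max \<bar>a\<bar> \<bar>b\<bar> \<le> 4 * M" by simp
    then have "max \<bar>a\<bar> \<bar>b\<bar> powr \<beta> \<le> (4 * M) powr \<beta>" using \<beta> by (intro powr_mono2) auto
    also have "\<dots> = 4 powr \<beta> * M powr \<beta>" using M by (auto simp: powr_mult)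
    also have "\<dots> \<le> 4 powr \<beta> * (?S a b a0 \<phi>)"
      using M by (intro mult_left_mono) auto
    finally have "C * max \<bar>a\<bar> \<bar>b\<bar> powr \<beta> * \<bar>a - b\<bar> \<le> C * (4 powr \<beta> * (?S a b a0 \<phi>)) * \<bar>a - b\<bar>"
      using C by (intro mult_left_mono mult_right_mono) auto
    with C(2)[of a b] show ?thesis by (simp only: mult.assoc)
  qed
  moreover have "C * 4 powr \<beta> > 0" using C by simp
  ultimately show ?thesis by blast
qed

text \<open>G is prescribed only almost everywhere in y for each \<tau>, so a jointly measurable
  version may be inserted. The parameter t0 may equal t: the right-hand side is then 0, and
  agreement before t gives agreement at t.\<close>

lemma Duhamel_difference:
  fixes u1 u2 :: "real \<Rightarrow> 'a::euclidean_space \<Rightarrow> real" and G :: "real \<Rightarrow> 'a \<Rightarrow> ennreal"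
  assumes s1: "hh_solution \<gamma> \<alpha> T u0 u1" and s2: "hh_solution \<gamma> \<alpha> T u0 u2"
    and t: "0 < t" "t \<le> T"
    and eq: "\<And>\<tau>. 0 < \<tau> \<Longrightarrow> \<tau> < t \<Longrightarrow> \<tau> \<le> t0 \<Longrightarrow> AE y in lebesgue. u1 \<tau> y = u2 \<tau> y"
    and G: "\<And>\<tau>. 0 < \<tau> \<Longrightarrow> t0 < \<tau> \<Longrightarrow> \<tau> < t \<Longrightarrow> AE y in lebesgue. G \<tau> y = ennreal \<bar>hh_nonlin \<gamma> \<alpha> (u1 \<tau>) y - hh_nonlin \<gamma> \<alpha> (u2 \<tau>) y\<bar>"
  shows "AE x in lebesgue. ennreal \<bar>u1 t x - u2 t x\<bar>
    \<le> (\<integral>\<^sup>+\<tau>. indicator {t0<..<t} \<tau> * (\<integral>\<^sup>+y. ennreal (heat_kernel (t - \<tau>) (x - y)) * G \<tau> y \<partial>lborel) \<partial>lborel)"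
proof -
  let ?F = "\<lambda>u \<tau>. hh_nonlin \<gamma> \<alpha> (u \<tau>)"
  have tT: "t \<in> {0<..T}" using t by auto
  have "AE x in lebesgue. heat_defined t u0 x \<and>
        (AE \<tau> in lborel. \<tau> \<in> {0<..<t} \<longrightarrow> heat_defined (t - \<tau>) (?F u1 \<tau>) x) \<and>
        set_integrable lborel {0<..<t} (\<lambda>\<tau>. heat_sg (t - \<tau>) (?F u1 \<tau>) x) \<and>
        u1 t x = heat_sg t u0 x + (LINT \<tau>:{0<..<t}|lborel. heat_sg (t - \<tau>) (?F u1 \<tau>) x)"
    by (rule s1[unfolded hh_solution_def, THEN conjunct2, THEN bspec, OF tT])
  moreover have "AE x in lebesgue. heat_defined t u0 x \<and>
        (AE \<tau> in lborel. \<tau> \<in> {0<..<t} \<longrightarrow> heat_defined (t - \<tau>) (?F u2 \<tau>) x) \<and>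
        set_integrable lborel {0<..<t} (\<lambda>\<tau>. heat_sg (t - \<tau>) (?F u2 \<tau>) x) \<and>
        u2 t x = heat_sg t u0 x + (LINT \<tau>:{0<..<t}|lborel. heat_sg (t - \<tau>) (?F u2 \<tau>) x)"
    by (rule s2[unfolded hh_solution_def, THEN conjunct2, THEN bspec, OF tT])
  ultimately show ?thesis
  proof eventually_elim
    case (elim x)
    let ?D = "\<lambda>\<tau>. heat_sg (t - \<tau>) (?F u1 \<tau>) x - heat_sg (t - \<tau>) (?F u2 \<tau>) x"
    note h1 = elim(1)[THEN conjunct2, THEN conjunct1]
      and si1 = elim(1)[THEN conjunct2, THEN conjunct2, THEN conjunct1]
      and e1 = elim(1)[THEN conjunct2, THEN conjunct2, THEN conjunct2]
    note h2 = elim(2)[THEN conjunct2, THEN conjunct1]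
      and si2 = elim(2)[THEN conjunct2, THEN conjunct2, THEN conjunct1]
      and e2 = elim(2)[THEN conjunct2, THEN conjunct2, THEN conjunct2]
    note si = set_integral_diff(1)[OF si1 si2]
    have d: "u1 t x - u2 t x = (LINT \<tau>:{0<..<t}|lborel. ?D \<tau>)"
      unfolding set_integral_diff(2)[OF si1 si2] e1 e2 by linarith
    have "ennreal \<bar>u1 t x - u2 t x\<bar> \<le> (\<integral>\<^sup>+\<tau>. norm (indicator {0<..<t} \<tau> *\<^sub>R ?D \<tau>) \<partial>lborel)"
      using integral_norm_bound_ennreal[OF si[unfolded set_integrable_def]]
      unfolding d by (simp only: set_lebesgue_integral_def real_norm_def)
    also have "\<dots> \<le> (\<integral>\<^sup>+\<tau>. indicator {t0<..<t} \<tau> * (\<integral>\<^sup>+y. ennreal (heat_kernel (t - \<tau>) (x - y)) * G \<tau> y \<partial>lborel) \<partial>lborel)"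
    proof (rule nn_integral_mono_AE)
      show "AE \<tau> in lborel. ennreal (norm (indicator {0<..<t} \<tau> *\<^sub>R ?D \<tau>))
        \<le> indicator {t0<..<t} \<tau> * (\<integral>\<^sup>+y. ennreal (heat_kernel (t - \<tau>) (x - y)) * G \<tau> y \<partial>lborel)"
        using h1 h2
      proof eventually_elim
        case h: (elim \<tau>)
        show ?case
        proof (cases "\<tau> \<in> {0<..<t}")
          case \<tau>: True
          have i1: "integrable lebesgue (\<lambda>y. heat_kernel (t - \<tau>) (x - y) * ?F u1 \<tau> y)"
            and i2: "integrable lebesgue (\<lambda>y. heat_kernel (t - \<tau>) (x - y) * ?F u2 \<tau> y)"
            using h \<tau> unfolding heat_defined_def by blast+
          show ?thesis
          proof (cases "\<tau> \<le> t0")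
            case True
            have "AE y in lebesgue. u1 \<tau> y = u2 \<tau> y" using eq \<tau> True by auto
            then have "AE y in lebesgue. heat_kernel (t - \<tau>) (x - y) * ?F u1 \<tau> y = heat_kernel (t - \<tau>) (x - y) * ?F u2 \<tau> y"
              by eventually_elim (simp add: hh_nonlin_def)
            then have "heat_sg (t - \<tau>) (?F u1 \<tau>) x = heat_sg (t - \<tau>) (?F u2 \<tau>) x"
              unfolding heat_sg_def
              by (rule integral_cong_AE[OF borel_measurable_integrable[OF i1] borel_measurable_integrable[OF i2]])
            then show ?thesis by simp
          next
            case False
            have d: "?D \<tau> = (\<integral>y. heat_kernel (t - \<tau>) (x - y) * ?F u1 \<tau> y - heat_kernel (t - \<tau>) (x - y) * ?F u2 \<tau> y \<partial>lebesgue)"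
              unfolding heat_sg_def by (rule Bochner_Integration.integral_diff[OF i1 i2, symmetric])
            have "ennreal (norm (?D \<tau>)) \<le> (\<integral>\<^sup>+y. norm (heat_kernel (t - \<tau>) (x - y) * ?F u1 \<tau> y - heat_kernel (t - \<tau>) (x - y) * ?F u2 \<tau> y) \<partial>lebesgue)"
              unfolding d by (rule integral_norm_bound_ennreal[OF Bochner_Integration.integrable_diff[OF i1 i2]])
            also have "\<dots> = (\<integral>\<^sup>+y. ennreal (heat_kernel (t - \<tau>) (x - y)) * G \<tau> y \<partial>lebesgue)"
            proof (rule nn_integral_cong_AE)
              have "AE y in lebesgue. G \<tau> y = ennreal \<bar>?F u1 \<tau> y - ?F u2 \<tau> y\<bar>" using G \<tau> False by auto
              then show "AE y in lebesgue. ennreal (norm (heat_kernel (t - \<tau>) (x - y) * ?F u1 \<tau> y - heat_kernel (t - \<tau>) (x - y) * ?F u2 \<tau> y)) = ennreal (heat_kernel (t - \<tau>) (x - y)) * G \<tau> y"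
              proof eventually_elim
                case (elim y)
                have k: "heat_kernel (t - \<tau>) (x - y) \<ge> 0" using \<tau> by (intro heat_kernel_nonneg) auto
                have "norm (heat_kernel (t - \<tau>) (x - y) * ?F u1 \<tau> y - heat_kernel (t - \<tau>) (x - y) * ?F u2 \<tau> y) = heat_kernel (t - \<tau>) (x - y) * \<bar>?F u1 \<tau> y - ?F u2 \<tau> y\<bar>"
                  unfolding right_diff_distrib[symmetric] using k by (simp add: abs_mult)
                then show ?case using k elim by (simp add: ennreal_mult)
              qed
            qed
            also have "\<dots> = (\<integral>\<^sup>+y. ennreal (heat_kernel (t - \<tau>) (x - y)) * G \<tau> y \<partial>lborel)"
              by (rule nn_integral_completion)
            finally show ?thesis using \<tau> False by simp
          qed
        qed simp
      qed
    qed
    finally show ?case .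
  qed
qed

section \<open>Uniqueness\<close>

lemma annular_bound_zero:
  fixes w :: "'a::euclidean_space \<Rightarrow> real"
  assumes "p > 0" "AE x in lebesgue. w x = 0" "w \<in> borel_measurable lebesgue"
  shows "annular_bound p \<sigma> N w"
proof (rule annular_bound_cong_AE[OF _ assms(3)])
  show "annular_bound p \<sigma> N (\<lambda>x::'a. 0)" by (simp add: annular_bound_def)
  show "AE x in lebesgue. 0 = w x" using assms(2) by eventually_elim simp
qed

text \<open>The estimates for the four parts of the potential put together: v1 and v2 are the
  increments of the solutions since the starting time, v3 the error of the test function, and Y
  bounds the contribution of the test function.\<close>

lemma nn_integral_split_potential:
  fixes v1 v2 v3 \<phi> :: "'a::euclidean_space \<Rightarrow> real"
  defines "n \<equiv> real DIM('a)"
  assumes \<beta>: "\<beta> > 0" and Q: "Q > 0" and p: "p > 0" and Qp: "\<beta> / Q + 1 / p = 1"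
    and \<sigma>: "\<sigma> * \<beta> = 2 + \<gamma>" and N: "N \<ge> 0" and \<eta>: "\<eta> \<ge> 0" and C: "C \<ge> 0" and Y: "Y \<ge> 0"
    and d: "0 \<le> n - 2 - \<sigma>" "n - 2 - \<sigma> \<le> b" and c: "0 \<le> c" "c \<le> n - 2 - \<sigma>" "c \<le> b - (n - 2 - \<sigma>)"
    and v: "annular_control c \<beta> Q \<sigma> \<eta> v1" "annular_control c \<beta> Q \<sigma> \<eta> v2" "annular_control c \<beta> Q \<sigma> \<eta> v3"
    and w: "annular_bound p \<sigma> N w" and \<phi> [measurable]: "\<phi> \<in> borel_measurable lebesgue"
    and Y\<phi>: "(\<integral>\<^sup>+y. ennreal (max (2 powr real_of_int j) (norm y) powr (- b) * (norm y powr \<gamma> * \<bar>\<phi> y\<bar> powr \<beta> * \<bar>w y\<bar>)) \<partial>lebesgue) \<le> ennreal Y"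
    and G: "AE y in lebesgue. G y \<le> ennreal (norm y powr \<gamma> * (C * (\<bar>v1 y\<bar> powr \<beta> + \<bar>v2 y\<bar> powr \<beta> + \<bar>v3 y\<bar> powr \<beta> + \<bar>\<phi> y\<bar> powr \<beta>) * \<bar>w y\<bar>))"
  shows "(\<integral>\<^sup>+y. ennreal (max (2 powr real_of_int j) (norm y) powr (- b)) * G y \<partial>lebesgue)
    \<le> ennreal (C * (3 * (2 powr b * 2 * 2 powr \<bar>\<gamma>\<bar> * \<eta> * N * 2 powr (real_of_int j * (n - 2 - \<sigma> - b))) + Y))"
proof -
  let ?V = "\<lambda>y. C * (\<bar>v1 y\<bar> powr \<beta> + \<bar>v2 y\<bar> powr \<beta> + \<bar>v3 y\<bar> powr \<beta> + \<bar>\<phi> y\<bar> powr \<beta>) * \<bar>w y\<bar>"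
  let ?m = "\<lambda>y::'a. max (2 powr real_of_int j) (norm y) powr (- b)"
  define P where "P v y = ?m y * (norm y powr \<gamma> * \<bar>v y\<bar> powr \<beta> * \<bar>w y\<bar>)" for v and y :: 'a
  define X where "X = 2 powr b * 2 * 2 powr \<bar>\<gamma>\<bar> * \<eta> * N * 2 powr (real_of_int j * (n - 2 - \<sigma> - b))"
  have X: "X \<ge> 0" using N \<eta> by (simp add: X_def)
  have P0: "P v y \<ge> 0" for v y by (simp add: P_def)
  have [measurable]: "v1 \<in> borel_measurable lebesgue" "v2 \<in> borel_measurable lebesgue" "v3 \<in> borel_measurable lebesgue"
    using v unfolding annular_control_def by blast+
  have [measurable]: "w \<in> borel_measurable lebesgue" using w unfolding annular_bound_def by blast
  have [measurable]: "norm \<in> borel_measurable (lebesgue :: 'a measure)"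
    by (intro measurable_completion) auto
  have Pm [measurable]: "P v \<in> borel_measurable lebesgue" if [measurable]: "v \<in> borel_measurable lebesgue" for v
    unfolding P_def by measurable
  have PX: "(\<integral>\<^sup>+y. ennreal (P v y) \<partial>lebesgue) \<le> ennreal X" if "annular_control c \<beta> Q \<sigma> \<eta> v" for v
    unfolding P_def X_def n_def
    by (rule nn_integral_small_potential[OF \<beta> Q p Qp \<sigma> N d[unfolded n_def] c[unfolded n_def] that w])
  have "(\<integral>\<^sup>+y. ennreal (?m y) * G y \<partial>lebesgue)
    \<le> (\<integral>\<^sup>+y. ennreal C * (ennreal (P v1 y) + (ennreal (P v2 y) + (ennreal (P v3 y) + ennreal (P \<phi> y)))) \<partial>lebesgue)"
    using G
  proof (intro nn_integral_mono_AE, eventually_elim)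
    case (elim y)
    have "ennreal (?m y) * G y \<le> ennreal (?m y) * ennreal (norm y powr \<gamma> * (?V y))"
      using elim by (intro mult_left_mono) auto
    also have "\<dots> = ennreal (?m y * (norm y powr \<gamma> * (?V y)))"
      using C by (intro ennreal_mult[symmetric]) auto
    also have "?m y * (norm y powr \<gamma> * (?V y))
      = C * (P v1 y + (P v2 y + (P v3 y + P \<phi> y)))"
      unfolding P_def by (simp only: distrib_left distrib_right mult_ac add_ac)
    also have "ennreal \<dots> = ennreal C * (ennreal (P v1 y) + (ennreal (P v2 y) + (ennreal (P v3 y) + ennreal (P \<phi> y))))"
      using C P0 by (simp add: ennreal_mult ennreal_plus)
    finally show ?case .
  qed
  also have "\<dots> = ennreal C * ((\<integral>\<^sup>+y. ennreal (P v1 y) \<partial>lebesgue) + ((\<integral>\<^sup>+y. ennreal (P v2 y) \<partial>lebesgue) + ((\<integral>\<^sup>+y. ennreal (P v3 y) \<partial>lebesgue) + (\<integral>\<^sup>+y. ennreal (P \<phi> y) \<partial>lebesgue))))"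
    by (simp add: nn_integral_cmult nn_integral_add)
  also have "\<dots> \<le> ennreal C * (ennreal X + (ennreal X + (ennreal X + ennreal Y)))"
    using Y\<phi> by (intro mult_left_mono add_mono PX v) (auto simp: P_def)
  also have "\<dots> = ennreal (C * (X + (X + (X + Y))))"
    using C X Y by (simp only: ennreal_mult ennreal_plus add_nonneg_nonneg)
  also have "C * (X + (X + (X + Y))) = C * (3 * X + Y)" by simp
  finally show ?thesis by (simp only: X_def)
qed

text \<open>Of the two upper bounds for the minimum, the critical term takes 1 and the term with
  C\<phi> takes h^\<delta> R^(-2 \<delta>). Both terms then carry the same power R^(n / p -
  \<sigma>), and each costs a quarter of N.\<close>

lemma shell_contraction_arith:
  fixes R :: real
  assumes R: "R > 0" and pos: "CD > 0" "CF > 0" "CS > 0" "C\<phi> > 0" "N > 0" "\<eta> > 0"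
    and \<eta>: "CD * CF * (3 * CS * \<eta>) \<le> 1 / 4" and h: "CD * CF * C\<phi> * h powr \<delta> \<le> 1 / 4"
    and t: "0 \<le> t" "t \<le> h" and \<delta>: "\<delta> > 0"
  shows "CD * R powr (n / p - 2 * \<delta>) * min 1 (t powr \<delta> * R powr (- 2 * \<delta>))
      * (CF * (3 * (CS * \<eta> * N * R powr (2 * \<delta> - \<sigma>)) + C\<phi> * N * R powr (4 * \<delta> - \<sigma>)))
    \<le> N / 2 * R powr (n / p - \<sigma>)"
proof -
  let ?m = "min 1 (t powr \<delta> * R powr (- 2 * \<delta>))"
  let ?S = "R powr (n / p - \<sigma>)"
  have m: "0 \<le> ?m" "?m \<le> 1" "?m \<le> h powr \<delta> * R powr (- 2 * \<delta>)"
  proof -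
    show "0 \<le> ?m" "?m \<le> 1" by auto
    have "?m \<le> t powr \<delta> * R powr (- 2 * \<delta>)" by (rule min.cobounded2)
    also have "\<dots> \<le> h powr \<delta> * R powr (- 2 * \<delta>)"
      using t \<delta> by (intro mult_right_mono powr_mono2) auto
    finally show "?m \<le> h powr \<delta> * R powr (- 2 * \<delta>)" .
  qed
  have e1: "R powr (n / p - 2 * \<delta>) * R powr (2 * \<delta> - \<sigma>) = ?S"
    by (simp flip: powr_add)
  have e2: "R powr (n / p - 2 * \<delta>) * R powr (4 * \<delta> - \<sigma>) * R powr (- 2 * \<delta>) = ?S"
    by (simp flip: powr_add)
  have "CD * R powr (n / p - 2 * \<delta>) * ?m * (CF * (3 * (CS * \<eta> * N * R powr (2 * \<delta> - \<sigma>)) + C\<phi> * N * R powr (4 * \<delta> - \<sigma>)))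
    = CD * CF * (3 * CS * \<eta>) * N * (R powr (n / p - 2 * \<delta>) * R powr (2 * \<delta> - \<sigma>)) * ?m
      + CD * CF * C\<phi> * N * (R powr (n / p - 2 * \<delta>) * R powr (4 * \<delta> - \<sigma>)) * ?m"
    by (simp only: distrib_left mult_ac)
  also have "\<dots> \<le> CD * CF * (3 * CS * \<eta>) * N * (R powr (n / p - 2 * \<delta>) * R powr (2 * \<delta> - \<sigma>)) * 1
      + CD * CF * C\<phi> * N * (R powr (n / p - 2 * \<delta>) * R powr (4 * \<delta> - \<sigma>)) * (h powr \<delta> * R powr (- 2 * \<delta>))"
    using m pos by (intro add_mono mult_left_mono) auto
  also have "\<dots> = (CD * CF * (3 * CS * \<eta>)) * (N * ?S) + (CD * CF * C\<phi> * h powr \<delta>) * (N * ?S)"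
  proof -
    have "CD * CF * C\<phi> * N * (R powr (n / p - 2 * \<delta>) * R powr (4 * \<delta> - \<sigma>)) * (h powr \<delta> * R powr (- 2 * \<delta>))
      = (CD * CF * C\<phi> * h powr \<delta>) * (N * (R powr (n / p - 2 * \<delta>) * R powr (4 * \<delta> - \<sigma>) * R powr (- 2 * \<delta>)))"
      by (simp only: mult_ac)
    then show ?thesis unfolding e1 e2 by (simp only: mult.assoc mult_1_right)
  qed
  also have "\<dots> \<le> 1 / 4 * (N * ?S) + 1 / 4 * (N * ?S)"
    using \<eta> h pos by (intro add_mono mult_right_mono) auto
  also have "\<dots> = N / 2 * ?S" by simp
  finally show ?thesis .
qed

lemma local_uniqueness:
  fixes u1 u2 :: "real \<Rightarrow> 'a::euclidean_space \<Rightarrow> real"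
  defines "n \<equiv> real DIM('a)"
  assumes \<beta>: "\<beta> > 0" "\<beta> = \<alpha> - 1" and \<gamma>: "\<gamma> > -2"
    and \<sigma>: "\<sigma> * \<beta> = 2 + \<gamma>" "0 < \<sigma>" "\<sigma> \<le> n - 2" and Q: "\<beta> + 1 \<le> Q" "n * \<beta> < 2 * Q"
    and c: "0 \<le> c" "c \<le> n - 2 - \<sigma>" "c \<le> \<sigma> / 2"
    and meas: "\<And>t. t \<in> {0..T} \<Longrightarrow> u1 t \<in> borel_measurable lebesgue" "\<And>t. t \<in> {0..T} \<Longrightarrow> u2 t \<in> borel_measurable lebesgue"
    and cont1: "\<And>t \<eta>. t \<in> {0..T} \<Longrightarrow> \<eta> > 0 \<Longrightarrow> \<exists>h>0. \<forall>t'\<in>{0..T}. \<bar>t' - t\<bar> < h \<longrightarrow> annular_control c \<beta> Q \<sigma> \<eta> (\<lambda>x. u1 t' x - u1 t x)"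
    and cont2: "\<And>t \<eta>. t \<in> {0..T} \<Longrightarrow> \<eta> > 0 \<Longrightarrow> \<exists>h>0. \<forall>t'\<in>{0..T}. \<bar>t' - t\<bar> < h \<longrightarrow> annular_control c \<beta> Q \<sigma> \<eta> (\<lambda>x. u2 t' x - u2 t x)"
    and appr: "\<And>t \<eta>. t \<in> {0..T} \<Longrightarrow> \<eta> > 0 \<Longrightarrow> \<exists>\<phi> M K. \<phi> \<in> borel_measurable lebesgue \<and> (\<forall>y. \<bar>\<phi> y\<bar> \<le> M) \<and>
        (\<forall>y. \<phi> y \<noteq> 0 \<longrightarrow> norm y < 2 powr real_of_int K) \<and> annular_control c \<beta> Q \<sigma> \<eta> (\<lambda>x. u1 t x - \<phi> x)"
    and s1: "hh_solution \<gamma> \<alpha> T u0 u1" and s2: "hh_solution \<gamma> \<alpha> T u0 u2"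
    and t0: "0 \<le> t0" "t0 \<le> T" and eq: "\<And>\<tau>. \<tau> \<in> {0..t0} \<Longrightarrow> AE x in lebesgue. u1 \<tau> x = u2 \<tau> x"
  shows "\<exists>h>0. \<forall>\<tau>\<in>{t0..t0+h}. \<tau> \<le> T \<longrightarrow> (AE x in lebesgue. u1 \<tau> x = u2 \<tau> x)"
proof -
  \<comment> \<open>The exponent conjugate to Q / \<beta>. With it, p \<le> Q is \<beta> + 1 \<le>
    Q, and (n - 2) p < n is n \<beta> < 2 Q.\<close>
  define p where "p = Q / (Q - \<beta>)"
  have Q0: "Q > 0" "Q > \<beta>" using Q \<beta> by auto
  have p: "p > 1" "p \<le> Q" "\<beta> / Q + 1 / p = 1" "(n - 2) * p < n"
  proof -
    show "p > 1" using Q0 \<beta> by (simp add: p_def field_simps)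
    have "Q * 1 \<le> Q * (Q - \<beta>)" using Q Q0 by (intro mult_left_mono) auto
    then show "p \<le> Q" using Q0 by (simp add: p_def divide_le_eq)
    show "\<beta> / Q + 1 / p = 1" using Q0 by (simp add: p_def field_simps)
    show "(n - 2) * p < n" using Q0 Q by (simp add: p_def field_simps)
  qed
  have p0: "p > 0" "p \<ge> 1" using p by auto
  \<comment> \<open>The three entries give, in this order: e \<le> b and c \<le> b - d; convergence
    at the origin for the bounded potential, whose exponent is 2 + \<gamma> - 2 \<delta>; and room
    for (n - 2 + 2 \<delta>) p < n.\<close>
  define \<delta> where "\<delta> = min (\<sigma> / 4) (min ((2 + \<gamma>) / 4) ((n - (n - 2) * p) / (4 * p)))"
  have \<delta>: "\<delta> > 0" "4 * \<delta> \<le> \<sigma>" "4 * \<delta> \<le> 2 + \<gamma>"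
  proof -
    show "\<delta> > 0" using \<sigma> \<gamma> p by (auto simp: \<delta>_def)
    have "\<delta> \<le> \<sigma> / 4" "\<delta> \<le> (2 + \<gamma>) / 4"
      unfolding \<delta>_def by (rule min.cobounded1, rule min.coboundedI2, rule min.cobounded1)
    then show "4 * \<delta> \<le> \<sigma>" "4 * \<delta> \<le> 2 + \<gamma>" by argo+
  qed
  have \<delta>p: "(n - 2 + 2 * \<delta>) * p < n"
  proof -
    have "\<delta> \<le> (n - (n - 2) * p) / (4 * p)"
      unfolding \<delta>_def by (intro min.coboundedI2 order_refl)
    then have "\<delta> * (4 * p) \<le> n - (n - 2) * p" using p0 by (simp add: pos_le_divide_eq)
    moreover have "2 * \<delta> * p < \<delta> * (4 * p)" using \<delta> p0 by simp
    ultimately show ?thesis by (simp add: algebra_simps)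
  qed
  define b where "b = n - 2 - 2 * \<delta>"
  define d where "d = n - 2 - \<sigma>"
  \<comment> \<open>Exceeding d by 2 \<delta> yields the gain R^(2 \<delta>) over the critical
    potential, exactly what the factor (t - t0)^\<delta> R^(-2 \<delta>) compensates.\<close>
  define e where "e = d + 2 * \<delta>"
  have dbe: "0 \<le> d" "d \<le> b" "0 \<le> e" "e \<le> b" "c \<le> d" "c \<le> b - d" "\<gamma> - e + n - \<sigma> > 0"
    using \<delta> \<sigma> c \<gamma> by (auto simp: b_def d_def e_def)
  have ebd: "d - b = 2 * \<delta> - \<sigma>" "e - b = 4 * \<delta> - \<sigma>" by (auto simp: b_def d_def e_def)
  have bound_cont: "\<exists>h>0. \<forall>t'\<in>{0..T}. \<bar>t' - t\<bar> < h \<longrightarrow> annular_bound Q \<sigma> N (\<lambda>x. u t' x - u t x)"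
    if N: "N > 0" and cont: "\<And>\<eta>. \<eta> > 0 \<Longrightarrow> \<exists>h>0. \<forall>t'\<in>{0..T}. \<bar>t' - t\<bar> < h \<longrightarrow> annular_control c \<beta> Q \<sigma> \<eta> (\<lambda>x. u t' x - u t x)"
    for N t and u :: "real \<Rightarrow> 'a \<Rightarrow> real"
  proof -
    obtain h where h: "h > 0" "\<And>t'. t' \<in> {0..T} \<Longrightarrow> \<bar>t' - t\<bar> < h \<Longrightarrow> annular_control c \<beta> Q \<sigma> (N powr \<beta>) (\<lambda>x. u t' x - u t x)"
      using cont[of "N powr \<beta>"] N by auto
    have "annular_bound Q \<sigma> N (\<lambda>x. u t' x - u t x)" if "t' \<in> {0..T}" "\<bar>t' - t\<bar> < h" for t'
      using annular_control_imp_bound[OF Q0(1) \<beta>(1) _ h(2)[OF that]] N \<beta> by (simp add: powr_powr)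
    with h(1) show ?thesis by blast
  qed
  obtain g1 where g1: "case_prod g1 \<in> borel_measurable borel" "\<And>t. t \<in> {0..T} \<Longrightarrow> AE x in lebesgue. g1 t x = u1 t x"
    using ex_jointly_measurable_version[OF Q0(1) meas(1) bound_cont[OF _ cont1]] by auto
  obtain g2 where g2: "case_prod g2 \<in> borel_measurable borel" "\<And>t. t \<in> {0..T} \<Longrightarrow> AE x in lebesgue. g2 t x = u2 t x"
    using ex_jointly_measurable_version[OF Q0(1) meas(2) bound_cont[OF _ cont2]] by auto
  have n2: "2 * \<delta> \<le> n - 2" using \<delta> \<sigma> by linarith
  obtain CD where CD: "CD > 0" "\<forall>t0 t R B. \<forall>(G :: real \<Rightarrow> 'a \<Rightarrow> ennreal) (W :: 'a \<Rightarrow> real).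
    t0 < t \<longrightarrow> R > 0 \<longrightarrow> B > 0 \<longrightarrow> (\<forall>x. W x \<ge> 0) \<longrightarrow> case_prod G \<in> borel_measurable borel \<longrightarrow>
    (\<forall>\<tau>. t0 < \<tau> \<and> \<tau> < t \<longrightarrow> (\<integral>\<^sup>+y. ennreal (max R (norm y) powr (- b)) * G \<tau> y \<partial>lborel) \<le> ennreal B) \<longrightarrow>
    (AE x in lborel. ennreal (W x) \<le> (\<integral>\<^sup>+\<tau>. indicator {t0<..<t} \<tau> * (\<integral>\<^sup>+y. ennreal (heat_kernel (t - \<tau>) (x - y)) * G \<tau> y \<partial>lborel) \<partial>lborel)) \<longrightarrow>
    (\<integral>\<^sup>+x. ennreal (W x powr p) * indicator (ball 0 R) x \<partial>lborel)
      \<le> ennreal ((CD * R powr (n / p - 2 * \<delta>) * min 1 ((t - t0) powr \<delta> * R powr (- 2 * \<delta>)) * B) powr p)"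
    using Duhamel_estimate[where 'a = 'a, OF \<delta>(1) n2[unfolded n_def] p0(2) \<delta>p[unfolded n_def], folded n_def, folded b_def] by (elim exE conjE) (rule that; assumption)
  obtain CF where CF: "CF > 0" "\<And>a b a0 \<phi>. \<bar>\<bar>a\<bar> powr \<beta> * a - \<bar>b\<bar> powr \<beta> * b\<bar>
    \<le> CF * (\<bar>a - a0\<bar> powr \<beta> + \<bar>b - a0\<bar> powr \<beta> + \<bar>a0 - \<phi>\<bar> powr \<beta> + \<bar>\<phi>\<bar> powr \<beta>) * \<bar>a - b\<bar>"
    using power_nonlinearity_split[OF \<beta>(1)] by blast
  define CS where "CS = 2 powr b * 2 * 2 powr \<bar>\<gamma>\<bar>"
  have CS: "CS > 0" by (simp add: CS_def)
  \<comment> \<open>The divisor 12 is 4 times the number of small parts of the potential.\<close>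
  define \<eta> where "\<eta> = 1 / (12 * (CD * CF * CS))"
  have \<eta>: "\<eta> > 0" "CD * CF * (3 * CS * \<eta>) \<le> 1 / 4" using CD CF CS by (auto simp: \<eta>_def)
  have t0T: "t0 \<in> {0..T}" using t0 by auto
  obtain \<phi> M K where \<phi>: "\<phi> \<in> borel_measurable lebesgue" "\<And>y. \<bar>\<phi> y\<bar> \<le> M" "\<And>y. \<phi> y \<noteq> 0 \<Longrightarrow> norm y < 2 powr real_of_int K"
    "annular_control c \<beta> Q \<sigma> \<eta> (\<lambda>x. u1 t0 x - \<phi> x)"
    using appr[OF t0T \<eta>(1)] by blast
  have "\<exists>C>0. \<forall>N w R. N \<ge> 0 \<longrightarrow> R > 0 \<longrightarrow> annular_bound p \<sigma> N w \<longrightarrow>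
    (\<integral>\<^sup>+y. ennreal (max R (norm y) powr (- b) * (norm y powr \<gamma> * \<bar>\<phi> y\<bar> powr \<beta> * \<bar>w y\<bar>)) \<partial>lebesgue)
    \<le> ennreal (C * N * R powr (e - b))"
    by (rule nn_integral_bounded_potential[where M = M and K = K, OF \<phi>(1,2) _ \<beta>(1) p(1) dbe(3,4) dbe(7)[unfolded n_def]]) (rule \<phi>(3))
  then obtain C\<phi> where C\<phi>: "C\<phi> > 0" "\<forall>N w R. N \<ge> 0 \<longrightarrow> R > 0 \<longrightarrow> annular_bound p \<sigma> N w \<longrightarrow>
    (\<integral>\<^sup>+y. ennreal (max R (norm y) powr (- b) * (norm y powr \<gamma> * \<bar>\<phi> y\<bar> powr \<beta> * \<bar>w y\<bar>)) \<partial>lebesgue)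
    \<le> ennreal (C\<phi> * N * R powr (e - b))"
    by (elim exE conjE) (rule that; assumption)
  obtain h1 where h1: "h1 > 0" "\<And>t'. t' \<in> {0..T} \<Longrightarrow> \<bar>t' - t0\<bar> < h1 \<Longrightarrow> annular_control c \<beta> Q \<sigma> \<eta> (\<lambda>x. u1 t' x - u1 t0 x)"
    using cont1[OF t0T \<eta>(1)] by blast
  obtain h2 where h2: "h2 > 0" "\<And>t'. t' \<in> {0..T} \<Longrightarrow> \<bar>t' - t0\<bar> < h2 \<Longrightarrow> annular_control c \<beta> Q \<sigma> \<eta> (\<lambda>x. u2 t' x - u2 t0 x)"
    using cont2[OF t0T \<eta>(1)] by blast
  \<comment> \<open>Solves CD CF C\<phi> h^\<delta> = 1 / 4. Since C\<phi> depends on \<phi>, the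
    step length depends on t0.\<close>
  define h3 where "h3 = (1 / (4 * (CD * CF * C\<phi>))) powr (1 / \<delta>)"
  have h3: "h3 > 0" "CD * CF * C\<phi> * h3 powr \<delta> \<le> 1 / 4"
    using CD CF C\<phi> \<delta> by (auto simp: h3_def powr_powr)
  define h where "h = min (min h1 h2) h3 / 2"
  have h: "h > 0" "h < h1" "h < h2" "h \<le> h3" using h1 h2 h3 by (auto simp: h_def)
  define I where "I = {\<tau>. t0 \<le> \<tau> \<and> \<tau> \<le> t0 + h \<and> \<tau> \<le> T}"
  have I: "\<tau> \<in> {0..T}" "\<bar>\<tau> - t0\<bar> < h1" "\<bar>\<tau> - t0\<bar> < h2" if "\<tau> \<in> I" for \<tau>
    using that t0 h by (auto simp: I_def)
  define w where "w \<tau> x = u1 \<tau> x - u2 \<tau> x" for \<tau> x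
  have wm: "w \<tau> \<in> borel_measurable lebesgue" if "\<tau> \<in> {0..T}" for \<tau>
    unfolding w_def using meas[OF that] by (rule borel_measurable_diff)
  have eq0: "AE x in lebesgue. u1 t0 x = u2 t0 x" using eq t0 by auto
  obtain N1 where N1: "N1 > 0" "\<And>v::'a \<Rightarrow> real. annular_bound Q \<sigma> (\<eta> powr (1 / \<beta>)) v \<Longrightarrow> annular_bound p \<sigma> N1 v"
    using annular_bound_exponent_le[OF p0(1) p(2), of "\<eta> powr (1 / \<beta>)"] \<eta>(1) by auto
  note control_bound = N1(2)[OF annular_control_imp_bound[where c = c, OF Q0(1) \<beta>(1) less_imp_le[OF \<eta>(1)]]]
  \<comment> \<open>The finite bound, uniform on \<open>I\<close>, from which the halving starts.
    The solutions agree at t0, so w is a difference of two controlled increments.\<close>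
  have start: "annular_bound p \<sigma> (4 * N1) (w \<tau>)" if \<tau>: "\<tau> \<in> I" for \<tau>
  proof (rule annular_bound_cong_AE)
    show "annular_bound p \<sigma> (4 * N1) (\<lambda>x. (u1 \<tau> x - u1 t0 x) - (u2 \<tau> x - u2 t0 x))"
      using p0 N1 I[OF \<tau>] by (intro annular_bound_diff control_bound h1(2) h2(2)) auto
    show "w \<tau> \<in> borel_measurable lebesgue" using wm I[OF \<tau>] by blast
    show "AE x in lebesgue. u1 \<tau> x - u1 t0 x - (u2 \<tau> x - u2 t0 x) = w \<tau> x"
      using eq0 by eventually_elim (simp add: w_def)
  qed
  have step: "annular_bound p \<sigma> (N / 2) (w t)"
    if N: "N > 0" and IN: "\<And>\<tau>. \<tau> \<in> I \<Longrightarrow> annular_bound p \<sigma> N (w \<tau>)" and t: "t \<in> I" for N t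
  proof (cases "t = t0")
    case True
    show ?thesis
    proof (rule annular_bound_zero[OF p0(1)])
      show "AE x in lebesgue. w t x = 0" using eq0 unfolding True by eventually_elim (simp add: w_def)
      show "w t \<in> borel_measurable lebesgue" using wm I[OF t] by blast
    qed
  next
    case False
    then have tt: "t0 < t" "t \<le> T" "t \<le> t0 + h" "0 < t" using t t0 by (auto simp: I_def)
    \<comment> \<open>Formed from the Borel versions \<open>g1\<close> and \<open>g2\<close>, since
      \<open>Duhamel_estimate\<close> asks for joint measurability.\<close>
    define G where "G \<tau> y = ennreal (norm y powr \<gamma> * \<bar>\<bar>g1 \<tau> y\<bar> powr \<beta> * g1 \<tau> y - \<bar>g2 \<tau> y\<bar> powr \<beta> * g2 \<tau> y\<bar>)" for \<tau> and y :: 'a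
    have Gm: "case_prod G \<in> borel_measurable borel"
    proof -
      have [measurable]: "case_prod g1 \<in> borel_measurable (borel \<Otimes>\<^sub>M borel)" "case_prod g2 \<in> borel_measurable (borel \<Otimes>\<^sub>M borel)"
        unfolding borel_prod using g1(1) g2(1) by auto
      have "case_prod G \<in> borel_measurable (borel \<Otimes>\<^sub>M borel)"
        unfolding G_def by measurable
      then show ?thesis unfolding borel_prod .
    qed
    have Geq: "AE y in lebesgue. G \<tau> y = ennreal \<bar>hh_nonlin \<gamma> \<alpha> (u1 \<tau>) y - hh_nonlin \<gamma> \<alpha> (u2 \<tau>) y\<bar>" if \<tau>: "\<tau> \<in> {0..T}" for \<tau>
      using g1(2)[OF \<tau>] g2(2)[OF \<tau>]
    proof eventually_elim
      case (elim y)
      have "hh_nonlin \<gamma> \<alpha> (u1 \<tau>) y - hh_nonlin \<gamma> \<alpha> (u2 \<tau>) y = norm y powr \<gamma> * (\<bar>u1 \<tau> y\<bar> powr \<beta> * u1 \<tau> y - \<bar>u2 \<tau> y\<bar> powr \<beta> * u2 \<tau> y)"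
        unfolding hh_nonlin_def \<beta>(2) by (simp only: right_diff_distrib mult.assoc)
      then have "\<bar>hh_nonlin \<gamma> \<alpha> (u1 \<tau>) y - hh_nonlin \<gamma> \<alpha> (u2 \<tau>) y\<bar> = norm y powr \<gamma> * \<bar>\<bar>u1 \<tau> y\<bar> powr \<beta> * u1 \<tau> y - \<bar>u2 \<tau> y\<bar> powr \<beta> * u2 \<tau> y\<bar>"
        by (simp add: abs_mult)
      then show ?case unfolding G_def elim by simp
    qed
    have W: "AE x in lebesgue. ennreal \<bar>w t x\<bar>
      \<le> (\<integral>\<^sup>+\<tau>. indicator {t0<..<t} \<tau> * (\<integral>\<^sup>+y. ennreal (heat_kernel (t - \<tau>) (x - y)) * G \<tau> y \<partial>lborel) \<partial>lborel)"
      unfolding w_def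
    proof (rule Duhamel_difference[OF s1 s2 tt(4,2)])
      show "AE y in lebesgue. u1 \<tau> y = u2 \<tau> y" if "0 < \<tau>" "\<tau> \<le> t0" for \<tau> using eq that by auto
      show "AE y in lebesgue. G \<tau> y = ennreal \<bar>hh_nonlin \<gamma> \<alpha> (u1 \<tau>) y - hh_nonlin \<gamma> \<alpha> (u2 \<tau>) y\<bar>" if "0 < \<tau>" "\<tau> < t" for \<tau>
        using that tt by (intro Geq) auto
    qed
    have "(\<integral>\<^sup>+x. ennreal (\<bar>w t x\<bar> powr p) * indicator (annulus j) x \<partial>lebesgue)
        \<le> ennreal ((N / 2 * 2 powr (- real_of_int j * (\<sigma> - n / p))) powr p)" for j
    proof -
      define R where "R = (2::real) powr real_of_int j"
      have R: "R > 0" by (simp add: R_def)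
      define B where "B = CF * (3 * (CS * \<eta> * N * R powr (2 * \<delta> - \<sigma>)) + C\<phi> * N * R powr (4 * \<delta> - \<sigma>))"
      have B: "B > 0" unfolding B_def using CF CS \<eta> N R C\<phi> by (intro mult_pos_pos add_pos_pos) auto
      have GB: "(\<integral>\<^sup>+y. ennreal (max R (norm y) powr (- b)) * G \<tau> y \<partial>lborel) \<le> ennreal B" if \<tau>: "t0 < \<tau> \<and> \<tau> < t" for \<tau>
      proof -
        have \<tau>I: "\<tau> \<in> I" using \<tau> tt by (auto simp: I_def)
        note \<tau>T = I[OF \<tau>I]
        define v2 where "v2 y = u2 \<tau> y - u2 t0 y" for y
        have Gle: "AE y in lebesgue. G \<tau> y \<le> ennreal (norm y powr \<gamma> * (CF * (\<bar>u1 \<tau> y - u1 t0 y\<bar> powr \<beta> + \<bar>v2 y\<bar> powr \<beta> + \<bar>u1 t0 y - \<phi> y\<bar> powr \<beta> + \<bar>\<phi> y\<bar> powr \<beta>) * \<bar>w \<tau> y\<bar>))"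
          using g1(2)[OF \<tau>T(1)] g2(2)[OF \<tau>T(1)] eq0
        proof eventually_elim
          case (elim y)
          \<comment> \<open>Agreement at t0 makes u1 t0 a common reference for both solutions, so
            that one test function serves both.\<close>
          have v2: "v2 y = u2 \<tau> y - u1 t0 y" using elim(3) by (simp add: v2_def)
          show ?case unfolding G_def elim(1,2) v2 w_def
            by (intro ennreal_leI mult_left_mono CF(2)) auto
        qed
        have "(\<integral>\<^sup>+y. ennreal (max (2 powr real_of_int j) (norm y) powr (- b)) * G \<tau> y \<partial>lebesgue)
          \<le> ennreal (CF * (3 * (2 powr b * 2 * 2 powr \<bar>\<gamma>\<bar> * \<eta> * N * 2 powr (real_of_int j * (n - 2 - \<sigma> - b))) + C\<phi> * N * R powr (e - b)))"
          unfolding n_def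
        proof (rule nn_integral_split_potential[where ?v3.0 = "\<lambda>x. u1 t0 x - \<phi> x", OF \<beta>(1) Q0(1) p0(1) p(3) \<sigma>(1) _ _ _ _ _ _ _ _ _ _ _ _ _ _ _ Gle])
          show "annular_control c \<beta> Q \<sigma> \<eta> (\<lambda>x. u1 \<tau> x - u1 t0 x)" using \<tau>T by (intro h1)
          show "annular_control c \<beta> Q \<sigma> \<eta> v2" unfolding v2_def using \<tau>T by (intro h2)
          show "annular_bound p \<sigma> N (w \<tau>)" by (rule IN[OF \<tau>I])
          show "(\<integral>\<^sup>+y. ennreal (max (2 powr real_of_int j) (norm y) powr (- b) * (norm y powr \<gamma> * \<bar>\<phi> y\<bar> powr \<beta> * \<bar>w \<tau> y\<bar>)) \<partial>lebesgue) \<le> ennreal (C\<phi> * N * R powr (e - b))"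
            using C\<phi>(2)[rule_format, OF _ R IN[OF \<tau>I]] N unfolding R_def by simp
        qed (use \<phi> N \<eta> CF C\<phi> c dbe in \<open>auto simp: d_def n_def\<close>)
        also have "2 powr b * 2 * 2 powr \<bar>\<gamma>\<bar> * \<eta> * N * 2 powr (real_of_int j * (n - 2 - \<sigma> - b)) = CS * \<eta> * N * R powr (2 * \<delta> - \<sigma>)"
        proof -
          have "n - 2 - \<sigma> - b = 2 * \<delta> - \<sigma>" using ebd(1) unfolding d_def .
          then have "2 powr (real_of_int j * (n - 2 - \<sigma> - b)) = R powr (2 * \<delta> - \<sigma>)"
            by (simp only: R_def powr_powr)
          then show ?thesis by (simp only: CS_def)
        qed
        finally show ?thesis unfolding nn_integral_completion B_def ebd R_def .
      qed
      \<comment> \<open>R = 2^j is the outer radius of annulus j, so the estimate over the ball is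
        no loss.\<close>
      have "(\<integral>\<^sup>+x. ennreal (\<bar>w t x\<bar> powr p) * indicator (annulus j) x \<partial>lebesgue) \<le> (\<integral>\<^sup>+x. ennreal (\<bar>w t x\<bar> powr p) * indicator (ball 0 R) x \<partial>lborel)"
        unfolding nn_integral_completion
        by (intro nn_integral_mono mult_left_mono) (auto simp: indicator_def annulus_def R_def)
      also have "\<dots> \<le> ennreal ((CD * R powr (n / p - 2 * \<delta>) * min 1 ((t - t0) powr \<delta> * R powr (- 2 * \<delta>)) * B) powr p)"
        using CD(2)[rule_format, OF tt(1) R B _ Gm GB, of "\<lambda>x. \<bar>w t x\<bar>"] W by (simp add: AE_completion_iff)
      also have "\<dots> \<le> ennreal ((N / 2 * R powr (n / p - \<sigma>)) powr p)"
      proof (intro ennreal_leI powr_mono2)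
        show "CD * R powr (n / p - 2 * \<delta>) * min 1 ((t - t0) powr \<delta> * R powr (- 2 * \<delta>)) * B \<le> N / 2 * R powr (n / p - \<sigma>)"
          unfolding B_def using tt h
          by (intro shell_contraction_arith[OF R CD(1) CF(1) CS C\<phi>(1) N \<eta> h3(2)] \<delta>) auto
        show "0 \<le> CD * R powr (n / p - 2 * \<delta>) * min 1 ((t - t0) powr \<delta> * R powr (- 2 * \<delta>)) * B"
          using CD B by (intro mult_nonneg_nonneg) auto
      qed (use p0 in simp)
      also have "R powr (n / p - \<sigma>) = 2 powr (- real_of_int j * (\<sigma> - n / p))"
        by (simp add: R_def powr_powr algebra_simps)
      finally show ?thesis .
    qed
    then show ?thesis using wm[OF I(1)[OF t]] unfolding annular_bound_def n_def by blast
  qed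
  have all: "\<forall>\<tau>\<in>I. annular_bound p \<sigma> (4 * N1 / 2 ^ i) (w \<tau>)" for i :: nat
  proof (induction i)
    case 0
    then show ?case using start by simp
  next
    case (Suc i)
    have "annular_bound p \<sigma> (4 * N1 / 2 ^ i / 2) (w \<tau>)" if "\<tau> \<in> I" for \<tau>
      using N1 Suc that by (intro step) auto
    then show ?case by (simp add: field_simps)
  qed
  have "AE x in lebesgue. u1 \<tau> x = u2 \<tau> x" if "\<tau> \<in> I" for \<tau>
  proof -
    have "AE x in lebesgue. w \<tau> x = 0"
      using all that N1 by (intro annular_bound_geometric_imp_zero[OF p0(1), of "4 * N1"]) auto
    then show ?thesis by eventually_elim (simp add: w_def)
  qed
  with h(1) show ?thesis by (intro exI[of _ h]) (auto simp: I_def)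
qed

section \<open>From the hypotheses of the theorem to local uniqueness, and continuation in
  time\<close>

lemma Cc_inf_bounded_support:
  fixes \<phi> :: "'a::euclidean_space \<Rightarrow> real"
  assumes "Cc_inf \<phi>"
  shows "\<phi> \<in> borel_measurable lebesgue" "\<exists>M. \<forall>y. \<bar>\<phi> y\<bar> \<le> M" "\<exists>K. \<forall>y. \<phi> y \<noteq> 0 \<longrightarrow> norm y < 2 powr real_of_int K"
proof -
  have "Ck 0 \<phi>" and cpt: "compact (closure {x. \<phi> x \<noteq> 0})" using assms unfolding Cc_inf_def by blast+
  then have cont: "continuous_on UNIV \<phi>" by simp
  then have "\<phi> \<in> borel_measurable borel" by (rule borel_measurable_continuous_onI)
  then have "\<phi> \<in> borel_measurable lborel" by simp
  then show "\<phi> \<in> borel_measurable lebesgue" by (rule measurable_completion)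
  have out: "y \<in> closure {x. \<phi> x \<noteq> 0}" if "\<phi> y \<noteq> 0" for y
    using that closure_subset[of "{x. \<phi> x \<noteq> 0}"] by blast
  have "bounded (\<phi> ` closure {x. \<phi> x \<noteq> 0})"
    using cont cpt by (intro compact_imp_bounded compact_continuous_image) (auto intro: continuous_on_subset)
  then obtain M where M: "\<And>y. y \<in> closure {x. \<phi> x \<noteq> 0} \<Longrightarrow> \<bar>\<phi> y\<bar> \<le> M" "M > 0"
    unfolding bounded_pos by auto
  have "\<bar>\<phi> y\<bar> \<le> M" for y using M out[of y] by (cases "\<phi> y = 0") auto
  then show "\<exists>M. \<forall>y. \<bar>\<phi> y\<bar> \<le> M" by blast
  obtain B where B: "\<And>y. y \<in> closure {x. \<phi> x \<noteq> 0} \<Longrightarrow> norm y \<le> B" "B > 0"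
    using compact_imp_bounded[OF cpt] unfolding bounded_pos by auto
  have "norm y < 2 powr real_of_int (\<lfloor>log 2 B\<rfloor> + 1)" if "\<phi> y \<noteq> 0" for y
    using B(1)[OF out[OF that]] dyadic_floor(2)[OF B(2)] by (rule order_le_less_trans)
  then show "\<exists>K. \<forall>y. \<phi> y \<noteq> 0 \<longrightarrow> norm y < 2 powr real_of_int K" by blast
qed

lemma annular_control_zero:
  assumes "Q > 0" "\<eta> \<ge> 0"
  shows "annular_control c \<beta> Q \<sigma> \<eta> (\<lambda>x::'a::euclidean_space. 0)"
  unfolding annular_control_def using assms by (intro conjI exI[of _ "\<lambda>_. 0"]) auto

lemma herz_continuous_imp_control:
  fixes u :: "real \<Rightarrow> 'a::euclidean_space \<Rightarrow> real"
  assumes u: "herz_continuous s q r T u" and \<beta>: "\<beta> > 0" and Q: "Q > 0" and D: "D > 0"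
    and ctrl: "\<And>\<epsilon> (f::'a \<Rightarrow> real). \<epsilon> > 0 \<Longrightarrow> f \<in> borel_measurable lebesgue \<Longrightarrow>
     herz_norm s q r f \<le> ennreal \<epsilon> \<Longrightarrow> annular_control c \<beta> Q \<sigma> (D * \<epsilon> powr \<beta>) f"
  shows "\<And>t. t \<in> {0..T} \<Longrightarrow> u t \<in> borel_measurable lebesgue"
    and "\<And>t \<eta>. t \<in> {0..T} \<Longrightarrow> \<eta> > 0 \<Longrightarrow> \<exists>h>0. \<forall>t'\<in>{0..T}. \<bar>t' - t\<bar> < h \<longrightarrow> annular_control c \<beta> Q \<sigma> \<eta> (\<lambda>x. u t' x - u t x)"
    and "\<And>t \<eta>. t \<in> {0..T} \<Longrightarrow> \<eta> > 0 \<Longrightarrow> \<exists>\<phi> M K. \<phi> \<in> borel_measurable lebesgue \<and> (\<forall>y. \<bar>\<phi> y\<bar> \<le> M) \<and>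
        (\<forall>y. \<phi> y \<noteq> 0 \<longrightarrow> norm y < 2 powr real_of_int K) \<and> annular_control c \<beta> Q \<sigma> \<eta> (\<lambda>x. u t x - \<phi> x)"
proof -
  have cl: "u t \<in> herz_closure s q r" if "t \<in> {0..T}" for t
    using u that unfolding herz_continuous_def by blast
  show meas: "u t \<in> borel_measurable lebesgue" if "t \<in> {0..T}" for t
    using cl[OF that] unfolding herz_closure_def herz_space_def by blast
  \<comment> \<open>The threshold (\<eta> / D)^(1 / \<beta>) is the solution \<epsilon> of D
    \<epsilon>^\<beta> = \<eta>.\<close>
  have ctrl': "annular_control c \<beta> Q \<sigma> \<eta> f"
    if "\<eta> > 0" "f \<in> borel_measurable lebesgue" "herz_norm s q r f < ennreal ((\<eta> / D) powr (1 / \<beta>))" for \<eta> and f :: "'a \<Rightarrow> real"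
    using ctrl[of "(\<eta> / D) powr (1 / \<beta>)" f] that D \<beta> by (simp add: powr_powr)
  show "\<exists>h>0. \<forall>t'\<in>{0..T}. \<bar>t' - t\<bar> < h \<longrightarrow> annular_control c \<beta> Q \<sigma> \<eta> (\<lambda>x. u t' x - u t x)"
    if t: "t \<in> {0..T}" and \<eta>: "\<eta> > 0" for t \<eta>
  proof -
    have "((\<lambda>t'. herz_norm s q r (\<lambda>x. u t' x - u t x)) \<longlongrightarrow> 0) (at t within {0..T})"
      using u t unfolding herz_continuous_def by blast
    then have "\<forall>\<^sub>F t' in at t within {0..T}. herz_norm s q r (\<lambda>x. u t' x - u t x) < ennreal ((\<eta> / D) powr (1 / \<beta>))"
      using \<eta> D by (intro order_tendstoD(2)) auto
    then obtain h where h: "h > 0" "\<And>t'. t' \<in> {0..T} \<Longrightarrow> t' \<noteq> t \<Longrightarrow> dist t' t < h \<Longrightarrow> herz_norm s q r (\<lambda>x. u t' x - u t x) < ennreal ((\<eta> / D) powr (1 / \<beta>))"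
      unfolding eventually_at by blast
    have "annular_control c \<beta> Q \<sigma> \<eta> (\<lambda>x. u t' x - u t x)" if t': "t' \<in> {0..T}" "\<bar>t' - t\<bar> < h" for t'
    \<comment> \<open>The limit excludes the point t itself, where the increment is the zero
      function.\<close>
    proof (cases "t' = t")
      case True
      then show ?thesis using annular_control_zero[OF Q, of \<eta>] \<eta> by simp
    next
      case False
      show ?thesis
        by (rule ctrl'[OF \<eta> borel_measurable_diff[OF meas[OF t'(1)] meas[OF t]] h(2)[OF t'(1) False]]) (use t' in \<open>simp add: dist_real_def\<close>)
    qed
    with h(1) show ?thesis by blast
  qed
  show "\<exists>\<phi> M K. \<phi> \<in> borel_measurable lebesgue \<and> (\<forall>y. \<bar>\<phi> y\<bar> \<le> M) \<and>
        (\<forall>y. \<phi> y \<noteq> 0 \<longrightarrow> norm y < 2 powr real_of_int K) \<and> annular_control c \<beta> Q \<sigma> \<eta> (\<lambda>x. u t x - \<phi> x)"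
    if t: "t \<in> {0..T}" and \<eta>: "\<eta> > 0" for t \<eta>
  proof -
    have "(\<eta> / D) powr (1 / \<beta>) > 0" using \<eta> D by simp
    then obtain \<phi> where \<phi>: "Cc_inf \<phi>" "herz_norm s q r (\<lambda>x. u t x - \<phi> x) < ennreal ((\<eta> / D) powr (1 / \<beta>))"
      using cl[OF t] unfolding herz_closure_def by blast
    note bs = Cc_inf_bounded_support[OF \<phi>(1)]
    have "annular_control c \<beta> Q \<sigma> \<eta> (\<lambda>x. u t x - \<phi> x)"
      by (rule ctrl'[OF \<eta> borel_measurable_diff[OF meas[OF t] bs(1)] \<phi>(2)])
    with bs show ?thesis by blast
  qed
qed

theorem theorem1p2:
  fixes \<gamma> \<alpha> s T :: real and q r :: ereal
    and u0 :: "real ^ 'n \<Rightarrow> real" and u1 u2 :: "real \<Rightarrow> real ^ 'n \<Rightarrow> real"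
  defines "n \<equiv> real CARD('n)"
  defines "qi \<equiv> real_of_ereal (1 / q)"
  assumes n3: "CARD('n) \<ge> 3"
    and T: "T > 0"
    and \<alpha>1: "\<alpha> > 1"
    and \<gamma>: "\<gamma> > - min 2 n"
    and \<alpha>: "\<alpha> \<ge> max 1 (1 + \<gamma> / n)"
    and s: "\<gamma> / (\<alpha> - 1) < s" "s \<le> n"
    and q: "1 \<le> q" "ereal \<alpha> \<le> q"
    and r: "0 < r"
    and pos: "s / n + qi > 0"
    and expo: "s / n + qi < 1 \<or> (s / n + qi = 1 \<and> r \<le> 1)"
    and cases:
      "(s / n + qi = 1 / crit_qc n \<gamma> \<alpha> \<and> 1 / crit_qc n \<gamma> \<alpha> < 1 / crit_Qc n \<gamma> \<alpha>
          \<and> q < \<infinity> \<and> r = \<infinity>)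
       \<or> (s / n + qi = 1 / crit_qc n \<gamma> \<alpha> \<and> 1 / crit_qc n \<gamma> \<alpha> = 1 / crit_Qc n \<gamma> \<alpha>
          \<and> ((q < \<infinity> \<and> r \<le> ereal (\<alpha> - 1)) \<or> (q \<le> \<infinity> \<and> r \<le> ereal (min 1 (\<alpha> - 1)))))"
    and u0: "u0 \<in> herz_closure s q r"
    and u1c: "herz_continuous s q r T u1" and u2c: "herz_continuous s q r T u2"
    and u1s: "hh_solution \<gamma> \<alpha> T u0 u1" and u2s: "hh_solution \<gamma> \<alpha> T u0 u2"
  shows "\<forall>t\<in>{0..T}. AE x in lebesgue. u1 t x = u2 t x"
proof -
  have n: "n \<ge> 3" "n > 0" using n3 by (auto simp: n_def)
  define \<beta> where "\<beta> = \<alpha> - 1"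
  have \<beta>: "\<beta> > 0" "\<beta> = \<alpha> - 1" using \<alpha>1 by (auto simp: \<beta>_def)
  have \<gamma>2: "\<gamma> > -2" "n + \<gamma> > 0" using \<gamma> by auto
  \<comment> \<open>The scaling exponent: the equation is invariant under passing from u to
    \<lambda>^\<sigma> u(\<lambda>^2 t, \<lambda> x).\<close>
  define \<sigma> where "\<sigma> = (2 + \<gamma>) / \<beta>"
  have \<sigma>\<beta>: "\<sigma> * \<beta> = 2 + \<gamma>" and \<sigma>0: "\<sigma> > 0" using \<beta> \<gamma>2 by (auto simp: \<sigma>_def)
  have qc: "1 / crit_qc n \<gamma> \<alpha> = \<sigma> / n" by (simp add: crit_qc_def \<sigma>_def \<beta>_def)
  have Qc: "1 / crit_Qc n \<gamma> \<alpha> = (n + \<gamma>) / \<alpha> / n" by (simp add: crit_Qc_def)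
  have \<sigma>s: "\<sigma> = s + n * qi"
  proof -
    have "s / n + qi = \<sigma> / n" using cases unfolding qc by blast
    then show ?thesis using n by (simp add: field_simps)
  qed
  have lt: "\<sigma> < n - 2 \<longleftrightarrow> 1 / crit_qc n \<gamma> \<alpha> < 1 / crit_Qc n \<gamma> \<alpha>"
    and eq: "\<sigma> = n - 2 \<longleftrightarrow> 1 / crit_qc n \<gamma> \<alpha> = 1 / crit_Qc n \<gamma> \<alpha>"
  proof -
    \<comment> \<open>This identity turns the comparison of \<sigma> with (n + \<gamma>) / \<alpha>
      into one of \<sigma> with n - 2.\<close>
    have "\<sigma> * \<alpha> = \<sigma> + 2 + \<gamma>" using \<sigma>\<beta> by (simp add: \<beta>_def algebra_simps)
    then have "\<sigma> < (n + \<gamma>) / \<alpha> \<longleftrightarrow> \<sigma> < n - 2" "\<sigma> = (n + \<gamma>) / \<alpha> \<longleftrightarrow> \<sigma> = n - 2"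
      using \<alpha>1 by (auto simp: pos_less_divide_eq eq_divide_eq)
    moreover have "a / n < b / n \<longleftrightarrow> a < b" "a / n = b / n \<longleftrightarrow> a = b" for a b :: real
      using n by (auto simp: divide_less_cancel)
    ultimately show "\<sigma> < n - 2 \<longleftrightarrow> 1 / crit_qc n \<gamma> \<alpha> < 1 / crit_Qc n \<gamma> \<alpha>"
      "\<sigma> = n - 2 \<longleftrightarrow> 1 / crit_qc n \<gamma> \<alpha> = 1 / crit_Qc n \<gamma> \<alpha>"
      unfolding qc Qc by blast+
  qed
  have rs: "(\<sigma> < n - 2 \<and> r = \<infinity>) \<or> (\<sigma> = n - 2 \<and> r \<le> ereal \<beta>)"
  proof -
    have "ereal (min 1 (\<alpha> - 1)) \<le> ereal \<beta>" by (simp add: \<beta>_def)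
    then show ?thesis using cases unfolding lt eq \<beta>(2) by (auto intro: order_trans)
  qed
  then have \<sigma>n: "\<sigma> \<le> n - 2" by auto
  \<comment> \<open>The decay rate between annuli: positive when \<sigma> < n - 2, and zero when
    \<sigma> = n - 2, where r \<le> \<alpha> - 1 takes over. The bound \<sigma> / 2 lies below the
    outward rate b - d = \<sigma> - 2 \<delta> of \<open>local_uniqueness\<close>.\<close>
  define c where "c = min (n - 2 - \<sigma>) (\<sigma> / 2)"
  have c: "0 \<le> c" "c \<le> n - 2 - \<sigma>" "c \<le> \<sigma> / 2"
  proof -
    show "0 \<le> c" using \<sigma>n \<sigma>0 by (simp add: c_def)
  qed (simp_all only: c_def min.cobounded1 min.cobounded2)
  have rc: "(r = \<infinity> \<and> c > 0) \<or> (r \<le> ereal \<beta> \<and> c \<ge> 0)" using rs c \<sigma>0 by (auto simp: c_def)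
  \<comment> \<open>For q = \<infinity> any large finite exponent will do: \<alpha> ensures \<beta>
    + 1 \<le> Q, and n \<beta> > 0 ensures n \<beta> < 2 Q.\<close>
  define Q where "Q = (if q = \<infinity> then max \<alpha> (n * \<beta>) else real_of_ereal q)"
  have Q: "\<beta> + 1 \<le> Q" "n * \<beta> < 2 * Q" "(q = ereal Q \<and> s = \<sigma> - n / Q) \<or> (q = \<infinity> \<and> s = \<sigma>)"
  proof -
    have "\<beta> + 1 \<le> Q \<and> n * \<beta> < 2 * Q \<and> ((q = ereal Q \<and> s = \<sigma> - n / Q) \<or> (q = \<infinity> \<and> s = \<sigma>))"
    proof (cases "q = \<infinity>")
      case True
      then have "qi = 0" by (simp add: qi_def)
      moreover have "n * \<beta> > 0" using n \<beta> by simp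
      ultimately show ?thesis using True \<sigma>s by (auto simp: Q_def \<beta>_def)
    next
      case False
      then have q': "q = ereal Q" using q(1) by (cases q) (auto simp: Q_def)
      have Q\<alpha>: "\<alpha> \<le> Q" "Q > 0" using q(2) \<alpha>1 unfolding q' by auto
      have "qi = 1 / Q" unfolding qi_def q' using Q\<alpha> by (simp add: one_ereal_def)
      then have s': "s = \<sigma> - n / Q" using \<sigma>s by simp
      \<comment> \<open>The hypothesis s > \<gamma> / \<beta> in disguise, since s = \<sigma> - n /
        Q and \<gamma> / \<beta> = \<sigma> - 2 / \<beta>.\<close>
      have "n / Q < 2 / \<beta>" using s(1) unfolding s' \<sigma>_def \<beta>_def[symmetric] by (simp add: add_divide_distrib)
      then have "n * \<beta> < 2 * Q" using Q\<alpha> \<beta>(1) by (simp add: field_simps)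
      then show ?thesis using q' s' Q\<alpha> by (simp add: \<beta>_def)
    qed
    then show "\<beta> + 1 \<le> Q" "n * \<beta> < 2 * Q" "(q = ereal Q \<and> s = \<sigma> - n / Q) \<or> (q = \<infinity> \<and> s = \<sigma>)" by blast+
  qed
  have Q0: "Q > 0" using Q \<beta> by linarith
  have dim: "real DIM(real ^ 'n) = n" by (simp add: n_def)
  obtain D where D: "D > 0" "\<And>\<epsilon> (f::real ^ 'n \<Rightarrow> real). \<epsilon> > 0 \<Longrightarrow> f \<in> borel_measurable lebesgue \<Longrightarrow>
     herz_norm s q r f \<le> ennreal \<epsilon> \<Longrightarrow> annular_control c \<beta> Q \<sigma> (D * \<epsilon> powr \<beta>) f"
    using herz_norm_imp_annular_control[where 'a = "real ^ 'n", OF Q0 Q(3)[folded dim] \<beta>(1) r rc] by blast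
  note C1 = herz_continuous_imp_control[OF u1c \<beta>(1) Q0 D]
  note C2 = herz_continuous_imp_control[OF u2c \<beta>(1) Q0 D]
  have local: "\<exists>h>0. \<forall>\<tau>\<in>{t0..t0+h}. \<tau> \<le> T \<longrightarrow> (AE x in lebesgue. u1 \<tau> x = u2 \<tau> x)"
    if "0 \<le> t0" "t0 \<le> T" "\<And>\<tau>. \<tau> \<in> {0..t0} \<Longrightarrow> AE x in lebesgue. u1 \<tau> x = u2 \<tau> x" for t0
    by (rule local_uniqueness[OF \<beta> \<gamma>2(1) \<sigma>\<beta> \<sigma>0 _ Q(1) _ c(1) _ c(3) C1(1) C2(1) C1(2) C2(2) C1(3) u1s u2s that])
      (use Q c \<sigma>n in \<open>simp_all only: dim\<close>)
  have u12: "AE x in lebesgue. u1 0 x = u2 0 x"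
  proof -
    have "AE x in lebesgue. u1 0 x = u0 x" "AE x in lebesgue. u2 0 x = u0 x"
      using u1s u2s unfolding hh_solution_def by blast+
    then show ?thesis by eventually_elim simp
  qed
  define E where "E \<tau> \<longleftrightarrow> (AE x in lebesgue. u1 \<tau> x = u2 \<tau> x)" for \<tau>
  define A where "A = {t\<in>{0..T}. \<forall>\<tau>\<in>{0..t}. E \<tau>}"
  have A0: "0 \<in> A" using T u12 by (auto simp: A_def E_def)
  have Abdd: "bdd_above A" by (auto simp: A_def)
  define m where "m = Sup A"
  have m: "0 \<le> m" "m \<le> T"
  proof -
    show "0 \<le> m" unfolding m_def by (rule cSup_upper[OF A0 Abdd])
    have "A \<noteq> {}" "\<And>t. t \<in> A \<Longrightarrow> t \<le> T" using A0 by (auto simp: A_def)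
    then show "m \<le> T" unfolding m_def by (rule cSup_least)
  qed
  have below: "E \<tau>" if \<tau>: "0 \<le> \<tau>" "\<tau> < m" for \<tau>
  proof -
    have "A \<noteq> {}" using A0 by blast
    then obtain t where "t \<in> A" "\<tau> < t" using less_cSupD[of A \<tau>] \<tau> unfolding m_def by blast
    then show ?thesis using \<tau> by (auto simp: A_def)
  qed
  have "E m"
  proof (cases "m = 0")
    case True
    then show ?thesis using u12 by (simp add: E_def)
  next
    case False
    then have "0 < m" using m by simp
    \<comment> \<open>With t0 = t = m the time interval on the right is empty. Agreement thus passes
      to the supremum through the Duhamel formula, without a limit in the Herz norm.\<close>
    from Duhamel_difference[OF u1s u2s this m(2), where ?t0.0 = m and G = "\<lambda>_ _. 0"]
    have "AE x in lebesgue. ennreal \<bar>u1 m x - u2 m x\<bar> \<le> 0"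
      using below by (auto simp: E_def)
    then show ?thesis unfolding E_def by eventually_elim (simp add: ennreal_eq_0_iff)
  qed
  then have upto: "E \<tau>" if "\<tau> \<in> {0..m}" for \<tau>
    using that below by (cases "\<tau> = m") auto
  have "m = T"
  proof (rule ccontr)
    assume "m \<noteq> T"
    then have mT: "m < T" using m by simp
    obtain h where h: "h > 0" "\<forall>\<tau>\<in>{m..m+h}. \<tau> \<le> T \<longrightarrow> E \<tau>"
      using local[OF m] upto unfolding E_def by blast
    have "E \<tau>" if "0 \<le> \<tau>" "\<tau> \<le> min (m + h) T" for \<tau>
      using that h(2) upto[of \<tau>] by (cases "\<tau> \<le> m") auto
    then have "min (m + h) T \<in> A"
      unfolding A_def using h(1) m by auto
    then have "min (m + h) T \<le> m" unfolding m_def by (intro cSup_upper Abdd)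
    then show False using h mT by auto
  qed
  then show ?thesis using upto by (simp add: E_def)
qed

end
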